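(* Let $L>0$, $\Omega=(0,L)\times\mathbb{T}\times\mathbb{T}$ with $\mathbb{T}$ the torus of period $1$, and let $D_1,D_2,\epsilon,\nu,K>0$ and $\alpha_1,\alpha_2,\beta_1,\beta_2,V>0$ be constants. Consider the Nernst-Planck-Stokes system on $\Omega$ $$\partial_tc_1+u\cdot\nabla c_1=D_1\operatorname{div}(\nabla c_1+c_1\nabla\Phi),\qquad \partial_tc_2+u\cdot\nabla c_2=D_2\operatorname{div}(\nabla c_2-c_2\nabla\Phi),$$ $$-\epsilon\Delta\Phi=\rho=c_1-c_2,\qquad \partial_tu-\nu\Delta u+\nabla p=-K\rho\nabla\Phi,\qquad\operatorname{div}u=0\qquad(\ast)$$ with boundary conditions $$c_i(t,0,y,z)=\alpha_i,\quad c_i(t,L,y,z)=\beta_i,\quad \Phi(t,0,y,z)=-V,\quad\Phi(t,L,y,z)=0,\quad u(t,0,y,z)=u(t,L,y,z)=0.\qquad(\ast\ast)$$ Suppose $(c_1^*,c_2^*,u^*\equiv0)$, with potential $\Phi^*$, is a one dimensional steady current solution of $(\ast)$ with boundary conditions $(\ast\ast)$, and let $j_1,j_2$ be its p-current and n-current. Suppose furthermore that $$\max_i|j_i|\,L\,G_i<\frac1{\sqrt2},\qquad\text{where}\quad G_i=\sqrt{\frac1D\left(\frac{D_i\overline\gamma^2}{2\underline\gamma^4}+\frac{KL^2\overline\gamma^2}{\nu\underline\gamma^3}\right)},$$ $D=\min_iD_i$, $\underline\gamma=\min\{\alpha_1,\alpha_2,\beta_1,\beta_2\}$ and $\overline\gamma=\max\{\alpha_1,\alpha_2,\beta_1,\beta_2\}$.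 Then $(c_1^*,c_2^*,u^*\equiv0)$ is globally asymptotically stable; that is, for any smooth initial conditions $c_1(0)\ge0$, $c_2(0)\ge0$, $u(0)$ (with $\operatorname{div}u(0)=0$), the corresponding solution $(c_1,c_2,u)$ of $(\ast)$ with boundary conditions $(\ast\ast)$ satisfies $$\sum_{i=1}^2\int_\Omega c_i^*\,\psi\!\left(\frac{c_i(t)}{c_i^*}\right)dV+\int_\Omega|\nabla(\Phi(t)-\Phi^* )|^2\,dV+\int_\Omega|u(t)|^2\,dV\to0\quad\text{as }t\to\infty.$$ Furthermore, there exists $T^*>0$, depending on the initial and boundary data and the parameters of the system, such that after time $t=T^*$ this convergence is exponential in time (i.e. the left hand side is bounded for $t\ge T^*$ by $Ce^{-\kappa t}$ for some constants $C,\kappa>0$).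
   Context: $\psi(s)=s\log s-s+1$ for $s>0$. One dimensional steady current solution: $(c_1^*,c_2^*,u^*\equiv0)$ is called a (one dimensional) steady current solution if $c_1^*,c_2^*$ (and $\Phi^*$) are independent of $y$, $z$ and $t$, and, as functions of $x\in(0,L)$, they are a smooth solution of $$0=\partial_x(\partial_xc_1^*+c_1^*\partial_x\Phi^* ),\qquad 0=\partial_x(\partial_xc_2^*-c_2^*\partial_x\Phi^* ),\qquad -\epsilon\,\partial_{xx}\Phi^*=c_1^*-c_2^*,$$ with $c_i^*(0)=\alpha_i$, $c_i^*(L)=\beta_i$, $\Phi^*(0)=-V$, $\Phi^*(L)=0$. (Together with $u^*\equiv 0$ and a suitable pressure these solve the three dimensional steady system.) The p-current $j_1$ and n-current $j_2$ are the constants $$j_1=\partial_xc_1^*+c_1^*\partial_x\Phi^*,\qquad j_2=\partial_xc_2^*-c_2^*\partial_x\Phi^*.$$ *)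

theory Defs
  imports "HOL-Analysis.Analysis"
begin

section \<open>Smooth functions\<close>

text \<open>Regularity on a set \<open>S\<close> that need not be open, through derivatives within \<open>S\<close>. It is
  only used for convex sets with non-empty interior; there derivatives within \<open>S\<close> are unique, and
  the notion is that of functions all of whose derivatives extend continuously from the interior
  to \<open>S\<close>.\<close>

primrec Ck_on :: "nat \<Rightarrow> 'a::euclidean_space set \<Rightarrow> ('a \<Rightarrow> 'b::real_normed_vector) \<Rightarrow> bool" where
  "Ck_on 0 S f \<longleftrightarrow> continuous_on S f"
| "Ck_on (Suc k) S f \<longleftrightarrow>
     (\<exists>f'. (\<forall>x\<in>S. (f has_derivative f' x) (at x within S)) \<and>
           (\<forall>b\<in>Basis. Ck_on k S (\<lambda>x. f' x b)))"

definition smooth_on :: "'a::euclidean_space set \<Rightarrow> ('a \<Rightarrow> 'b::real_normed_vector) \<Rightarrow> bool" where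
  "smooth_on S f \<longleftrightarrow> (\<forall>k. Ck_on k S f)"

section \<open>The domain\<close>

text \<open>Functions on \<open>[0,L] \<times> \<T> \<times> \<T>\<close> are functions on the slab below in \<open>\<real>\<^sup>3\<close> that are
  1-periodic in the second and third variable; integrals over \<open>\<Omega> = (0,L) \<times> \<T> \<times> \<T>\<close> are
  integrals over a period cell. The coordinates \<open>x, y, z\<close> of \<open>p\<close> are \<open>p $ 1, p $ 2, p $ 3\<close>.\<close>

definition closed_slab :: "real \<Rightarrow> (real ^ 3) set" where
  "closed_slab L = {p. 0 \<le> p $ 1 \<and> p $ 1 \<le> L}"

definition open_slab :: "real \<Rightarrow> (real ^ 3) set" where
  "open_slab L = {p. 0 < p $ 1 \<and> p $ 1 < L}"

definition cell :: "real \<Rightarrow> (real ^ 3) set" where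
  "cell L = {p. 0 < p $ 1 \<and> p $ 1 < L \<and> 0 \<le> p $ 2 \<and> p $ 2 < 1 \<and> 0 \<le> p $ 3 \<and> p $ 3 < 1}"

definition yz_periodic :: "real \<Rightarrow> (real ^ 3 \<Rightarrow> 'b) \<Rightarrow> bool" where
  "yz_periodic L f \<longleftrightarrow>
     (\<forall>p\<in>closed_slab L. f (p + axis 2 1) = f p \<and> f (p + axis 3 1) = f p)"

section \<open>Differential operators\<close>

definition grad :: "(real ^ 3 \<Rightarrow> real) \<Rightarrow> real ^ 3 \<Rightarrow> real ^ 3" where
  "grad f p = (\<chi> i. frechet_derivative f (at p) (axis i 1))"

definition divg :: "(real ^ 3 \<Rightarrow> real ^ 3) \<Rightarrow> real ^ 3 \<Rightarrow> real" where
  "divg v p = (\<Sum>i\<in>UNIV. frechet_derivative v (at p) (axis i 1) $ i)"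

definition laplace :: "(real ^ 3 \<Rightarrow> real) \<Rightarrow> real ^ 3 \<Rightarrow> real" where
  "laplace f = divg (grad f)"

definition vlaplace :: "(real ^ 3 \<Rightarrow> real ^ 3) \<Rightarrow> real ^ 3 \<Rightarrow> real ^ 3" where
  "vlaplace v p = (\<chi> i. laplace (\<lambda>q. v q $ i) p)"

section \<open>The Nernst--Planck--Stokes system\<close>

definition nps_equations ::
  "real \<Rightarrow> real \<Rightarrow> real \<Rightarrow> real \<Rightarrow> real \<Rightarrow> real \<Rightarrow>
   (real \<Rightarrow> real ^ 3 \<Rightarrow> real) \<Rightarrow> (real \<Rightarrow> real ^ 3 \<Rightarrow> real) \<Rightarrow> (real \<Rightarrow> real ^ 3 \<Rightarrow> real ^ 3) \<Rightarrow>
   (real \<Rightarrow> real ^ 3 \<Rightarrow> real) \<Rightarrow> (real \<Rightarrow> real ^ 3 \<Rightarrow> real) \<Rightarrow> bool" where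
  "nps_equations L D1 D2 \<epsilon> \<nu> K c1 c2 u \<Phi> pr \<longleftrightarrow>
     (\<forall>t>0. \<forall>p\<in>open_slab L.
        deriv (\<lambda>s. c1 s p) t + u t p \<bullet> grad (c1 t) p
          = D1 * divg (\<lambda>q. grad (c1 t) q + c1 t q *\<^sub>R grad (\<Phi> t) q) p \<and>
        deriv (\<lambda>s. c2 s p) t + u t p \<bullet> grad (c2 t) p
          = D2 * divg (\<lambda>q. grad (c2 t) q - c2 t q *\<^sub>R grad (\<Phi> t) q) p \<and>
        - \<epsilon> * laplace (\<Phi> t) p = c1 t p - c2 t p \<and>
        vector_derivative (\<lambda>s. u s p) (at t) - \<nu> *\<^sub>R vlaplace (u t) p + grad (pr t) p
          = - (K * (c1 t p - c2 t p)) *\<^sub>R grad (\<Phi> t) p \<and>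
        divg (u t) p = 0)"

definition nps_boundary ::
  "real \<Rightarrow> real \<Rightarrow> real \<Rightarrow> real \<Rightarrow> real \<Rightarrow> real \<Rightarrow>
   (real \<Rightarrow> real ^ 3 \<Rightarrow> real) \<Rightarrow> (real \<Rightarrow> real ^ 3 \<Rightarrow> real) \<Rightarrow> (real \<Rightarrow> real ^ 3 \<Rightarrow> real ^ 3) \<Rightarrow>
   (real \<Rightarrow> real ^ 3 \<Rightarrow> real) \<Rightarrow> bool" where
  "nps_boundary L \<alpha>1 \<alpha>2 \<beta>1 \<beta>2 V c1 c2 u \<Phi> \<longleftrightarrow>
     (\<forall>t>0. \<forall>p.
        (p $ 1 = 0 \<longrightarrow> c1 t p = \<alpha>1 \<and> c2 t p = \<alpha>2 \<and> \<Phi> t p = - V \<and> u t p = 0) \<and>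
        (p $ 1 = L \<longrightarrow> c1 t p = \<beta>1 \<and> c2 t p = \<beta>2 \<and> \<Phi> t p = 0 \<and> u t p = 0))"

definition spacetime_smooth ::
  "real \<Rightarrow> (real \<Rightarrow> real ^ 3 \<Rightarrow> 'b::real_normed_vector) \<Rightarrow> bool" where
  "spacetime_smooth L f \<longleftrightarrow>
     smooth_on ({0<..} \<times> closed_slab L) (\<lambda>(t, p). f t p) \<and> (\<forall>t>0. yz_periodic L (f t))"

text \<open>The initial value is attained in \<open>L\<^sup>2(\<Omega>)\<close>, so that smooth initial data that do not match
  the boundary values are admitted as well.\<close>

definition attains_initial ::
  "real \<Rightarrow> (real \<Rightarrow> real ^ 3 \<Rightarrow> 'b::real_normed_vector) \<Rightarrow> (real ^ 3 \<Rightarrow> 'b) \<Rightarrow> bool" where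
  "attains_initial L f f0 \<longleftrightarrow>
     ((\<lambda>t. LINT p:cell L|lborel. (norm (f t p - f0 p))\<^sup>2) \<longlongrightarrow> 0) (at_right 0)"

definition nps_solution ::
  "real \<Rightarrow> real \<Rightarrow> real \<Rightarrow> real \<Rightarrow> real \<Rightarrow> real \<Rightarrow> real \<Rightarrow> real \<Rightarrow> real \<Rightarrow> real \<Rightarrow> real \<Rightarrow>
   (real ^ 3 \<Rightarrow> real) \<Rightarrow> (real ^ 3 \<Rightarrow> real) \<Rightarrow> (real ^ 3 \<Rightarrow> real ^ 3) \<Rightarrow>
   (real \<Rightarrow> real ^ 3 \<Rightarrow> real) \<Rightarrow> (real \<Rightarrow> real ^ 3 \<Rightarrow> real) \<Rightarrow> (real \<Rightarrow> real ^ 3 \<Rightarrow> real ^ 3) \<Rightarrow>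
   (real \<Rightarrow> real ^ 3 \<Rightarrow> real) \<Rightarrow> (real \<Rightarrow> real ^ 3 \<Rightarrow> real) \<Rightarrow> bool" where
  "nps_solution L D1 D2 \<epsilon> \<nu> K \<alpha>1 \<alpha>2 \<beta>1 \<beta>2 V c10 c20 u0 c1 c2 u \<Phi> pr \<longleftrightarrow>
     spacetime_smooth L c1 \<and> spacetime_smooth L c2 \<and> spacetime_smooth L u \<and>
     spacetime_smooth L \<Phi> \<and> spacetime_smooth L pr \<and>
     nps_equations L D1 D2 \<epsilon> \<nu> K c1 c2 u \<Phi> pr \<and>
     nps_boundary L \<alpha>1 \<alpha>2 \<beta>1 \<beta>2 V c1 c2 u \<Phi> \<and>
     attains_initial L c1 c10 \<and> attains_initial L c2 c20 \<and> attains_initial L u u0"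

definition smooth_initial_data ::
  "real \<Rightarrow> (real ^ 3 \<Rightarrow> real) \<Rightarrow> (real ^ 3 \<Rightarrow> real) \<Rightarrow> (real ^ 3 \<Rightarrow> real ^ 3) \<Rightarrow> bool" where
  "smooth_initial_data L c10 c20 u0 \<longleftrightarrow>
     smooth_on (closed_slab L) c10 \<and> smooth_on (closed_slab L) c20 \<and>
     smooth_on (closed_slab L) u0 \<and>
     yz_periodic L c10 \<and> yz_periodic L c20 \<and> yz_periodic L u0 \<and>
     (\<forall>p\<in>closed_slab L. 0 \<le> c10 p \<and> 0 \<le> c20 p) \<and>
     (\<forall>p\<in>open_slab L. divg u0 p = 0)"

section \<open>One dimensional steady current solutions\<close>

definition p_flux :: "(real \<Rightarrow> real) \<Rightarrow> (real \<Rightarrow> real) \<Rightarrow> real \<Rightarrow> real" where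
  "p_flux c \<Phi> x = deriv c x + c x * deriv \<Phi> x"

definition n_flux :: "(real \<Rightarrow> real) \<Rightarrow> (real \<Rightarrow> real) \<Rightarrow> real \<Rightarrow> real" where
  "n_flux c \<Phi> x = deriv c x - c x * deriv \<Phi> x"

definition steady_current ::
  "real \<Rightarrow> real \<Rightarrow> real \<Rightarrow> real \<Rightarrow> real \<Rightarrow> real \<Rightarrow> real \<Rightarrow>
   (real \<Rightarrow> real) \<Rightarrow> (real \<Rightarrow> real) \<Rightarrow> (real \<Rightarrow> real) \<Rightarrow> bool" where
  "steady_current L \<epsilon> \<alpha>1 \<alpha>2 \<beta>1 \<beta>2 V cs1 cs2 \<Phi>s \<longleftrightarrow>
     (\<forall>f\<in>{cs1, cs2, \<Phi>s}. smooth_on {0<..<L} f \<and> continuous_on {0..L} f) \<and>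
     (\<forall>x\<in>{0<..<L}.
        deriv (p_flux cs1 \<Phi>s) x = 0 \<and>
        deriv (n_flux cs2 \<Phi>s) x = 0 \<and>
        - \<epsilon> * deriv (deriv \<Phi>s) x = cs1 x - cs2 x) \<and>
     cs1 0 = \<alpha>1 \<and> cs1 L = \<beta>1 \<and> cs2 0 = \<alpha>2 \<and> cs2 L = \<beta>2 \<and> \<Phi>s 0 = - V \<and> \<Phi>s L = 0"

section \<open>Distance to the steady state\<close>

text \<open>Since \<open>ln 0 = 0\<close> in HOL, this is also the continuous extension of \<open>\<psi>\<close> to \<open>0\<close>.\<close>

definition psi :: "real \<Rightarrow> real" where
  "psi s = s * ln s - s + 1"

definition steady_distance ::
  "real \<Rightarrow> (real \<Rightarrow> real) \<Rightarrow> (real \<Rightarrow> real) \<Rightarrow> (real \<Rightarrow> real) \<Rightarrow>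
   (real ^ 3 \<Rightarrow> real) \<Rightarrow> (real ^ 3 \<Rightarrow> real) \<Rightarrow> (real ^ 3 \<Rightarrow> real ^ 3) \<Rightarrow> (real ^ 3 \<Rightarrow> real) \<Rightarrow> real" where
  "steady_distance L cs1 cs2 \<Phi>s c1 c2 u \<Phi> =
     (LINT p:cell L|lborel. cs1 (p $ 1) * psi (c1 p / cs1 (p $ 1))) +
     (LINT p:cell L|lborel. cs2 (p $ 1) * psi (c2 p / cs2 (p $ 1))) +
     (LINT p:cell L|lborel. (norm (grad (\<lambda>q. \<Phi> q - \<Phi>s (q $ 1)) p))\<^sup>2) +
     (LINT p:cell L|lborel. (norm (u p))\<^sup>2)"

definition G_const :: "real \<Rightarrow> real \<Rightarrow> real \<Rightarrow> real \<Rightarrow> real \<Rightarrow> real \<Rightarrow> real \<Rightarrow> real" where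
  "G_const L D Di \<nu> K \<gamma>lo \<gamma>hi =
     sqrt (1 / D * (Di * \<gamma>hi\<^sup>2 / (2 * \<gamma>lo ^ 4) + K * L\<^sup>2 * \<gamma>hi\<^sup>2 / (\<nu> * \<gamma>lo ^ 3)))"

end

theory Submission
  imports Defs
begin

text \<open>The proof exhibits one Lyapunov functional \<open>F = entropy + A * excess_functional\<close> with
\<open>F' \<le> - \<kappa> F\<close> for all times \<open>t \<ge> 1\<close>.

The entropy part is the natural free energy relative to the steady state: relative entropies of
the two concentrations, field energy of \<open>\<phi> = \<Phi> - \<Phi>\<^sup>*\<close> and kinetic energy. Differentiating it and
testing the equations with \<open>\<zeta>\<^sub>i = ln c\<^sub>i - ln c\<^sub>i\<^sup>* \<plusminus> \<phi>\<close> makes the electric and convective terms cancel.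
What remains is the dissipation \<open>\<Sum> D\<^sub>i \<integral> c\<^sub>i |\<nabla>\<zeta>\<^sub>i|\<^sup>2 + \<nu>/K \<integral> |\<nabla>u|\<^sup>2\<close> and terms proportional to the currents
\<open>j\<^sub>i\<close> and to the deviations \<open>c\<^sub>i - c\<^sub>i\<^sup>*\<close>. Monotonicity of the logarithm together with the Poisson
equation bounds these deviations by \<open>\<zeta>\<^sub>i\<close> in \<open>L\<^sup>2\<close> (lemma \<open>coercivity\<close>), hence by the dissipation through the
Poincare inequality, and the smallness of the currents lets the dissipation win.

This argument needs pointwise bounds on \<open>c\<^sub>i\<close> close to the extreme boundary values \<open>\<gamma>lo\<close> and \<open>\<gamma>hi\<close>, which a
solution satisfies only asymptotically, and in integral norms. Two devices
replace uniform convergence. First, the logarithm is continued linearly outside \<open>[4/5 \<gamma>lo, 5/4 \<gamma>hi]\<close>;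
then the entropy argument goes through for every solution, at the price of the single error term
\<open>\<integral> e\<^sup>2 |\<nabla>\<Phi>|\<^sup>2\<close>, where \<open>e\<close> is the part of the concentration that is cut off. Secondly, the fourth power of
the distance of \<open>c\<^sub>i\<close> to \<open>[\<gamma>lo, \<gamma>hi]\<close> has an integral that decreases at a rate controlling
\<open>\<integral> dist(c\<^sub>i)\<^sup>2 |\<nabla>c\<^sub>i|\<^sup>2\<close> (lemma \<open>excess_decay\<close>), because the field drives the two species
in opposite directions. An integration by parts with the bounded potential estimates the error term by
this dissipation (lemmas \<open>excess_field_energy\<close> and \<open>residual_le\<close>), so a large multiple \<open>A\<close> of the excess
functional absorbs it.

The crude bounds that enter, \<open>0 \<le> c\<^sub>i \<le> M\<close> and \<open>|\<Phi>| \<le> P\<close>, hold for all positive times and come from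
testing with truncations of the unknowns (lemmas \<open>upper_bound\<close>, \<open>nonnegative\<close>, \<open>potential_bounded\<close>). The bounds
\<open>\<gamma>lo \<le> c\<^sub>i\<^sup>* \<le> \<gamma>hi\<close> are the stationary case of the excess estimate (lemma \<open>steady_bounds\<close>).\<close>

section \<open>Integration over the period cell\<close>

text \<open>Integrals run over the half-open cell, but bounds are required here, where both ends of each
period are included: the fundamental theorem of calculus along a period needs them.\<close>

definition closed_cell :: "real \<Rightarrow> (real ^ 3) set" where
  "closed_cell L = {p \<in> open_slab L. 0 \<le> p $ 2 \<and> p $ 2 \<le> 1 \<and> 0 \<le> p $ 3 \<and> p $ 3 \<le> 1}"

definition cell_integral :: "real \<Rightarrow> (real ^ 3 \<Rightarrow> real) \<Rightarrow> real" where
  "cell_integral L f = (LINT p:cell L|lborel. f p)"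

text \<open>The class of integrands. Nothing is asked on the walls \<open>x = 0\<close> and \<open>x = L\<close>, because a gradient defined by
two-sided derivatives carries no information there.\<close>

definition bcont :: "real \<Rightarrow> (real ^ 3 \<Rightarrow> 'b::real_normed_vector) \<Rightarrow> bool" where
  "bcont L f \<longleftrightarrow> continuous_on (open_slab L) f \<and> bounded (f ` closed_cell L)"

lemma open_slab_open: "open (open_slab L)"
proof -
  have "open_slab L = {p. 0 < p $ 1} \<inter> {p. p $ 1 < L}"
    by (auto simp: open_slab_def)
  then show ?thesis
    by (simp add: open_Int open_Collect_less continuous_intros)
qed

lemma cell_subset_closed_cell: "cell L \<subseteq> closed_cell L"
  by (auto simp: cell_def closed_cell_def open_slab_def)

lemma closed_cell_subset_open_slab: "closed_cell L \<subseteq> open_slab L"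
  by (auto simp: closed_cell_def)

lemma cell_open_slab: "p \<in> cell L \<Longrightarrow> p \<in> open_slab L"
  using cell_subset_closed_cell closed_cell_subset_open_slab by blast

lemma open_slab_closed_slab: "p \<in> open_slab L \<Longrightarrow> p \<in> closed_slab L"
  by (auto simp: open_slab_def closed_slab_def)

lemma slab_shift:
  "p \<in> open_slab L \<Longrightarrow> p + axis 2 1 \<in> open_slab L"
  "p \<in> open_slab L \<Longrightarrow> p + axis 3 1 \<in> open_slab L"
  by (auto simp: open_slab_def axis_def)

lemma cell_borel [measurable]: "cell L \<in> sets borel"
  unfolding cell_def by measurable

lemma cell_emeasure_finite: "emeasure lborel (cell L) < \<infinity>"
proof -
  have "cell L \<subseteq> cbox 0 (\<chi> i. if i = 1 then L else 1)"
    by (auto simp: cell_def mem_box_cart forall_3)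
  then have "emeasure lborel (cell L) \<le> emeasure lborel (cbox 0 (\<chi> i. if i = 1 then L else 1) :: (real^3) set)"
    by (intro emeasure_mono) auto
  also have "\<dots> < \<infinity>" by (rule emeasure_lborel_cbox_finite)
  finally show ?thesis .
qed

lemma bcont_integrable:
  fixes f :: "real ^ 3 \<Rightarrow> real"
  assumes "bcont L f"
  shows "set_integrable lborel (cell L) f"
proof -
  from assms obtain B where B: "\<And>p. p \<in> closed_cell L \<Longrightarrow> norm (f p) \<le> B"
    unfolding bcont_def bounded_iff by blast
  have "set_borel_measurable lborel (cell L) f"
    using assms cell_open_slab
    unfolding set_borel_measurable_def
    using borel_measurable_continuous_on_indicator[of "cell L" f]
    by (auto simp: bcont_def intro: continuous_on_subset)
  then show ?thesis
    using B cell_subset_closed_cell cell_emeasure_finite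
    unfolding set_integrable_def set_borel_measurable_def
    by (intro integrableI_bounded_set[where A = "cell L" and B = B]) (auto simp: indicator_def)
qed

lemma bcont_const: "bcont L (\<lambda>p. c)"
  unfolding bcont_def
  by (auto intro!: continuous_intros boundedI)

lemma bcont_bilinear:
  assumes "bounded_bilinear pr" "bcont L f" "bcont L g"
  shows "bcont L (\<lambda>p. pr (f p) (g p))"
proof -
  interpret bounded_bilinear pr by fact
  obtain K where K: "\<And>a b. norm (pr a b) \<le> norm a * norm b * K"
    using bounded by blast
  obtain B C where B: "\<And>p. p \<in> closed_cell L \<Longrightarrow> norm (f p) \<le> B"
    and C: "\<And>p. p \<in> closed_cell L \<Longrightarrow> norm (g p) \<le> C"
    using assms unfolding bcont_def bounded_iff by (metis image_eqI)
  have "norm (pr (f p) (g p)) \<le> B * C * \<bar>K\<bar>" if "p \<in> closed_cell L" for p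
  proof -
    have "norm (pr (f p) (g p)) \<le> norm (f p) * norm (g p) * \<bar>K\<bar>"
      by (rule order_trans[OF K]) (simp add: mult_left_mono)
    also have "\<dots> \<le> B * C * \<bar>K\<bar>"
      using B[OF that] C[OF that] order_trans[OF norm_ge_zero B[OF that]]
        order_trans[OF norm_ge_zero C[OF that]]
      by (intro mult_mono) auto
    finally show ?thesis .
  qed
  then show ?thesis
    using assms unfolding bcont_def by (auto intro!: continuous_on boundedI)
qed

lemmas bcont_mult = bcont_bilinear[OF bounded_bilinear_mult]
  and bcont_scaleR = bcont_bilinear[OF bounded_bilinear_scaleR]
  and bcont_inner = bcont_bilinear[OF bounded_bilinear_inner]

lemma bcont_add: "bcont L f \<Longrightarrow> bcont L g \<Longrightarrow> bcont L (\<lambda>p. f p + g p)"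
  unfolding bcont_def by (auto intro: continuous_on_add bounded_plus_comp)

lemma bcont_minus: "bcont L f \<Longrightarrow> bcont L (\<lambda>p. - f p)"
  unfolding bcont_def by (auto intro: continuous_on_minus bounded_minus_comp)

lemma bcont_diff: "bcont L f \<Longrightarrow> bcont L g \<Longrightarrow> bcont L (\<lambda>p. f p - g p)"
  using bcont_add[of L f "\<lambda>p. - g p"] bcont_minus[of L g] by simp

lemma bcont_sum: "(\<And>i. i \<in> I \<Longrightarrow> bcont L (f i)) \<Longrightarrow> bcont L (\<lambda>p. \<Sum>i\<in>I. f i p)"
  by (induction I rule: infinite_finite_induct) (auto intro: bcont_const bcont_add)

lemma bcont_component: "bcont L (f :: real ^ 3 \<Rightarrow> real ^ 'n) \<Longrightarrow> bcont L (\<lambda>p. f p $ i)"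
  using bcont_inner[OF _ bcont_const, of L f "axis i 1"] by (simp add: inner_axis)

lemma bcont_vec:
  assumes "\<And>i. bcont L (\<lambda>p. f p $ i)"
  shows "bcont L (f :: real ^ 3 \<Rightarrow> real ^ 3)"
proof -
  have "bcont L (\<lambda>p. \<Sum>i\<in>UNIV. (f p $ i) *\<^sub>R (axis i 1 :: real ^ 3))"
    by (intro bcont_sum bcont_scaleR bcont_const assms)
  moreover have "(\<lambda>p. \<Sum>i\<in>UNIV. (f p $ i) *\<^sub>R axis i 1) = f"
    by (simp add: fun_eq_iff basis_expansion flip: scalar_mult_eq_scaleR)
  ultimately show ?thesis by simp
qed

lemma bcont_power: "bcont L f \<Longrightarrow> bcont L (\<lambda>p. f p ^ n :: real)"
  by (induction n) (auto intro: bcont_const bcont_mult)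

lemma bcont_compose:
  fixes f :: "real ^ 3 \<Rightarrow> real" and g :: "real \<Rightarrow> real"
  assumes "bcont L f" "continuous_on S g" "f ` open_slab L \<subseteq> S" "closure (f ` closed_cell L) \<subseteq> S"
  shows "bcont L (\<lambda>p. g (f p))"
proof -
  have "bounded (g ` closure (f ` closed_cell L))"
    using assms
    by (intro compact_imp_bounded compact_continuous_image continuous_on_subset[OF assms(2)])
      (auto simp: compact_eq_bounded_closed bcont_def)
  then have "bounded ((\<lambda>p. g (f p)) ` closed_cell L)"
    by (rule bounded_subset) (use closure_subset in blast)
  moreover have "continuous_on (open_slab L) (\<lambda>p. g (f p))"
    using assms by (auto simp: bcont_def intro: continuous_on_compose2)
  ultimately show ?thesis by (simp add: bcont_def)
qed

lemma bcont_compose_UNIV: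
  fixes f :: "real ^ 3 \<Rightarrow> real" and g :: "real \<Rightarrow> real"
  shows "bcont L f \<Longrightarrow> continuous_on UNIV g \<Longrightarrow> bcont L (\<lambda>p. g (f p))"
  by (rule bcont_compose[where S = UNIV]) auto

lemma bcont_abs: "bcont L f \<Longrightarrow> bcont L (\<lambda>p. \<bar>f p\<bar> :: real)"
  by (rule bcont_compose_UNIV) (auto intro: continuous_intros)

lemma bcont_cong: "(\<And>p. p \<in> open_slab L \<Longrightarrow> f p = g p) \<Longrightarrow> bcont L f \<longleftrightarrow> bcont L g"
proof -
  assume eq: "\<And>p. p \<in> open_slab L \<Longrightarrow> f p = g p"
  have "f ` closed_cell L = g ` closed_cell L"
    using eq closed_cell_subset_open_slab by (intro image_cong) auto
  then show ?thesis
    using eq unfolding bcont_def by (metis (no_types, lifting) continuous_on_cong)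
qed

lemmas bcont_intros = bcont_const bcont_mult bcont_scaleR bcont_inner bcont_add bcont_diff
  bcont_minus bcont_sum bcont_component bcont_power bcont_abs

lemma ci_add: "bcont L f \<Longrightarrow> bcont L g \<Longrightarrow>
    cell_integral L (\<lambda>p. f p + g p) = cell_integral L f + cell_integral L g"
  unfolding cell_integral_def by (intro set_integral_add bcont_integrable)

lemma ci_diff: "bcont L f \<Longrightarrow> bcont L g \<Longrightarrow>
    cell_integral L (\<lambda>p. f p - g p) = cell_integral L f - cell_integral L g"
  unfolding cell_integral_def by (intro set_integral_diff bcont_integrable)

lemma ci_minus: "cell_integral L (\<lambda>p. - f p) = - cell_integral L f"
  unfolding cell_integral_def set_lebesgue_integral_def by simp

lemma ci_cmult: "cell_integral L (\<lambda>p. c * f p) = c * cell_integral L f"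
  unfolding cell_integral_def by simp

lemma ci_sum: "(\<And>i. i \<in> I \<Longrightarrow> bcont L (f i)) \<Longrightarrow>
    cell_integral L (\<lambda>p. \<Sum>i\<in>I. f i p) = (\<Sum>i\<in>I. cell_integral L (f i))"
proof (induction I rule: infinite_finite_induct)
  case (insert x F)
  then show ?case by (simp add: ci_add bcont_sum)
qed (auto simp: cell_integral_def set_lebesgue_integral_def)

lemma ci_mono:
  assumes "bcont L f" "bcont L g" "\<And>p. p \<in> cell L \<Longrightarrow> f p \<le> g p"
  shows "cell_integral L f \<le> cell_integral L g"
  unfolding cell_integral_def using assms by (intro set_integral_mono bcont_integrable)

lemma ci_cong:
  assumes "\<And>p. p \<in> open_slab L \<Longrightarrow> f p = g p"
  shows "cell_integral L f = cell_integral L g"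
  unfolding cell_integral_def using assms cell_open_slab
  by (intro set_lebesgue_integral_cong) auto

lemma ci_nonneg:
  assumes "\<And>p. p \<in> cell L \<Longrightarrow> 0 \<le> f p"
  shows "0 \<le> cell_integral L f"
  unfolding cell_integral_def set_lebesgue_integral_def using assms
  by (intro integral_nonneg_AE AE_I2) (auto simp: indicator_def)

text \<open>A continuous function that is positive at \<open>p\<close> stays above half its value on a small box with
corner \<open>p\<close>, and this box lies in the cell even if \<open>p\<close> is on one of its included faces. The lemma turns integral
identities into pointwise bounds.\<close>

lemma ci_zero_imp_zero:
  assumes f: "bcont L f" and nn: "\<And>p. p \<in> cell L \<Longrightarrow> 0 \<le> f p"
    and z: "cell_integral L f \<le> 0" and p: "p \<in> cell L"
  shows "f p = 0"
proof (rule ccontr)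
  assume "f p \<noteq> 0"
  with nn[OF p] have pos: "0 < f p" by simp
  have "isCont f p"
    using f p open_slab_open cell_open_slab by (auto simp: bcont_def continuous_on_eq_continuous_at)
  then obtain e where e: "e > 0" "\<And>q. dist q p < e \<Longrightarrow> dist (f q) (f p) < f p / 2"
    unfolding continuous_at_eps_delta using pos by (metis half_gt_zero)
  define s where "s = Min {e / 3, L - p $ 1, 1 - p $ 2, 1 - p $ 3}"
  have "s \<le> e / 3" unfolding s_def by (rule Min_le) auto
  with e p have s: "s > 0" "s \<le> e / 3" "s \<le> L - p $ 1" "s \<le> 1 - p $ 2" "s \<le> 1 - p $ 3"
    by (auto simp: s_def cell_def)
  define B where "B = box p (p + (\<chi> i. s))"
  have B: "q \<in> cell L" "f p / 2 \<le> f q" if "q \<in> B" for q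
  proof -
    have q: "p $ i < q $ i" "q $ i < p $ i + s" for i
      using that by (auto simp: B_def mem_box_cart)
    show "q \<in> cell L"
      using q[of 1] q[of 2] q[of 3] s p by (auto simp: cell_def)
    have "norm (q - p) \<le> (\<Sum>i\<in>UNIV. \<bar>(q - p) $ i\<bar>)" by (rule norm_le_l1_cart)
    also have "\<dots> < (\<Sum>i\<in>(UNIV::3 set). s)"
      using q by (intro sum_strict_mono) (auto simp: abs_less_iff field_simps less_imp_le)
    also have "\<dots> \<le> e" using s(2) by simp
    finally have "dist (f q) (f p) < f p / 2" by (intro e) (simp add: dist_norm)
    then show "f p / 2 \<le> f q" unfolding dist_real_def by linarith
  qed
  have Bm: "measure lborel B > 0"
    using s unfolding B_def
    by (subst measure_lborel_box) (auto simp: cart_eq_inner_axis[symmetric] Basis_vec_def inner_axis intro!: prod_pos)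
  have "f p / 2 * measure lborel B = (LINT q|lborel. indicator B q * (f p / 2))"
    by (simp add: B_def)
  also have "\<dots> \<le> (LINT q|lborel. indicator (cell L) q *\<^sub>R f q)"
  proof (rule integral_mono)
    show "integrable lborel (\<lambda>q. indicator B q * (f p / 2))"
      by (auto simp: B_def intro!: integrable_mult_left integrable_real_indicator emeasure_lborel_box_finite)
    show "integrable lborel (\<lambda>q. indicator (cell L) q *\<^sub>R f q)"
      using bcont_integrable[OF f] by (simp add: set_integrable_def)
    show "indicator B q * (f p / 2) \<le> indicator (cell L) q *\<^sub>R f q" for q
      using B[of q] nn[of q] by (auto simp: indicator_def)
  qed
  also have "\<dots> \<le> 0"
    using z by (simp add: cell_integral_def set_lebesgue_integral_def)
  finally show False using pos Bm by (simp add: mult_le_0_iff)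
qed

lemma measure_cell_nonneg_integral: "cell_integral L (\<lambda>p. c) = c * measure lborel (cell L)"
  using cell_emeasure_finite[of L] unfolding cell_integral_def
  by (subst set_integral_const) auto

section \<open>Differentiable functions on the slab and the divergence theorem\<close>

text \<open>The gradient is an explicit argument, so that the rules of calculus compute it by resolution.\<close>

definition C1 :: "real \<Rightarrow> (real ^ 3 \<Rightarrow> real) \<Rightarrow> (real ^ 3 \<Rightarrow> real ^ 3) \<Rightarrow> bool" where
  "C1 L f f' \<longleftrightarrow> (\<forall>p\<in>open_slab L. (f has_derivative (\<lambda>v. f' p \<bullet> v)) (at p)) \<and>
     bounded (f ` closed_cell L) \<and> bcont L f' \<and>
     (\<forall>p\<in>open_slab L. f (p + axis 2 1) = f p \<and> f (p + axis 3 1) = f p)"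

definition vanishing :: "real \<Rightarrow> (real ^ 3 \<Rightarrow> real) \<Rightarrow> bool" where
  "vanishing L f \<longleftrightarrow> continuous_on (closed_slab L) f \<and> (\<forall>p. p $ 1 = 0 \<or> p $ 1 = L \<longrightarrow> f p = 0)"

text \<open>Zero boundary values for fields that have no meaningful values on the walls, such as a gradient
multiplied by a function that vanishes there.\<close>

definition vanishing_bound :: "real \<Rightarrow> (real ^ 3 \<Rightarrow> 'b::real_normed_vector) \<Rightarrow> bool" where
  "vanishing_bound L F \<longleftrightarrow> (\<exists>\<psi> B. vanishing L \<psi> \<and> (\<forall>p\<in>closed_cell L. norm (F p) \<le> B * \<bar>\<psi> p\<bar>))"

lemma C1_bcont: "C1 L f f' \<Longrightarrow> bcont L f"
  unfolding C1_def bcont_def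
  by (auto intro!: continuous_at_imp_continuous_on dest: has_derivative_continuous)

lemma C1_bcont_grad: "C1 L f f' \<Longrightarrow> bcont L f'"
  by (simp add: C1_def)

text \<open>The coordinate along which a derivative is integrated comes last in the pair, hence innermost
in Fubini's theorem.\<close>

definition coords :: "3 \<Rightarrow> 3 \<Rightarrow> 3 \<Rightarrow> (real \<times> real) \<times> real \<Rightarrow> real ^ 3" where
  "coords i j k = (\<lambda>((y, z), x). \<chi> n. if n = i then x else if n = j then y else z)"

lemma distinct_indices:
  fixes i j k n :: 3
  assumes "i \<noteq> j" "i \<noteq> k" "j \<noteq> k"
  shows "n = i \<or> n = j \<or> n = k"
  using assms exhaust_3[of i] exhaust_3[of j] exhaust_3[of k] exhaust_3[of n] by auto

lemma coords_measurable [measurable]: "coords i j k \<in> borel_measurable borel"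
proof -
  have "continuous_on UNIV (\<lambda>w :: (real \<times> real) \<times> real. if n = i then snd w else if n = j then fst (fst w) else snd (fst w))" for n
    by (cases "n = i"; cases "n = j") (auto intro!: continuous_intros)
  then show ?thesis
    unfolding coords_def case_prod_beta
    by (intro borel_measurable_continuous_onI continuous_on_vec_lambda)
qed

lemma lborel_coords:
  assumes "i \<noteq> j" "i \<noteq> k" "j \<noteq> k"
  shows "lborel = distr lborel borel (coords i j k)"
proof (rule lborel_eqI)
  fix l u :: "real ^ 3"
  assume lu: "\<And>b. b \<in> Basis \<Longrightarrow> l \<bullet> b \<le> u \<bullet> b"
  have le: "l $ n \<le> u $ n" for n
    using lu[of "axis n 1"] by (simp add: inner_axis)
  note ind = distinct_indices[OF assms]
  have U: "(UNIV :: 3 set) = {i, j, k}" using ind by auto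
  have "coords i j k -` box l u = ({l $ j<..<u $ j} \<times> {l $ k<..<u $ k}) \<times> {l $ i<..<u $ i}"
  proof (rule set_eqI)
    fix w :: "(real \<times> real) \<times> real"
    obtain y z x where w: "w = ((y, z), x)" by (metis surj_pair)
    have "w \<in> coords i j k -` box l u \<longleftrightarrow>
      (\<forall>n\<in>{i, j, k}. l $ n < coords i j k w $ n \<and> coords i j k w $ n < u $ n)"
      by (simp add: mem_box_cart flip: U)
    also have "\<dots> \<longleftrightarrow> l $ i < x \<and> x < u $ i \<and> l $ j < y \<and> y < u $ j \<and> l $ k < z \<and> z < u $ k"
      using assms by (auto simp: w coords_def)
    also have "\<dots> \<longleftrightarrow> w \<in> ({l $ j<..<u $ j} \<times> {l $ k<..<u $ k}) \<times> {l $ i<..<u $ i}"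
      by (auto simp: w)
    finally show "w \<in> coords i j k -` box l u \<longleftrightarrow> w \<in> ({l $ j<..<u $ j} \<times> {l $ k<..<u $ k}) \<times> {l $ i<..<u $ i}" .
  qed
  then have "emeasure (distr lborel borel (coords i j k)) (box l u)
      = emeasure lborel (({l $ j<..<u $ j} \<times> {l $ k<..<u $ k}) \<times> {l $ i<..<u $ i})"
    by (subst emeasure_distr) auto
  also have "\<dots> = ennreal ((u $ j - l $ j) * (u $ k - l $ k) * (u $ i - l $ i))"
    using le
    by (simp add: lborel_prod[symmetric] lborel.emeasure_pair_measure_Times ennreal_mult)
  also have "(u $ j - l $ j) * (u $ k - l $ k) * (u $ i - l $ i) = (\<Prod>n\<in>UNIV. (u - l) $ n)"
    using assms by (simp add: U)
  also have "\<dots> = (\<Prod>b\<in>Basis. (u - l) \<bullet> b)"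
    unfolding Basis_vec_def
    by (simp add: prod.reindex inj_on_def axis_eq_axis UNION_singleton_eq_range inner_axis)
  finally show "emeasure (distr lborel borel (coords i j k)) (box l u) = ennreal (\<Prod>b\<in>Basis. (u - l) \<bullet> b)" .
qed simp

lemma cell_integral_eq_zero_if_lines:
  assumes f: "bcont L f" and ijk: "i \<noteq> j" "i \<noteq> k" "j \<noteq> k"
    and lines: "\<And>y z. (LINT x|lborel. indicator (cell L) (coords i j k ((y, z), x)) *\<^sub>R f (coords i j k ((y, z), x))) = 0"
  shows "cell_integral L f = 0"
proof -
  let ?g = "\<lambda>p. indicator (cell L) p *\<^sub>R f p" and ?T = "coords i j k"
  have int: "integrable lborel ?g"
    using bcont_integrable[OF f] by (simp add: set_integrable_def)
  then have "integrable (distr lborel borel ?T) ?g"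
    using lborel_coords[OF ijk] by simp
  then have int2: "integrable (lborel \<Otimes>\<^sub>M lborel) (\<lambda>w. ?g (?T w))"
    using borel_measurable_integrable[OF int]
    by (subst (asm) integrable_distr_eq) (auto simp: lborel_prod)
  have "cell_integral L f = (LINT p|distr lborel borel ?T. ?g p)"
    using lborel_coords[OF ijk] by (simp add: cell_integral_def set_lebesgue_integral_def)
  also have "\<dots> = (LINT w|lborel. ?g (?T w))"
    using borel_measurable_integrable[OF int] by (intro integral_distr) auto
  also have "\<dots> = (LINT w|(lborel \<Otimes>\<^sub>M lborel). ?g (?T w))"
    by (simp add: lborel_prod)
  also have "\<dots> = (LINT yz|lborel. LINT x|lborel. ?g (?T (yz, x)))"
    using int2 by (rule lborel_pair.integral_fst'[symmetric])
  also have "\<dots> = (LINT (yz :: real \<times> real)|lborel. 0)"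
    using lines by (intro Bochner_Integration.integral_cong refl) (metis surj_pair)
  finally show ?thesis by simp
qed

lemma ftc_zero:
  fixes \<phi> d :: "real \<Rightarrow> real"
  assumes ab: "a < b" and S: "{a<..<b} \<subseteq> S" "S \<subseteq> {a..b}" "S \<in> sets borel"
    and cont: "continuous_on {a..b} \<phi>" and eq: "\<phi> a = \<phi> b"
    and der: "\<And>x. x \<in> {a<..<b} \<Longrightarrow> (\<phi> has_real_derivative d x) (at x)"
    and d: "continuous_on S d" "bounded (d ` S)"
  shows "(LINT x|lborel. indicator S x *\<^sub>R d x) = 0"
proof -
  have "(d has_integral \<phi> b - \<phi> a) {a..b}"
    using ab cont der
    by (intro fundamental_theorem_of_calculus_interior)
      (auto simp: has_real_derivative_iff_has_vector_derivative)
  then have "(d has_integral 0) {a..b}" using eq by simp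
  moreover have "negligible {x \<in> {a..b} - S. d x \<noteq> 0}" "negligible {x \<in> S - {a..b}. d x \<noteq> 0}"
    by (rule negligible_subset[of "{a, b}"]; use S in \<open>auto simp: subset_eq\<close>)+
  ultimately have I: "(d has_integral 0) S"
    using has_integral_spike_set_eq by blast
  obtain B where B: "\<And>x. x \<in> S \<Longrightarrow> norm (d x) \<le> B" using d(2) unfolding bounded_iff by blast
  have "emeasure lborel S \<le> emeasure lborel {a..b}" using S by (intro emeasure_mono) auto
  then have fin: "emeasure lborel S < \<infinity>" using ab by (auto simp: le_less_trans top_unique)
  have "set_integrable lborel S d"
    unfolding set_integrable_def
    using B fin S borel_measurable_continuous_on_indicator[OF S(3) d(1)]
    by (intro integrableI_bounded_set[where A = S and B = B]) (auto simp: indicator_def)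
  then have "(LINT x:S|lborel. d x) = integral S d"
    by (rule set_borel_integral_eq_integral)
  with I show ?thesis by (simp add: integral_unique set_lebesgue_integral_def)
qed

lemma coords_line:
  "coords i j k ((y, z), x) = coords i j k ((y, z), 0) + x *\<^sub>R axis i 1"
  by (auto simp: coords_def vec_eq_iff axis_def)

lemma C1_line_derivative:
  assumes "C1 L f f'" "coords i j k ((y, z), x) \<in> open_slab L"
  shows "((\<lambda>x. f (coords i j k ((y, z), x))) has_real_derivative f' (coords i j k ((y, z), x)) $ i) (at x)"
proof -
  let ?l = "\<lambda>x. coords i j k ((y, z), x)"
  have "(?l has_derivative (\<lambda>h. h *\<^sub>R axis i 1)) (at x)"
    by (subst coords_line) (auto intro!: derivative_eq_intros)
  moreover have "(f has_derivative (\<lambda>v. f' (?l x) \<bullet> v)) (at (?l x))"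
    using assms by (auto simp: C1_def)
  ultimately have "(f \<circ> ?l has_derivative (\<lambda>v. f' (?l x) \<bullet> v) \<circ> (\<lambda>h. h *\<^sub>R axis i 1)) (at x)"
    by (rule diff_chain_at)
  then show ?thesis
    by (simp add: has_field_derivative_def o_def inner_axis mult.commute[of _ "f' _ $ i"] fun_eq_iff)
qed

lemma line_continuous: "continuous_on S (\<lambda>x. coords i j k ((y, z), x))"
  by (subst coords_line) (intro continuous_intros)

lemma bounded_line:
  assumes "bcont L g" "\<And>x. x \<in> S \<Longrightarrow> coords i j k ((y, z), x) \<in> closed_cell L"
  shows "continuous_on S (\<lambda>x. g (coords i j k ((y, z), x)))"
    and "bounded ((\<lambda>x. g (coords i j k ((y, z), x))) ` S)"
proof -
  show "continuous_on S (\<lambda>x. g (coords i j k ((y, z), x)))"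
    using assms closed_cell_subset_open_slab
    by (intro continuous_on_compose2[of "open_slab L" g S]) (auto simp: bcont_def line_continuous)
  show "bounded ((\<lambda>x. g (coords i j k ((y, z), x))) ` S)"
    by (rule bounded_subset[of "g ` closed_cell L"]) (use assms in \<open>auto simp: bcont_def\<close>)
qed

lemma cell_integral_periodic_derivative:
  assumes f: "C1 L f f'" and i: "i = 2 \<or> i = 3"
  shows "cell_integral L (\<lambda>p. f' p $ i) = 0"
proof -
  define k :: 3 where "k = (if i = 2 then 3 else 2)"
  have ijk: "i \<noteq> 1" "i \<noteq> k" "1 \<noteq> k" using i by (auto simp: k_def)
  show ?thesis
  proof (rule cell_integral_eq_zero_if_lines[OF bcont_component[OF C1_bcont_grad[OF f]] ijk])
    fix y z :: real
    let ?l = "\<lambda>x. coords i 1 k ((y, z), x)"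
    let ?S = "{0..<1::real}"
    show "(LINT x|lborel. indicator (cell L) (?l x) *\<^sub>R f' (?l x) $ i) = 0"
    proof (cases "0 < y \<and> y < L \<and> 0 \<le> z \<and> z < 1")
      case True
      have cell: "?l x \<in> cell L \<longleftrightarrow> x \<in> ?S" for x
        using True i by (auto simp: cell_def coords_def k_def)
      have slab: "?l x \<in> open_slab L" for x
        using True i by (auto simp: open_slab_def coords_def)
      have cl: "?l x \<in> closed_cell L" if "x \<in> {0..1}" for x
        using True i that by (auto simp: closed_cell_def open_slab_def coords_def k_def)
      have "(LINT x|lborel. indicator ?S x *\<^sub>R f' (?l x) $ i) = 0"
      proof (rule ftc_zero[where a = 0 and b = 1 and \<phi> = "\<lambda>x. f (?l x)"])
        show "((\<lambda>x. f (?l x)) has_real_derivative f' (?l x) $ i) (at x)" for x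
          by (rule C1_line_derivative[OF f slab])
        show "continuous_on {0..1} (\<lambda>x. f (?l x))"
          using bounded_line(1)[OF C1_bcont[OF f] cl] by blast
        have "?l 1 = ?l 0 + axis i 1" using coords_line[of i 1 k y z 1] by simp
        then show "f (?l 0) = f (?l 1)"
          using f slab[of 0] i by (auto simp: C1_def)
        show "continuous_on ?S (\<lambda>x. f' (?l x) $ i)" "bounded ((\<lambda>x. f' (?l x) $ i) ` ?S)"
          using bounded_line[OF bcont_component[OF C1_bcont_grad[OF f]], of ?S i 1 k y z] cl by auto
      qed auto
      then show ?thesis by (simp add: indicator_def cell cong: if_cong)
    next
      case False
      then have "?l x \<notin> cell L" for x
        using i by (auto simp: cell_def coords_def k_def)
      then show ?thesis by simp
    qed
  qed
qed

lemma vanishing_tendsto: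
  assumes L: "L > 0" and \<psi>: "vanishing L \<psi>" and a: "a = 0 \<or> a = L"
  shows "((\<lambda>x. \<psi> (coords 1 2 3 ((y, z), x))) \<longlongrightarrow> 0) (at a within {0..L})"
proof -
  let ?l = "\<lambda>x. coords 1 2 3 ((y, z), x)"
  have "continuous_on {0..L} (\<lambda>x. \<psi> (?l x))"
    using \<psi> by (intro continuous_on_compose2[of "closed_slab L" \<psi> "{0..L}"] line_continuous)
      (auto simp: vanishing_def closed_slab_def coords_def)
  then have "((\<lambda>x. \<psi> (?l x)) \<longlongrightarrow> \<psi> (?l a)) (at a within {0..L})"
    using L a by (auto simp: continuous_on_def)
  moreover have "\<psi> (?l a) = 0" using \<psi> a by (auto simp: vanishing_def coords_def)
  ultimately show ?thesis by simp
qed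

text \<open>Extended by zero to the walls, a function dominated by a vanishing one is continuous on each
line from wall to wall, although its given values on the walls are arbitrary.\<close>

lemma cell_integral_normal_derivative:
  assumes L: "L > 0" and f: "C1 L f f'" and v: "vanishing_bound L f"
  shows "cell_integral L (\<lambda>p. f' p $ 1) = 0"
proof (rule cell_integral_eq_zero_if_lines[OF bcont_component[OF C1_bcont_grad[OF f]], of 1 2 3])
  fix y z :: real
  let ?l = "\<lambda>x. coords 1 2 3 ((y, z), x)"
  let ?S = "{0<..<L}"
  show "(LINT x|lborel. indicator (cell L) (?l x) *\<^sub>R f' (?l x) $ 1) = 0"
  proof (cases "0 \<le> y \<and> y < 1 \<and> 0 \<le> z \<and> z < 1")
    case True
    have cell: "?l x \<in> cell L \<longleftrightarrow> x \<in> ?S" for x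
      using True by (auto simp: cell_def coords_def)
    have cl: "?l x \<in> closed_cell L" if "x \<in> ?S" for x
      using cell_subset_closed_cell cell that by blast
    then have slab: "?l x \<in> open_slab L" if "x \<in> ?S" for x
      using that closed_cell_subset_open_slab by blast
    define \<phi> where "\<phi> x = (if x \<in> ?S then f (?l x) else 0)" for x
    have der: "(\<phi> has_real_derivative f' (?l x) $ 1) (at x)" if "x \<in> ?S" for x
    proof (rule has_field_derivative_transform_within_open[of _ _ _ ?S])
      show "((\<lambda>x. f (?l x)) has_real_derivative f' (?l x) $ 1) (at x)"
        by (rule C1_line_derivative[OF f slab[OF that]])
    qed (use that in \<open>auto simp: \<phi>_def\<close>)
    obtain \<psi> B where \<psi>: "vanishing L \<psi>" and B: "\<And>p. p \<in> closed_cell L \<Longrightarrow> norm (f p) \<le> B * \<bar>\<psi> p\<bar>"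
      using v by (auto simp: vanishing_bound_def)
    have bnd: "norm (\<phi> x) \<le> \<bar>B\<bar> * \<bar>\<psi> (?l x)\<bar>" for x
      using B[OF cl[of x]] order_trans[OF _ mult_right_mono[OF abs_ge_self[of B], of "\<bar>\<psi> (?l x)\<bar>"]]
      by (auto simp: \<phi>_def)
    have "(\<phi> \<longlongrightarrow> \<phi> a) (at a within {0..L})" if a: "a \<in> {0..L}" for a
    proof (cases "a \<in> ?S")
      case True
      then show ?thesis
        using DERIV_isCont[OF der] by (auto simp: isCont_def intro: tendsto_within_subset)
    next
      case False
      with a have a: "a = 0 \<or> a = L" by auto
      have "((\<lambda>x. \<bar>B\<bar> * \<bar>\<psi> (?l x)\<bar>) \<longlongrightarrow> \<bar>B\<bar> * \<bar>0\<bar>) (at a within {0..L})"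
        by (intro tendsto_intros vanishing_tendsto L \<psi> a)
      then have "(\<phi> \<longlongrightarrow> 0) (at a within {0..L})"
        by (intro Lim_null_comparison[OF always_eventually, of \<phi>]) (use bnd in auto)
      then show ?thesis using a by (auto simp: \<phi>_def)
    qed
    then have cont: "continuous_on {0..L} \<phi>" by (simp add: continuous_on_def)
    have "(LINT x|lborel. indicator ?S x *\<^sub>R f' (?l x) $ 1) = 0"
    proof (rule ftc_zero[where a = 0 and b = L and \<phi> = \<phi>])
      show "continuous_on ?S (\<lambda>x. f' (?l x) $ 1)" "bounded ((\<lambda>x. f' (?l x) $ 1) ` ?S)"
        using bounded_line[OF bcont_component[OF C1_bcont_grad[OF f]], of ?S 1 2 3 y z] cl by auto
      show "\<phi> 0 = \<phi> L" by (simp add: \<phi>_def)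
    qed (use L der cont in auto)
    then show ?thesis by (simp add: indicator_def cell cong: if_cong)
  next
    case False
    then have "?l x \<notin> cell L" for x by (auto simp: cell_def coords_def)
    then show ?thesis by simp
  qed
qed auto

lemma C1_D: "C1 L f f' \<Longrightarrow> p \<in> open_slab L \<Longrightarrow> (f has_derivative (\<lambda>v. f' p \<bullet> v)) (at p)"
  by (simp add: C1_def)

lemma C1_I:
  assumes "\<And>p. p \<in> open_slab L \<Longrightarrow> (f has_derivative (\<lambda>v. f' p \<bullet> v)) (at p)"
    and "bcont L f" "bcont L f'"
    and "\<And>p. p \<in> open_slab L \<Longrightarrow> f (p + axis 2 1) = f p \<and> f (p + axis 3 1) = f p"
  shows "C1 L f f'"
  using assms by (auto simp: C1_def bcont_def)

lemma C1_periodic: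
  "C1 L f f' \<Longrightarrow> p \<in> open_slab L \<Longrightarrow> f (p + axis 2 1) = f p"
  "C1 L f f' \<Longrightarrow> p \<in> open_slab L \<Longrightarrow> f (p + axis 3 1) = f p"
  by (auto simp: C1_def)

lemma C1_const: "C1 L (\<lambda>p. c) (\<lambda>p. 0)"
  by (rule C1_I) (auto intro: bcont_const)

lemma C1_add: "C1 L f f' \<Longrightarrow> C1 L g g' \<Longrightarrow> C1 L (\<lambda>p. f p + g p) (\<lambda>p. f' p + g' p)"
  by (rule C1_I)
    (auto intro: bcont_add C1_bcont C1_bcont_grad
      simp: C1_periodic inner_left_distrib intro!: derivative_eq_intros dest: C1_D)

lemma C1_mult:
  "C1 L f f' \<Longrightarrow> C1 L g g' \<Longrightarrow> C1 L (\<lambda>p. f p * g p) (\<lambda>p. f p *\<^sub>R g' p + g p *\<^sub>R f' p)"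
  by (rule C1_I, auto intro: bcont_mult C1_bcont
      simp: C1_periodic inner_left_distrib mult.commute intro!: derivative_eq_intros dest: C1_D)
    (intro bcont_add bcont_scaleR C1_bcont C1_bcont_grad; assumption)

lemma C1_cmult: "C1 L f f' \<Longrightarrow> C1 L (\<lambda>p. c * f p) (\<lambda>p. c *\<^sub>R f' p)"
  using C1_mult[OF C1_const, of L f f' c] by simp

lemma C1_minus: "C1 L f f' \<Longrightarrow> C1 L (\<lambda>p. - f p) (\<lambda>p. - f' p)"
  using C1_cmult[of L f f' "-1"] by simp

lemma C1_diff: "C1 L f f' \<Longrightarrow> C1 L g g' \<Longrightarrow> C1 L (\<lambda>p. f p - g p) (\<lambda>p. f' p - g' p)"
  using C1_add[OF _ C1_minus, of L f f' g g'] by simp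

lemma C1_compose:
  assumes f: "C1 L f f'" and g: "\<And>s. (g has_real_derivative g' s) (at s)" "continuous_on UNIV g'"
  shows "C1 L (\<lambda>p. g (f p)) (\<lambda>p. g' (f p) *\<^sub>R f' p)"
proof (rule C1_I)
  have "continuous_on UNIV g" using g(1) by (intro continuous_at_imp_continuous_on) (auto dest: DERIV_isCont)
  then show "bcont L (\<lambda>p. g (f p))" by (rule bcont_compose_UNIV[OF C1_bcont[OF f]])
  show "bcont L (\<lambda>p. g' (f p) *\<^sub>R f' p)"
    by (intro bcont_scaleR bcont_compose_UNIV[OF C1_bcont[OF f]] g C1_bcont_grad[OF f])
  show "((\<lambda>p. g (f p)) has_derivative (\<lambda>v. (g' (f p) *\<^sub>R f' p) \<bullet> v)) (at p)" if "p \<in> open_slab L" for p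
    using diff_chain_at[OF C1_D[OF f that] g(1)[unfolded has_field_derivative_def]]
    by (simp add: o_def)
qed (auto simp: C1_periodic[OF f])

lemma C1_cong:
  assumes "C1 L f f'" "\<And>p. p \<in> open_slab L \<Longrightarrow> g p = f p" "\<And>p. p \<in> open_slab L \<Longrightarrow> g' p = f' p"
  shows "C1 L g g'"
proof (rule C1_I)
  show "bcont L g" "bcont L g'"
    using assms bcont_cong[of L g f] bcont_cong[of L g' f'] C1_bcont C1_bcont_grad by blast+
  show "(g has_derivative (\<lambda>v. g' p \<bullet> v)) (at p)" if "p \<in> open_slab L" for p
    using C1_D[OF assms(1) that] assms(2,3) that
    by (auto intro: has_derivative_transform_within_open[OF _ open_slab_open that])
qed (use assms slab_shift in \<open>auto simp: C1_periodic\<close>)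

lemma C1_of_x:
  assumes der: "\<And>x. 0 < x \<Longrightarrow> x < L \<Longrightarrow> (f has_real_derivative f' x) (at x)"
    and f': "continuous_on {0<..<L} f'" "bounded (f ` {0<..<L})" "bounded (f' ` {0<..<L})"
  shows "C1 L (\<lambda>p. f (p $ 1)) (\<lambda>p. f' (p $ 1) *\<^sub>R axis 1 1)"
proof -
  have *: "bcont L (\<lambda>p. h (p $ 1))" if "continuous_on {0<..<L} h" "bounded (h ` {0<..<L})" for h :: "real \<Rightarrow> real"
    unfolding bcont_def
  proof
    show "continuous_on (open_slab L) (\<lambda>p. h (p $ 1))"
      by (rule continuous_on_compose2[OF that(1)]) (auto intro!: continuous_intros simp: open_slab_def)
    show "bounded ((\<lambda>p. h (p $ 1)) ` closed_cell L)"
      by (rule bounded_subset[OF that(2)]) (auto simp: closed_cell_def open_slab_def)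
  qed
  show ?thesis
  proof (rule C1_I)
    show "bcont L (\<lambda>p. f (p $ 1))"
      using f' DERIV_isCont[OF der] by (intro * continuous_at_imp_continuous_on) auto
    show "bcont L (\<lambda>p. f' (p $ 1) *\<^sub>R axis 1 1)"
      using f' by (intro bcont_scaleR bcont_const *)
    show "((\<lambda>p. f (p $ 1)) has_derivative (\<lambda>v. (f' (p $ 1) *\<^sub>R axis 1 1) \<bullet> v)) (at p)" if "p \<in> open_slab L" for p
    proof -
      have 1: "((\<lambda>p. p $ 1) has_derivative (\<lambda>v. v $ 1)) (at p)"
        by (intro bounded_linear_imp_has_derivative bounded_linear_vec_nth)
      have 2: "(f has_derivative (*) (f' (p $ 1))) (at (p $ 1))"
        using der[of "p $ 1"] that by (auto simp: has_field_derivative_def open_slab_def)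
      show ?thesis
        using diff_chain_at[OF 1 2] by (simp add: o_def inner_axis')
    qed
  qed (auto simp: axis_def)
qed

lemma grad_eq: "C1 L f f' \<Longrightarrow> p \<in> open_slab L \<Longrightarrow> grad f p = f' p"
  using frechet_derivative_at[OF C1_D, of L f f' p, symmetric] by (simp add: grad_def vec_eq_iff inner_axis)

text \<open>Fields with differentiable components. The component gradients are hidden, since only the
divergence enters the integral theorems.\<close>

definition has_div :: "real \<Rightarrow> (real ^ 3 \<Rightarrow> real ^ 3) \<Rightarrow> (real ^ 3 \<Rightarrow> real) \<Rightarrow> bool" where
  "has_div L F d \<longleftrightarrow> (\<exists>A. (\<forall>i. C1 L (\<lambda>p. F p $ i) (A i)) \<and>
      (\<forall>p\<in>open_slab L. d p = (\<Sum>i\<in>UNIV. A i p $ i)))"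

lemma has_div_bcont: "has_div L F d \<Longrightarrow> bcont L F"
  unfolding has_div_def by (auto intro: bcont_vec C1_bcont)

lemma has_div_bcont_div: "has_div L F d \<Longrightarrow> bcont L d"
proof -
  assume "has_div L F d"
  then obtain A where A: "\<And>i. C1 L (\<lambda>p. F p $ i) (A i)"
    and d: "\<And>p. p \<in> open_slab L \<Longrightarrow> d p = (\<Sum>i\<in>UNIV. A i p $ i)"
    unfolding has_div_def by blast
  have "bcont L (\<lambda>p. \<Sum>i\<in>UNIV. A i p $ i)"
    by (intro bcont_sum bcont_component C1_bcont_grad[OF A])
  then show ?thesis using bcont_cong[of L d "\<lambda>p. \<Sum>i\<in>UNIV. A i p $ i"] d by simp
qed

lemma has_div_add:
  assumes "has_div L F d" "has_div L G e"
  shows "has_div L (\<lambda>p. F p + G p) (\<lambda>p. d p + e p)"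
proof -
  obtain A B where "\<And>i. C1 L (\<lambda>p. F p $ i) (A i)" "\<And>i. C1 L (\<lambda>p. G p $ i) (B i)"
    "\<And>p. p \<in> open_slab L \<Longrightarrow> d p = (\<Sum>i\<in>UNIV. A i p $ i)"
    "\<And>p. p \<in> open_slab L \<Longrightarrow> e p = (\<Sum>i\<in>UNIV. B i p $ i)"
    using assms unfolding has_div_def by blast
  then show ?thesis
    unfolding has_div_def
    by (intro exI[of _ "\<lambda>i p. A i p + B i p"]) (auto simp: C1_add sum.distrib)
qed

lemma has_div_scale:
  assumes F: "has_div L F d" and f: "C1 L f f'"
  shows "has_div L (\<lambda>p. f p *\<^sub>R F p) (\<lambda>p. f p * d p + F p \<bullet> f' p)"
proof -
  obtain A where A: "\<And>i. C1 L (\<lambda>p. F p $ i) (A i)"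
    and d: "\<And>p. p \<in> open_slab L \<Longrightarrow> d p = (\<Sum>i\<in>UNIV. A i p $ i)"
    using F unfolding has_div_def by blast
  have "C1 L (\<lambda>p. f p * F p $ i) (\<lambda>p. f p *\<^sub>R A i p + (F p $ i) *\<^sub>R f' p)" for i
    by (rule C1_mult[OF f A])
  then show ?thesis
    unfolding has_div_def
    by (intro exI[of _ "\<lambda>i p. f p *\<^sub>R A i p + (F p $ i) *\<^sub>R f' p"])
      (auto simp: d sum.distrib sum_distrib_left inner_vec_def)
qed

lemma has_div_cmult: "has_div L F d \<Longrightarrow> has_div L (\<lambda>p. c *\<^sub>R F p) (\<lambda>p. c * d p)"
  using has_div_scale[OF _ C1_const, of L F d c] by simp

lemma has_div_diff:
  "has_div L F d \<Longrightarrow> has_div L G e \<Longrightarrow> has_div L (\<lambda>p. F p - G p) (\<lambda>p. d p - e p)"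
  using has_div_add[OF _ has_div_cmult, of L F d G e "-1"] by simp

lemma has_div_normal:
  assumes "C1 L f f'"
  shows "has_div L (\<lambda>p. f p *\<^sub>R axis 1 1) (\<lambda>p. f' p $ 1)"
proof -
  have "C1 L (\<lambda>p. (f p *\<^sub>R axis 1 1 :: real ^ 3) $ i) (\<lambda>p. if i = 1 then f' p else 0)" for i
    using assms C1_const[of L 0] by (cases "i = 1") (auto simp: axis_def)
  then show ?thesis
    unfolding has_div_def
    by (intro exI[of _ "\<lambda>i p. if i = 1 then f' p else 0"])
      (auto simp: sum_3)
qed

lemma divg_eq:
  assumes "has_div L F d" "p \<in> open_slab L"
  shows "divg F p = d p"
proof -
  obtain A where A: "\<And>i. C1 L (\<lambda>p. F p $ i) (A i)"
    and d: "d p = (\<Sum>i\<in>UNIV. A i p $ i)"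
    using assms unfolding has_div_def by blast
  have "(F has_derivative (\<lambda>v. \<chi> i. A i p \<bullet> v)) (at p)"
    unfolding has_derivative_componentwise_within[of F] 
    using C1_D[OF A assms(2)] by (auto simp: Basis_vec_def inner_axis)
  from frechet_derivative_at[OF this, symmetric] show ?thesis
    by (simp add: divg_def d inner_axis)
qed

theorem divergence_integral_zero:
  assumes L: "L > 0" and F: "has_div L F d" and v: "vanishing_bound L F"
  shows "cell_integral L d = 0"
proof -
  obtain A where A: "\<And>i. C1 L (\<lambda>p. F p $ i) (A i)"
    and d: "\<And>p. p \<in> open_slab L \<Longrightarrow> d p = (\<Sum>i\<in>UNIV. A i p $ i)"
    using F unfolding has_div_def by blast
  have "vanishing_bound L (\<lambda>p. F p $ 1)"
    using v order_trans[OF Finite_Cartesian_Product.norm_nth_le] unfolding vanishing_bound_def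
    by blast
  then have 1: "cell_integral L (\<lambda>p. A 1 p $ 1) = 0"
    by (rule cell_integral_normal_derivative[OF L A])
  have "cell_integral L d = cell_integral L (\<lambda>p. \<Sum>i\<in>UNIV. A i p $ i)"
    by (intro ci_cong d)
  also have "\<dots> = (\<Sum>i\<in>UNIV. cell_integral L (\<lambda>p. A i p $ i))"
    by (intro ci_sum bcont_component C1_bcont_grad[OF A])
  also have "\<dots> = 0"
    using 1 cell_integral_periodic_derivative[OF A] by (simp add: sum_3)
  finally show ?thesis .
qed

lemma vanishing_bound_scale:
  assumes "bcont L F" "vanishing L \<psi>"
  shows "vanishing_bound L (\<lambda>p. \<psi> p *\<^sub>R F p)"
proof -
  obtain B where "\<And>p. p \<in> closed_cell L \<Longrightarrow> norm (F p) \<le> B"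
    using assms unfolding bcont_def bounded_iff by blast
  then show ?thesis
    unfolding vanishing_bound_def
    by (intro exI[of _ \<psi>] exI[of _ B]) (auto simp: assms mult.commute[of B] intro: mult_left_mono)
qed

lemma vanishing_bound_scale2:
  assumes "bcont L f" "vanishing_bound L F"
  shows "vanishing_bound L (\<lambda>p. f p *\<^sub>R F p)"
proof -
  obtain B where B: "\<And>p. p \<in> closed_cell L \<Longrightarrow> norm (f p) \<le> B"
    using assms unfolding bcont_def bounded_iff by blast
  obtain \<psi> C where \<psi>: "vanishing L \<psi>" "\<And>p. p \<in> closed_cell L \<Longrightarrow> norm (F p) \<le> C * \<bar>\<psi> p\<bar>"
    using assms unfolding vanishing_bound_def by blast
  have "norm (f p *\<^sub>R F p) \<le> (B * C) * \<bar>\<psi> p\<bar>" if "p \<in> closed_cell L" for p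
    using mult_mono[OF B[OF that] \<psi>(2)[OF that]] order_trans[OF norm_ge_zero B[OF that]]
    by (simp add: mult.assoc)
  then show ?thesis unfolding vanishing_bound_def using \<psi>(1) by blast
qed

theorem integration_by_parts:
  assumes L: "L > 0" and F: "has_div L F d" and \<psi>: "C1 L \<psi> \<psi>'" "vanishing L \<psi>"
  shows "cell_integral L (\<lambda>p. \<psi> p * d p) = - cell_integral L (\<lambda>p. F p \<bullet> \<psi>' p)"
proof -
  have "cell_integral L (\<lambda>p. \<psi> p * d p + F p \<bullet> \<psi>' p) = 0"
    by (rule divergence_integral_zero[OF L has_div_scale[OF F \<psi>(1)]
        vanishing_bound_scale[OF has_div_bcont[OF F] \<psi>(2)]])
  then show ?thesis
    by (subst (asm) ci_add)
      (auto intro!: bcont_mult bcont_inner C1_bcont[OF \<psi>(1)] C1_bcont_grad[OF \<psi>(1)] has_div_bcont[OF F] has_div_bcont_div[OF F])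
qed

lemma solenoidal_gradient_integral_zero:
  assumes L: "L > 0" and u: "has_div L u (\<lambda>p. 0)" "vanishing_bound L u" and f: "C1 L f f'"
  shows "cell_integral L (\<lambda>p. u p \<bullet> f' p) = 0"
  using divergence_integral_zero[OF L has_div_scale[OF u(1) f] vanishing_bound_scale2[OF C1_bcont[OF f] u(2)]]
  by simp

lemma vanishing_compose:
  assumes "continuous_on (closed_slab L) f" "continuous_on UNIV g"
    and "\<And>p. p $ 1 = 0 \<or> p $ 1 = L \<Longrightarrow> g (f p) = 0"
  shows "vanishing L (\<lambda>p. g (f p))"
  using assms unfolding vanishing_def by (auto intro: continuous_on_compose2)

lemma vanishing_add: "vanishing L f \<Longrightarrow> vanishing L g \<Longrightarrow> vanishing L (\<lambda>p. f p + g p)"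
  and vanishing_diff: "vanishing L f \<Longrightarrow> vanishing L g \<Longrightarrow> vanishing L (\<lambda>p. f p - g p)"
  and vanishing_mult: "vanishing L f \<Longrightarrow> continuous_on (closed_slab L) g \<Longrightarrow> vanishing L (\<lambda>p. f p * g p)"
  by (auto simp: vanishing_def intro!: continuous_intros)

text \<open>Integrate \<open>0 \<le> (\<partial>\<^sub>x f + m f)\<^sup>2 = (\<partial>\<^sub>x f)\<^sup>2 + (m f\<^sup>2)\<^sub>x - (m' - m\<^sup>2) f\<^sup>2\<close>, where \<open>m(x) = \<omega> tan (\<omega> x - 1)\<close>
solves \<open>m' - m\<^sup>2 = \<omega>\<^sup>2\<close>. For \<open>\<omega> = 2 / L\<close> the argument of the tangent stays in \<open>[-1, 1]\<close>, away from the poles.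
The optimal constant would be \<open>L\<^sup>2 / \<pi>\<^sup>2\<close>.\<close>

theorem poincare:
  assumes L: "L > 0" and f: "C1 L f f'" "vanishing L f"
  shows "cell_integral L (\<lambda>p. (f p)\<^sup>2) \<le> L\<^sup>2 / 4 * cell_integral L (\<lambda>p. (f' p $ 1)\<^sup>2)"
proof -
  define m where "m x = 2 / L * tan (2 / L * x - 1)" for x
  have range: "cos (2 / L * x - 1) > 0" if "0 \<le> x" "x \<le> L" for x
  proof (rule cos_gt_zero_pi)
    have "0 \<le> 2 / L * x" "2 / L * x \<le> 2" using that L by (auto simp: field_simps)
    then show "- (pi / 2) < 2 / L * x - 1" "2 / L * x - 1 < pi / 2"
      using pi_gt3 by linarith+
  qed
  have der: "(m has_real_derivative 4 / L\<^sup>2 + (m x)\<^sup>2) (at x)" if "0 \<le> x" "x \<le> L" for x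
  proof -
    have "inverse ((cos (2 / L * x - 1))\<^sup>2) = 1 + (tan (2 / L * x - 1))\<^sup>2"
      using range[OF that] tan_sec[of "2 / L * x - 1"] by (simp add: power_inverse)
    moreover have "(m has_real_derivative 2 / L * (inverse ((cos (2 / L * x - 1))\<^sup>2) * (2 / L))) (at x)"
      unfolding m_def using range[OF that] L
      by (intro DERIV_cmult DERIV_chain2[where f = tan] DERIV_tan) (auto intro!: derivative_eq_intros)
    ultimately show ?thesis
      using L by (simp add: m_def algebra_simps power2_eq_square)
  qed
  then have cont: "continuous_on {0..L} m"
    using DERIV_isCont[OF der] by (intro continuous_at_imp_continuous_on) auto
  have mC: "C1 L (\<lambda>p. m (p $ 1)) (\<lambda>p. (4 / L\<^sup>2 + (m (p $ 1))\<^sup>2) *\<^sub>R axis 1 1)"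
  proof (rule C1_of_x)
    have B: "bounded (m ` {0..L})" "bounded ((\<lambda>x. 4 / L\<^sup>2 + (m x)\<^sup>2) ` {0..L})"
      by (intro compact_imp_bounded compact_continuous_image continuous_intros cont; simp)+
    show "bounded (m ` {0<..<L})" by (rule bounded_subset[OF B(1)]) auto
    show "bounded ((\<lambda>x. 4 / L\<^sup>2 + (m x)\<^sup>2) ` {0<..<L})" by (rule bounded_subset[OF B(2)]) auto
    show "continuous_on {0<..<L} (\<lambda>x. 4 / L\<^sup>2 + (m x)\<^sup>2)"
      by (intro continuous_intros continuous_on_subset[OF cont]) auto
  qed (use der in auto)
  have F: "has_div L (\<lambda>p. m (p $ 1) *\<^sub>R axis 1 1) (\<lambda>p. 4 / L\<^sup>2 + (m (p $ 1))\<^sup>2)"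
    using has_div_normal[OF mC] by simp
  have f2: "C1 L (\<lambda>p. (f p)\<^sup>2) (\<lambda>p. (2 * f p) *\<^sub>R f' p)"
    by (rule C1_cong[OF C1_mult[OF f(1) f(1)]]) (auto simp: power2_eq_square scaleR_add_left[symmetric])
  have v2: "vanishing L (\<lambda>p. (f p)\<^sup>2)"
    using f(2) by (auto simp: vanishing_def intro!: continuous_intros)
  note bc = bcont_intros C1_bcont[OF f(1)] C1_bcont_grad[OF f(1)] C1_bcont[OF mC]
  have "cell_integral L (\<lambda>p. 4 / L\<^sup>2 * (f p)\<^sup>2)
     \<le> cell_integral L (\<lambda>p. (f' p $ 1)\<^sup>2 + ((f p)\<^sup>2 * (4 / L\<^sup>2 + (m (p $ 1))\<^sup>2) + (m (p $ 1) *\<^sub>R axis 1 1) \<bullet> ((2 * f p) *\<^sub>R f' p)))"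
  proof (rule ci_mono)
    fix p
    have "0 \<le> (f' p $ 1 + m (p $ 1) * f p)\<^sup>2" by simp
    then show "4 / L\<^sup>2 * (f p)\<^sup>2 \<le> (f' p $ 1)\<^sup>2 + ((f p)\<^sup>2 * (4 / L\<^sup>2 + (m (p $ 1))\<^sup>2) + (m (p $ 1) *\<^sub>R axis 1 1) \<bullet> ((2 * f p) *\<^sub>R f' p))"
      by (simp add: inner_axis' power2_sum algebra_simps power_mult_distrib)
  qed (intro bc)+
  also have "\<dots> = cell_integral L (\<lambda>p. (f' p $ 1)\<^sup>2)"
    using integration_by_parts[OF L F f2 v2]
    by (subst ci_add; (intro bc)?)+ simp
  finally have "4 / L\<^sup>2 * cell_integral L (\<lambda>p. (f p)\<^sup>2) \<le> cell_integral L (\<lambda>p. (f' p $ 1)\<^sup>2)"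
    by (simp only: ci_cmult)
  then show ?thesis using L by (simp add: field_simps)
qed

lemma Ck_on_continuous: "Ck_on k S f \<Longrightarrow> continuous_on S f"
  by (cases k) (auto intro: has_derivative_continuous_on)

section \<open>Time slices of space-time smooth functions\<close>

lemma has_div_cong:
  "has_div L F d \<Longrightarrow> (\<And>p. p \<in> open_slab L \<Longrightarrow> e p = d p) \<Longrightarrow> has_div L F e"
  unfolding has_div_def by auto

lemma Ck_on_inner: "Ck_on k S f \<Longrightarrow> Ck_on k S (\<lambda>x. f x \<bullet> b)"
proof (induction k arbitrary: f)
  case 0
  then show ?case by (auto intro: continuous_intros)
next
  case (Suc k)
  then obtain f' where f': "\<And>x. x \<in> S \<Longrightarrow> (f has_derivative f' x) (at x within S)"
    "\<And>v. v \<in> Basis \<Longrightarrow> Ck_on k S (\<lambda>x. f' x v)"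
    by auto
  then show ?case
    using Suc.IH
    by (auto intro!: exI[of _ "\<lambda>x v. f' x v \<bullet> b"] has_derivative_inner_left)
qed

abbreviation spacetime :: "real \<Rightarrow> (real \<times> (real ^ 3)) set" where
  "spacetime L \<equiv> {0<..} \<times> closed_slab L"

lemma spacetime_at_within:
  assumes "t > 0" "p \<in> open_slab L"
  shows "at (t, p) within spacetime L = at (t, p)"
  by (rule at_within_open_subset[of _ "{0<..} \<times> open_slab L"])
    (use assms open_slab_open open_slab_closed_slab in \<open>auto intro: open_Times\<close>)

text \<open>Splits the derivative in time and space into a time derivative and a gradient that inherit the
remaining order of smoothness.\<close>

lemma Ck_on_spacetime:
  fixes f :: "real \<Rightarrow> real ^ 3 \<Rightarrow> real"
  assumes "Ck_on (Suc k) (spacetime L) (\<lambda>(t, p). f t p)"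
  obtains ft fg where
    "\<And>t p. t > 0 \<Longrightarrow> p \<in> open_slab L \<Longrightarrow>
      ((\<lambda>(t, p). f t p) has_derivative (\<lambda>(s, v). ft t p * s + fg t p \<bullet> v)) (at (t, p))"
    "Ck_on k (spacetime L) (\<lambda>(t, p). ft t p)"
    "\<And>i. Ck_on k (spacetime L) (\<lambda>(t, p). fg t p $ i)"
proof -
  obtain f' where f': "\<And>w. w \<in> spacetime L \<Longrightarrow> ((\<lambda>(t, p). f t p) has_derivative f' w) (at w within spacetime L)"
    and C: "\<And>b. b \<in> Basis \<Longrightarrow> Ck_on k (spacetime L) (\<lambda>w. f' w b)"
    using assms by auto
  let ?ft = "\<lambda>t p. f' (t, p) (1, 0)" and ?fg = "\<lambda>t p. \<chi> i. f' (t, p) (0, axis i 1)"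
  show thesis
  proof
    fix t :: real and p :: "real ^ 3" assume tp: "t > 0" "p \<in> open_slab L"
    then have D: "((\<lambda>(t, p). f t p) has_derivative f' (t, p)) (at (t, p))"
      using f'[of "(t, p)"] spacetime_at_within[OF tp] open_slab_closed_slab by auto
    then interpret linear "f' (t, p)" by (rule has_derivative_linear)
    have eq: "f' (t, p) (s, v) = ?ft t p * s + ?fg t p \<bullet> v" for s v
    proof -
      have lin: "linear (\<lambda>v. f' (t, p) (0, v))"
        using add[of "(0, _)" "(0, _)"] scaleR[of _ "(0, _)"] by (intro linearI) auto
      have "f' (t, p) (s, v) = f' (t, p) (s *\<^sub>R (1, 0)) + f' (t, p) (0, v)"
        using add[of "s *\<^sub>R (1, 0)" "(0, v)"] by simp
      also have "f' (t, p) (s *\<^sub>R (1, 0)) = ?ft t p * s"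
        by (simp only: scaleR) simp
      also have "f' (t, p) (0, v) = f' (t, p) (0, \<Sum>i\<in>UNIV. (v $ i) *\<^sub>R axis i 1)"
        by (simp add: basis_expansion flip: scalar_mult_eq_scaleR)
      also have "\<dots> = (\<Sum>i\<in>UNIV. (v $ i) * f' (t, p) (0, axis i 1))"
        by (simp add: linear_sum[OF lin] linear_cmul[OF lin])
      also have "\<dots> = ?fg t p \<bullet> v"
        by (simp add: inner_vec_def mult.commute)
      finally show ?thesis .
    qed
    have "f' (t, p) w = (case w of (s, v) \<Rightarrow> ?ft t p * s + ?fg t p \<bullet> v)" for w
      by (cases w) (simp only: prod.case, rule eq)
    then have "f' (t, p) = (\<lambda>(s, v). ?ft t p * s + ?fg t p \<bullet> v)" by (rule ext)
    with D show "((\<lambda>(t, p). f t p) has_derivative (\<lambda>(s, v). ?ft t p * s + ?fg t p \<bullet> v)) (at (t, p))"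
      by (simp only:)
  next
    show "Ck_on k (spacetime L) (\<lambda>(t, p). ?ft t p)"
    proof -
      have "(\<lambda>(t, p). ?ft t p) = (\<lambda>w. f' w (1, 0))" by auto
      then show ?thesis using C[of "(1, 0)"] by (simp add: Basis_prod_def)
    qed
    show "Ck_on k (spacetime L) (\<lambda>(t, p). ?fg t p $ i)" for i
    proof -
      have "(\<lambda>(t, p). ?fg t p $ i) = (\<lambda>w. f' w (0, axis i 1))" by auto
      then show ?thesis using C[of "(0, axis i 1)"] by (simp add: Basis_prod_def)
    qed
  qed
qed

lemma spacetime_locally_bounded:
  fixes f :: "real \<Rightarrow> real ^ 3 \<Rightarrow> real"
  assumes "continuous_on (spacetime L) (\<lambda>(t, p). f t p)" "0 < a"
  shows "\<exists>B. \<forall>t\<in>{a..b}. \<forall>p\<in>closed_cell L. \<bar>f t p\<bar> \<le> B"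
proof -
  let ?R = "{a..b} \<times> cbox 0 (\<chi> i. if i = 1 then L else 1 :: real ^ 3)"
  have "?R \<subseteq> spacetime L"
    using assms(2) by (auto simp: closed_slab_def mem_box_cart forall_3)
  then have "compact ((\<lambda>(t, p). f t p) ` ?R)"
    by (intro compact_continuous_image compact_Times compact_Icc compact_cbox continuous_on_subset[OF assms(1)])
  then have "bounded ((\<lambda>(t, p). f t p) ` ?R)" by (rule compact_imp_bounded)
  then obtain B where B: "\<And>x. x \<in> (\<lambda>(t, p). f t p) ` ?R \<Longrightarrow> norm x \<le> B"
    unfolding bounded_iff by blast
  have "\<bar>f t p\<bar> \<le> B" if "t \<in> {a..b}" "p \<in> closed_cell L" for t p
    using B[of "f t p"] that by (force simp: closed_cell_def open_slab_def mem_box_cart forall_3)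
  then show ?thesis by blast
qed

lemma spacetime_slice:
  assumes "continuous_on (spacetime L) (\<lambda>(t, p). f t p)" "t > 0"
  shows "continuous_on (closed_slab L) (f t)"
proof -
  have "continuous_on (closed_slab L) (\<lambda>p. case (t, p) of (t, p) \<Rightarrow> f t p)"
    using assms(2) by (intro continuous_on_compose2[OF assms(1)] continuous_intros) auto
  then show ?thesis by simp
qed

lemma spacetime_slice_bcont:
  fixes f :: "real \<Rightarrow> real ^ 3 \<Rightarrow> real"
  assumes "continuous_on (spacetime L) (\<lambda>(t, p). f t p)" "t > 0"
  shows "bcont L (f t)"
proof -
  obtain B where "\<And>p. p \<in> closed_cell L \<Longrightarrow> \<bar>f t p\<bar> \<le> B"
    using spacetime_locally_bounded[OF assms, of t] by auto
  then show ?thesis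
    using spacetime_slice[OF assms] open_slab_closed_slab
    unfolding bcont_def by (auto intro: continuous_on_subset intro!: boundedI)
qed

lemma gradient_periodic:
  assumes f: "\<And>p. p \<in> open_slab L \<Longrightarrow> (f has_derivative (\<lambda>v. f' p \<bullet> v)) (at p)"
    and per: "\<And>p. p \<in> open_slab L \<Longrightarrow> f (p + e) = f p"
    and e: "\<And>p. p \<in> open_slab L \<Longrightarrow> p + e \<in> open_slab L"
    and p: "p \<in> open_slab L"
  shows "f' (p + e) = f' p"
proof -
  have "((\<lambda>p. p + e) has_derivative (\<lambda>v. v)) (at p)" by (auto intro!: derivative_eq_intros)
  from diff_chain_at[OF this f[OF e[OF p]]]
  have "((\<lambda>p. f (p + e)) has_derivative (\<lambda>v. f' (p + e) \<bullet> v)) (at p)" by (simp add: o_def)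
  then have "(f has_derivative (\<lambda>v. f' (p + e) \<bullet> v)) (at p)"
    by (rule has_derivative_transform_within_open[OF _ open_slab_open p]) (simp add: per)
  from has_derivative_unique[OF this f[OF p]] have "f' (p + e) \<bullet> v = f' p \<bullet> v" for v
    by (rule fun_cong)
  then show ?thesis using vector_eq_rdot by blast
qed

lemma C1_gradient_periodic:
  assumes "C1 L f f'" "p \<in> open_slab L"
  shows "f' (p + axis 2 1) = f' p" "f' (p + axis 3 1) = f' p"
  using gradient_periodic[of L f f'] assms slab_shift by (auto simp: C1_def)

lemma Ck_on_slice_C1:
  fixes f :: "real \<Rightarrow> real ^ 3 \<Rightarrow> real"
  assumes C: "continuous_on (spacetime L) (\<lambda>(t, p). f t p)"
    and D: "\<And>t p. t > 0 \<Longrightarrow> p \<in> open_slab L \<Longrightarrow>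
      ((\<lambda>(t, p). f t p) has_derivative (\<lambda>(s, v). ft t p * s + fg t p \<bullet> v)) (at (t, p))"
    and Cg: "\<And>i. continuous_on (spacetime L) (\<lambda>(t, p). fg t p $ i)"
    and per: "\<And>p. p \<in> open_slab L \<Longrightarrow> f t (p + axis 2 1) = f t p \<and> f t (p + axis 3 1) = f t p"
    and t: "t > 0"
  shows "C1 L (f t) (fg t)"
proof (rule C1_I)
  show "bcont L (f t)" by (rule spacetime_slice_bcont[OF C t])
  show "bcont L (fg t)" by (rule bcont_vec) (rule spacetime_slice_bcont[OF Cg t])
  show "(f t has_derivative (\<lambda>v. fg t p \<bullet> v)) (at p)" if p: "p \<in> open_slab L" for p
  proof -
    have "((\<lambda>p. (t, p)) has_derivative (\<lambda>v. (0, v))) (at p)" by (auto intro!: derivative_eq_intros)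
    from diff_chain_at[OF this D[OF t p]] show ?thesis by (simp add: o_def)
  qed
qed (rule per)

lemma Ck_on_time_derivative:
  assumes D: "((\<lambda>(t, p). f t p) has_derivative (\<lambda>(s, v). a * s + b \<bullet> v)) (at (t, p))"
  shows "((\<lambda>s. f s p :: real) has_real_derivative a) (at t)"
proof -
  have "((\<lambda>s. (s, p)) has_derivative (\<lambda>s. (s, 0))) (at t)" by (auto intro!: derivative_eq_intros)
  from diff_chain_at[OF this D] show ?thesis
    by (simp add: o_def has_field_derivative_def)
qed

lemma spacetime_smooth_C1:
  fixes f :: "real \<Rightarrow> real ^ 3 \<Rightarrow> real"
  assumes f: "spacetime_smooth L f" and t: "t > 0"
  shows "C1 L (f t) (grad (f t))" "has_div L (grad (f t)) (laplace (f t))"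
proof -
  have per: "f t (p + axis 2 1) = f t p \<and> f t (p + axis 3 1) = f t p" if "p \<in> open_slab L" for p
    using f t that open_slab_closed_slab by (auto simp: spacetime_smooth_def yz_periodic_def)
  have C2: "Ck_on (Suc (Suc 0)) (spacetime L) (\<lambda>(t, p). f t p)"
    using f unfolding spacetime_smooth_def smooth_on_def by blast
  obtain ft fg where D: "\<And>t p. t > 0 \<Longrightarrow> p \<in> open_slab L \<Longrightarrow>
      ((\<lambda>(t, p). f t p) has_derivative (\<lambda>(s, v). ft t p * s + fg t p \<bullet> v)) (at (t, p))"
    and Cg: "\<And>i. Ck_on (Suc 0) (spacetime L) (\<lambda>(t, p). fg t p $ i)"
    using Ck_on_spacetime[OF C2] by metis
  have fC: "C1 L (f t) (fg t)"
    by (rule Ck_on_slice_C1[OF Ck_on_continuous[OF C2] D Ck_on_continuous[OF Cg] per t])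
  then have eq: "grad (f t) p = fg t p" if "p \<in> open_slab L" for p
    using grad_eq that by blast
  show "C1 L (f t) (grad (f t))"
    using fC by (rule C1_cong) (simp_all add: eq)
  have "\<exists>A. C1 L (\<lambda>p. grad (f t) p $ i) A" for i
  proof -
    obtain gt gg where D: "\<And>t p. t > 0 \<Longrightarrow> p \<in> open_slab L \<Longrightarrow>
      ((\<lambda>(t, p). fg t p $ i) has_derivative (\<lambda>(s, v). gt t p * s + gg t p \<bullet> v)) (at (t, p))"
      and Cg2: "\<And>j. Ck_on 0 (spacetime L) (\<lambda>(t, p). gg t p $ j)"
      using Ck_on_spacetime[OF Cg[of i]] by metis
    have "C1 L (\<lambda>p. fg t p $ i) (gg t)"
      by (rule Ck_on_slice_C1[OF Ck_on_continuous[OF Cg[of i]] D Ck_on_continuous[OF Cg2] _ t])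
        (auto simp: C1_gradient_periodic[OF fC])
    then have "C1 L (\<lambda>p. grad (f t) p $ i) (gg t)"
      by (rule C1_cong) (simp_all add: eq)
    then show ?thesis by blast
  qed
  then obtain A where "\<And>i. C1 L (\<lambda>p. grad (f t) p $ i) (A i)" by metis
  then have *: "has_div L (grad (f t)) (\<lambda>p. \<Sum>i\<in>UNIV. A i p $ i)" by (auto simp: has_div_def)
  then show "has_div L (grad (f t)) (laplace (f t))"
    unfolding laplace_def by (rule has_div_cong) (rule divg_eq[OF *])
qed

lemma spacetime_smooth_continuous:
  "spacetime_smooth L f \<Longrightarrow> continuous_on (spacetime L) (\<lambda>(t, p). f t p)"
  unfolding spacetime_smooth_def smooth_on_def using Ck_on_continuous by blast

lemma spacetime_smooth_time_derivative:
  fixes f :: "real \<Rightarrow> real ^ 3 \<Rightarrow> real"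
  assumes f: "spacetime_smooth L f"
  shows "t > 0 \<Longrightarrow> p \<in> open_slab L \<Longrightarrow> ((\<lambda>s. f s p) has_real_derivative deriv (\<lambda>s. f s p) t) (at t)"
    and "t > 0 \<Longrightarrow> bcont L (\<lambda>p. deriv (\<lambda>s. f s p) t)"
    and "a > 0 \<Longrightarrow> \<exists>B. \<forall>t\<in>{a..b}. \<forall>p\<in>closed_cell L. \<bar>deriv (\<lambda>s. f s p) t\<bar> \<le> B"
proof -
  have C2: "Ck_on (Suc 0) (spacetime L) (\<lambda>(t, p). f t p)"
    using f unfolding spacetime_smooth_def smooth_on_def by blast
  obtain ft fg where D: "\<And>t p. t > 0 \<Longrightarrow> p \<in> open_slab L \<Longrightarrow>
      ((\<lambda>(t, p). f t p) has_derivative (\<lambda>(s, v). ft t p * s + fg t p \<bullet> v)) (at (t, p))"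
    and C: "Ck_on 0 (spacetime L) (\<lambda>(t, p). ft t p)"
    using Ck_on_spacetime[OF C2] by metis
  have d: "((\<lambda>s. f s p) has_real_derivative ft t p) (at t)" if "t > 0" "p \<in> open_slab L" for t p
    by (rule Ck_on_time_derivative[OF D[OF that]])
  then have eq: "deriv (\<lambda>s. f s p) t = ft t p" if "t > 0" "p \<in> open_slab L" for t p
    using that DERIV_imp_deriv by blast
  show "t > 0 \<Longrightarrow> p \<in> open_slab L \<Longrightarrow> ((\<lambda>s. f s p) has_real_derivative deriv (\<lambda>s. f s p) t) (at t)"
    using d eq by simp
  show "bcont L (\<lambda>p. deriv (\<lambda>s. f s p) t)" if "t > 0"
    using spacetime_slice_bcont[OF Ck_on_continuous[OF C] that] bcont_cong[of L "ft t"] eq that by metis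
  show "\<exists>B. \<forall>t\<in>{a..b}. \<forall>p\<in>closed_cell L. \<bar>deriv (\<lambda>s. f s p) t\<bar> \<le> B" if a: "a > 0"
  proof -
    obtain B where "\<forall>t\<in>{a..b}. \<forall>p\<in>closed_cell L. \<bar>ft t p\<bar> \<le> B"
      using spacetime_locally_bounded[OF Ck_on_continuous[OF C] a, of b] by blast
    then show ?thesis
      using a eq closed_cell_subset_open_slab by (intro exI[of _ B]) (fastforce simp: subset_eq)
  qed
qed

lemma spacetime_smooth_component:
  fixes u :: "real \<Rightarrow> real ^ 3 \<Rightarrow> real ^ 3"
  assumes "spacetime_smooth L u"
  shows "spacetime_smooth L (\<lambda>t p. u t p $ i)"
proof -
  have "Ck_on k (spacetime L) (\<lambda>(t, p). u t p $ i)" for k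
  proof -
    have "(\<lambda>(t, p). u t p $ i) = (\<lambda>w. (case w of (t, p) \<Rightarrow> u t p) \<bullet> axis i 1)"
      by (auto simp: inner_axis)
    then show ?thesis
      using Ck_on_inner[of k "spacetime L" "\<lambda>(t, p). u t p" "axis i 1"] assms
      by (simp only: spacetime_smooth_def smooth_on_def)
  qed
  then show ?thesis
    using assms by (auto simp: spacetime_smooth_def smooth_on_def yz_periodic_def)
qed

lemma spacetime_smooth_has_div:
  fixes u :: "real \<Rightarrow> real ^ 3 \<Rightarrow> real ^ 3"
  assumes "spacetime_smooth L u" "t > 0"
  shows "has_div L (u t) (divg (u t))"
proof -
  have *: "has_div L (u t) (\<lambda>p. \<Sum>i\<in>UNIV. grad (\<lambda>p. u t p $ i) p $ i)"
    using spacetime_smooth_C1(1)[OF spacetime_smooth_component[OF assms(1)] assms(2)]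
    unfolding has_div_def by (intro exI[of _ "\<lambda>i. grad (\<lambda>p. u t p $ i)"]) auto
  then show ?thesis
    by (rule has_div_cong) (rule divg_eq[OF *])
qed

lemma vector_derivative_component:
  fixes u :: "real \<Rightarrow> real ^ 3 \<Rightarrow> real ^ 3"
  assumes u: "spacetime_smooth L u" and t: "t > 0" and p: "p \<in> open_slab L"
  shows "vector_derivative (\<lambda>s. u s p) (at t) $ i = deriv (\<lambda>s. u s p $ i) t"
proof -
  have "((\<lambda>s. u s p) has_vector_derivative (\<chi> i. deriv (\<lambda>s. u s p $ i) t)) (at t)"
    unfolding has_vector_derivative_def has_derivative_componentwise_within[of "\<lambda>s. u s p"]
    using spacetime_smooth_time_derivative(1)[OF spacetime_smooth_component[OF u] t p]
    by (auto simp: Basis_vec_def inner_axis has_field_derivative_def mult_commute_abs)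
  then show ?thesis by (simp add: vector_derivative_at)
qed

text \<open>By the mean value theorem the bound on the time derivative bounds the difference quotients, so
dominated convergence applies.\<close>

lemma cell_integral_has_derivative:
  assumes t: "a < t" "t < b"
    and der: "\<And>s p. a < s \<Longrightarrow> s < b \<Longrightarrow> p \<in> cell L \<Longrightarrow> ((\<lambda>s. F s p) has_real_derivative F' s p) (at s)"
    and bnd: "\<And>s p. a < s \<Longrightarrow> s < b \<Longrightarrow> p \<in> cell L \<Longrightarrow> \<bar>F' s p\<bar> \<le> B"
    and F: "\<And>s. a < s \<Longrightarrow> s < b \<Longrightarrow> bcont L (F s)" and F': "bcont L (F' t)"
  shows "((\<lambda>s. cell_integral L (F s)) has_real_derivative cell_integral L (F' t)) (at t)"
proof -
  define q where "q s p = (F s p - F t p) / (s - t)" for s p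
  have lip: "\<bar>q s p\<bar> \<le> B" if s: "a < s" "s < b" "s \<noteq> t" and p: "p \<in> cell L" for s p
  proof -
    have "norm (F s p - F t p) \<le> B * norm (s - t)"
      using t s bnd[OF _ _ p]
      by (intro field_differentiable_bound[of "{a<..<b}" "\<lambda>s. F s p" "\<lambda>s. F' s p"])
        (auto intro: DERIV_subset der p)
    then show ?thesis using s by (simp add: q_def divide_le_eq)
  qed
  have "((\<lambda>s. cell_integral L (q s)) \<longlongrightarrow> cell_integral L (F' t)) (at t)"
    unfolding tendsto_at_iff_sequentially o_def
  proof (intro allI impI)
    fix X :: "nat \<Rightarrow> real" assume X: "\<forall>i. X i \<in> UNIV - {t}" "X \<longlonglongrightarrow> t"
    have "\<forall>\<^sub>F n in sequentially. a < X n \<and> X n < b"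
      using X(2) t by (auto intro: eventually_conj order_tendstoD)
    then obtain N where N: "\<And>n. a < X (n + N) \<and> X (n + N) < b"
      unfolding eventually_sequentially by (metis le_add2)
    have "(\<lambda>n. cell_integral L (q (X (n + N)))) \<longlonglongrightarrow> cell_integral L (F' t)"
      unfolding cell_integral_def set_lebesgue_integral_def
    proof (rule integral_dominated_convergence[where w = "\<lambda>p. indicator (cell L) p *\<^sub>R B"])
      show "(\<lambda>p. indicator (cell L) p *\<^sub>R F' t p) \<in> borel_measurable lborel"
        using bcont_integrable[OF F'] by (auto simp: set_integrable_def)
      have "bcont L (q (X (n + N)))" for n
        unfolding q_def using N t by (simp add: divide_inverse) (intro bcont_intros F; simp)
      from bcont_integrable[OF this]
      show "(\<lambda>p. indicator (cell L) p *\<^sub>R q (X (n + N)) p) \<in> borel_measurable lborel" for n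
        by (auto simp: set_integrable_def)
      show "integrable lborel (\<lambda>p. indicator (cell L) p *\<^sub>R B)"
        using bcont_integrable[OF bcont_const] by (auto simp: set_integrable_def)
      show "AE p in lborel. norm (indicator (cell L) p *\<^sub>R q (X (n + N)) p) \<le> indicator (cell L) p *\<^sub>R B" for n
        using lip N X(1) by (intro AE_I2) (auto simp: indicator_def)
      show "AE p in lborel. (\<lambda>n. indicator (cell L) p *\<^sub>R q (X (n + N)) p) \<longlonglongrightarrow> indicator (cell L) p *\<^sub>R F' t p"
      proof (intro AE_I2)
        fix p
        have "(\<lambda>n. q (X (n + N)) p) \<longlonglongrightarrow> F' t p" if p: "p \<in> cell L"
        proof -
          have "((\<lambda>s. q s p) \<longlongrightarrow> F' t p) (at t)"
            using der[OF t p] by (simp add: has_field_derivative_iff q_def)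
          then show ?thesis
            using X LIMSEQ_ignore_initial_segment[OF X(2), of N]
            unfolding tendsto_at_iff_sequentially o_def by auto
        qed
        then show "(\<lambda>n. indicator (cell L) p *\<^sub>R q (X (n + N)) p) \<longlonglongrightarrow> indicator (cell L) p *\<^sub>R F' t p"
          by (auto simp: indicator_def)
      qed
    qed
    then show "(\<lambda>n. cell_integral L (q (X n))) \<longlonglongrightarrow> cell_integral L (F' t)"
      by (rule LIMSEQ_offset)
  qed
  moreover have "\<forall>\<^sub>F s in at t. a < s \<and> s < b \<and> s \<noteq> t"
  proof -
    have "\<forall>\<^sub>F s in nhds t. s \<in> {a<..<b}"
      using t by (intro eventually_nhds_in_open) auto
    then show ?thesis by (auto simp: eventually_at_filter elim!: eventually_mono)
  qed
  then have "\<forall>\<^sub>F s in at t. cell_integral L (q s) = (cell_integral L (F s) - cell_integral L (F t)) / (s - t)"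
  proof eventually_elim
    case (elim s)
    have "cell_integral L (q s) = inverse (s - t) * cell_integral L (\<lambda>p. F s p - F t p)"
      unfolding q_def ci_cmult[symmetric] by (simp add: divide_inverse mult.commute)
    then show ?case using elim t by (simp add: ci_diff F divide_inverse mult.commute)
  qed
  ultimately show ?thesis
    unfolding has_field_derivative_iff by (rule Lim_transform_eventually)
qed

section \<open>Comparison functionals and the Poisson coupling\<close>

text \<open>Smooth truncations are built as \<open>F (max s 0)\<close>; the condition \<open>F' 0 = 0\<close> makes the two branches fit to first order.\<close>

lemma DERIV_pos_part:
  fixes F F' :: "real \<Rightarrow> real"
  assumes F: "\<And>x. x \<ge> 0 \<Longrightarrow> (F has_real_derivative F' x) (at x)" and F0: "F' 0 = 0"
  shows "((\<lambda>s. F (max s 0)) has_real_derivative F' (max s 0)) (at s)"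
proof -
  consider "s > 0" | "s < 0" | "s = 0" by linarith
  then show ?thesis
  proof cases
    case 1
    then show ?thesis
      using F[of s] by (auto intro: has_field_derivative_transform_within_open[where S = "{0<..}" and f = F])
  next
    case 2
    have "((\<lambda>s. F 0) has_real_derivative 0) (at s)" by simp
    then show ?thesis
      using 2 F0 by (auto intro: has_field_derivative_transform_within_open[where S = "{..<0}" and f = "\<lambda>s. F 0"])
  next
    case 3
    have "((\<lambda>y. (F y - F 0) / (y - 0)) \<longlongrightarrow> 0) (at 0)"
      using F[of 0] F0 by (simp add: has_field_derivative_iff)
    then have "((\<lambda>y. (F y - F 0) / (y - 0)) \<longlongrightarrow> 0) (at_right 0)"
      by (simp add: filterlim_at_split)
    then have right: "((\<lambda>y. (F (max y 0) - F 0) / (y - 0)) \<longlongrightarrow> 0) (at_right 0)"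
      by (rule Lim_transform_eventually) (auto simp: eventually_at_right_less eventually_at_filter max_def intro!: always_eventually)
    have left: "((\<lambda>y. (F (max y 0) - F 0) / (y - 0)) \<longlongrightarrow> 0) (at_left 0)"
      by (rule Lim_transform_eventually[OF tendsto_const]) (auto simp: eventually_at_filter max_def intro!: always_eventually)
    show ?thesis
      using left right 3 F0 by (simp add: has_field_derivative_iff filterlim_at_split)
  qed
qed

lemma DERIV_pos_part_power:
  "((\<lambda>s. max s 0 ^ Suc (Suc n)) has_real_derivative real (Suc (Suc n)) * max s 0 ^ Suc n) (at s)"
  by (rule DERIV_pos_part[where F = "\<lambda>x. x ^ Suc (Suc n)" and F' = "\<lambda>x. real (Suc (Suc n)) * x ^ Suc n"])
    (use DERIV_pow[of "Suc (Suc n)"] in auto)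

lemma antiderivative_exists:
  fixes f :: "real \<Rightarrow> real"
  assumes "continuous_on UNIV f"
  obtains F where "\<And>x. (F has_real_derivative f x) (at x)"
proof -
  have "\<exists>F. \<forall>x::real. -\<infinity> < ereal x \<longrightarrow> ereal x < \<infinity> \<longrightarrow> (F has_vector_derivative f x) (at x)"
    by (rule einterval_antiderivative) (use assms in \<open>auto simp: continuous_on_eq_continuous_at\<close>)
  then show thesis
    using that by (auto simp: has_real_derivative_iff_has_vector_derivative)
qed

text \<open>Two concentrations with gradients \<open>g1\<close> and \<open>g2\<close> at one instant, coupled through the field
\<open>E\<close>, the gradient of the potential.\<close>

locale electrostatics =
  fixes L \<epsilon> :: real and c1 c2 :: "real ^ 3 \<Rightarrow> real" and g1 g2 E :: "real ^ 3 \<Rightarrow> real ^ 3"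
  assumes L: "L > 0" and \<epsilon>: "\<epsilon> > 0"
    and c1: "C1 L c1 g1" and c2: "C1 L c2 g2"
    and c1_cont: "continuous_on (closed_slab L) c1" and c2_cont: "continuous_on (closed_slab L) c2"
    and E: "has_div L E (\<lambda>p. - (c1 p - c2 p) / \<epsilon>)"
begin

text \<open>The basic identity behind all comparison arguments. The drift terms are
\<open>E \<bullet> (c1 a'(c1) \<nabla>c1 - c2 a'(c2) \<nabla>c2) = E \<bullet> \<nabla>(Q(c1) - Q(c2))\<close>, and integration by parts
exchanges the field for its divergence, the charge density. For increasing \<open>Q\<close> the last integral is
nonnegative: the drift then helps the comparison.\<close>

lemma flux_pairing:
  assumes a: "\<And>s. (a has_real_derivative a' s) (at s)" "continuous_on UNIV a'"
    and Q: "\<And>s. (Q has_real_derivative s * a' s) (at s)"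
    and bdry: "\<And>p. p $ 1 = 0 \<or> p $ 1 = L \<Longrightarrow> Q (c1 p) = 0 \<and> Q (c2 p) = 0"
  shows "cell_integral L (\<lambda>p. (g1 p + c1 p *\<^sub>R E p) \<bullet> (a' (c1 p) *\<^sub>R g1 p)) +
      cell_integral L (\<lambda>p. (g2 p - c2 p *\<^sub>R E p) \<bullet> (a' (c2 p) *\<^sub>R g2 p)) =
    cell_integral L (\<lambda>p. a' (c1 p) * (g1 p \<bullet> g1 p)) + cell_integral L (\<lambda>p. a' (c2 p) * (g2 p \<bullet> g2 p)) +
      cell_integral L (\<lambda>p. (Q (c1 p) - Q (c2 p)) * (c1 p - c2 p)) / \<epsilon>"
proof -
  have cQ': "continuous_on UNIV (\<lambda>s. s * a' s)" by (intro continuous_intros a)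
  have cQ: "continuous_on UNIV Q"
    using DERIV_isCont[OF Q] by (intro continuous_at_imp_continuous_on) auto
  let ?\<psi> = "\<lambda>p. Q (c1 p) - Q (c2 p)"
  let ?\<psi>' = "\<lambda>p. (c1 p * a' (c1 p)) *\<^sub>R g1 p - (c2 p * a' (c2 p)) *\<^sub>R g2 p"
  have \<psi>: "C1 L ?\<psi> ?\<psi>'" by (intro C1_diff C1_compose c1 c2 Q cQ')
  have v: "vanishing L ?\<psi>"
    by (intro vanishing_diff vanishing_compose c1_cont c2_cont cQ) (use bdry in auto)
  note bc = bcont_intros C1_bcont[OF c1] C1_bcont[OF c2] C1_bcont_grad[OF c1] C1_bcont_grad[OF c2]
    bcont_compose_UNIV[OF C1_bcont[OF c1] a(2)] bcont_compose_UNIV[OF C1_bcont[OF c2] a(2)] has_div_bcont[OF E]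
  have ibp: "cell_integral L (\<lambda>p. E p \<bullet> ?\<psi>' p) = cell_integral L (\<lambda>p. ?\<psi> p * (c1 p - c2 p)) / \<epsilon>"
  proof -
    have "cell_integral L (\<lambda>p. E p \<bullet> ?\<psi>' p) = - cell_integral L (\<lambda>p. ?\<psi> p * (- (c1 p - c2 p) / \<epsilon>))"
      using integration_by_parts[OF L E \<psi> v] by simp
    also have "\<dots> = cell_integral L (\<lambda>p. (1 / \<epsilon>) * (?\<psi> p * (c1 p - c2 p)))"
    proof -
      have "- (x * (- d / \<epsilon>)) = (1 / \<epsilon>) * (x * d)" for x d :: real by simp
      then show ?thesis unfolding ci_minus[symmetric] by (intro ci_cong)
    qed
    finally show ?thesis by (simp only: ci_cmult) simp
  qed
  have "cell_integral L (\<lambda>p. (g1 p + c1 p *\<^sub>R E p) \<bullet> (a' (c1 p) *\<^sub>R g1 p)) +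
      cell_integral L (\<lambda>p. (g2 p - c2 p *\<^sub>R E p) \<bullet> (a' (c2 p) *\<^sub>R g2 p)) =
    cell_integral L (\<lambda>p. (g1 p + c1 p *\<^sub>R E p) \<bullet> (a' (c1 p) *\<^sub>R g1 p) + (g2 p - c2 p *\<^sub>R E p) \<bullet> (a' (c2 p) *\<^sub>R g2 p))"
    by (rule ci_add[symmetric]) (intro bc)+
  also have "\<dots> = cell_integral L (\<lambda>p. (a' (c1 p) * (g1 p \<bullet> g1 p) + a' (c2 p) * (g2 p \<bullet> g2 p)) + E p \<bullet> ?\<psi>' p)"
    by (intro ci_cong) (simp add: inner_add_left inner_diff_left inner_diff_right algebra_simps)
  also have "\<dots> = cell_integral L (\<lambda>p. a' (c1 p) * (g1 p \<bullet> g1 p) + a' (c2 p) * (g2 p \<bullet> g2 p)) + cell_integral L (\<lambda>p. E p \<bullet> ?\<psi>' p)"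
    by (rule ci_add) (intro bc)+
  also have "cell_integral L (\<lambda>p. a' (c1 p) * (g1 p \<bullet> g1 p) + a' (c2 p) * (g2 p \<bullet> g2 p)) =
    cell_integral L (\<lambda>p. a' (c1 p) * (g1 p \<bullet> g1 p)) + cell_integral L (\<lambda>p. a' (c2 p) * (g2 p \<bullet> g2 p))"
    by (rule ci_add) (intro bc)+
  finally show ?thesis by (simp only: ibp)
qed

end

text \<open>For \<open>lo \<le> hi\<close>, the squared distance of \<open>s\<close> to \<open>[lo, hi]\<close>. The two functions after it are, up to
the factor 3, antiderivatives of \<open>excess2\<close> and of \<open>s * excess2\<close> that vanish on the interval.\<close>

definition excess2 :: "real \<Rightarrow> real \<Rightarrow> real \<Rightarrow> real" where
  "excess2 lo hi s = (max (s - hi) 0)\<^sup>2 + (max (lo - s) 0)\<^sup>2"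

definition excess3 :: "real \<Rightarrow> real \<Rightarrow> real \<Rightarrow> real" where
  "excess3 lo hi s = max (s - hi) 0 ^ 3 - max (lo - s) 0 ^ 3"

definition excess_flux :: "real \<Rightarrow> real \<Rightarrow> real \<Rightarrow> real" where
  "excess_flux lo hi s = 3 / 4 * max (s - hi) 0 ^ 4 + hi * max (s - hi) 0 ^ 3
     + 3 / 4 * max (lo - s) 0 ^ 4 - lo * max (lo - s) 0 ^ 3"

lemma DERIV_upper: "((\<lambda>s. max (s - b) 0 ^ Suc (Suc n)) has_real_derivative real (Suc (Suc n)) * max (s - b) 0 ^ Suc n) (at s)"
  for b :: real
  by (rule DERIV_cong[OF DERIV_chain2[OF DERIV_pos_part_power[of n]]]) (auto intro!: derivative_eq_intros)

lemma DERIV_lower: "((\<lambda>s. max (b - s) 0 ^ Suc (Suc n)) has_real_derivative - real (Suc (Suc n)) * max (b - s) 0 ^ Suc n) (at s)"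
  for b :: real
  by (rule DERIV_cong[OF DERIV_chain2[OF DERIV_pos_part_power[of n]]]) (auto intro!: derivative_eq_intros)

lemma DERIV_parts:
  "((\<lambda>s. (max (s - b) 0)\<^sup>2) has_real_derivative 2 * max (s - b) 0) (at s)"
  "((\<lambda>s. max (s - b) 0 ^ 3) has_real_derivative 3 * (max (s - b) 0)\<^sup>2) (at s)"
  "((\<lambda>s. max (s - b) 0 ^ 4) has_real_derivative 4 * max (s - b) 0 ^ 3) (at s)"
  "((\<lambda>s. (max (b - s) 0)\<^sup>2) has_real_derivative - 2 * max (b - s) 0) (at s)"
  "((\<lambda>s. max (b - s) 0 ^ 3) has_real_derivative - 3 * (max (b - s) 0)\<^sup>2) (at s)"
  "((\<lambda>s. max (b - s) 0 ^ 4) has_real_derivative - 4 * max (b - s) 0 ^ 3) (at s)"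
  for b :: real
  using DERIV_upper[of b 0 s] DERIV_upper[of b 1 s] DERIV_upper[of b 2 s]
    DERIV_lower[of b 0 s] DERIV_lower[of b 1 s] DERIV_lower[of b 2 s]
  by (simp_all add: eval_nat_numeral)

lemma DERIV_excess2:
  "(excess2 lo hi has_real_derivative 2 * (max (s - hi) 0 - max (lo - s) 0)) (at s)"
  unfolding excess2_def[abs_def]
  by (rule DERIV_cong[OF DERIV_add[OF DERIV_parts(1) DERIV_parts(4)]]) simp

lemma DERIV_excess3: "(excess3 lo hi has_real_derivative 3 * excess2 lo hi s) (at s)"
  unfolding excess3_def[abs_def] excess2_def
  by (rule DERIV_cong[OF DERIV_diff[OF DERIV_parts(2) DERIV_parts(5)]]) simp

lemma excess2_squared:
  "lo \<le> hi \<Longrightarrow> (excess2 lo hi s)\<^sup>2 = max (s - hi) 0 ^ 4 + max (lo - s) 0 ^ 4"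
  unfolding excess2_def by (auto simp: max_def power2_eq_square eval_nat_numeral)

lemma DERIV_excess4:
  assumes "lo \<le> hi"
  shows "((\<lambda>s. (excess2 lo hi s)\<^sup>2) has_real_derivative 4 * excess3 lo hi s) (at s)"
  unfolding excess2_squared[OF assms] excess3_def
  by (rule DERIV_cong[OF DERIV_add[OF DERIV_parts(3) DERIV_parts(6)]]) simp

lemma DERIV_excess_flux:
  "(excess_flux lo hi has_real_derivative s * (3 * excess2 lo hi s)) (at s)"
proof -
  let ?w = "max (s - hi) 0" and ?h = "max (lo - s) 0"
  have "(excess_flux lo hi has_real_derivative
     3 / 4 * (4 * ?w ^ 3) + hi * (3 * ?w\<^sup>2) + 3 / 4 * (- 4 * ?h ^ 3) - lo * (- 3 * ?h\<^sup>2)) (at s)"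
    unfolding excess_flux_def[abs_def]
    by (intro DERIV_add DERIV_diff DERIV_cmult DERIV_parts)
  moreover have "3 / 4 * (4 * ?w ^ 3) + hi * (3 * ?w\<^sup>2) + 3 / 4 * (- 4 * ?h ^ 3) - lo * (- 3 * ?h\<^sup>2) = s * (3 * excess2 lo hi s)"
    by (auto simp: excess2_def max_def power2_eq_square power3_eq_cube algebra_simps)
  ultimately show ?thesis by simp
qed

lemma excess2_nonneg: "0 \<le> excess2 lo hi s"
  by (simp add: excess2_def)

lemma excess_flux_mono: "0 \<le> s \<Longrightarrow> s \<le> t \<Longrightarrow> excess_flux lo hi s \<le> excess_flux lo hi t"
  by (rule DERIV_nonneg_imp_nondecreasing[of s t "excess_flux lo hi"])
    (auto intro!: exI DERIV_excess_flux mult_nonneg_nonneg excess2_nonneg)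

lemma excess_inside:
  assumes "lo \<le> s" "s \<le> hi"
  shows "excess2 lo hi s = 0" "excess3 lo hi s = 0" "excess_flux lo hi s = 0"
  using assms by (simp_all add: excess2_def excess3_def excess_flux_def max_def)

lemma excess2_eq_0: "excess2 lo hi s = 0 \<Longrightarrow> lo \<le> s \<and> s \<le> hi"
  by (auto simp: excess2_def max_def add_nonneg_eq_0_iff split: if_splits)

lemma excess2_continuous: "continuous_on S (excess2 lo hi)"
  using DERIV_isCont[OF DERIV_excess2] by (intro continuous_at_imp_continuous_on) auto

lemma bcont_excess2: "bcont L f \<Longrightarrow> bcont L (\<lambda>p. excess2 lo hi (f p))"
  by (rule bcont_compose_UNIV[OF _ excess2_continuous])

text \<open>The function \<open>excess2 lo hi \<circ> c\<close> vanishes on the walls, and its gradient has square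
\<open>4 * excess2 * |\<nabla>c|\<^sup>2\<close>.\<close>

lemma excess_poincare:
  assumes L: "L > 0" and c: "C1 L c g" "continuous_on (closed_slab L) c" and lo: "lo \<le> hi"
    and bdry: "\<And>p. p $ 1 = 0 \<or> p $ 1 = L \<Longrightarrow> lo \<le> c p \<and> c p \<le> hi"
  shows "cell_integral L (\<lambda>p. (excess2 lo hi (c p))\<^sup>2) \<le> L\<^sup>2 * cell_integral L (\<lambda>p. excess2 lo hi (c p) * (g p \<bullet> g p))"
proof -
  let ?d = "\<lambda>s. 2 * (max (s - hi) 0 - max (lo - s) 0)"
  have f: "C1 L (\<lambda>p. excess2 lo hi (c p)) (\<lambda>p. ?d (c p) *\<^sub>R g p)"
    by (intro C1_compose c DERIV_excess2 continuous_intros)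
  have v: "vanishing L (\<lambda>p. excess2 lo hi (c p))"
    by (rule vanishing_compose[OF c(2) excess2_continuous]) (use bdry excess_inside in auto)
  have bc: "bcont L (\<lambda>p. ((?d (c p) *\<^sub>R g p) $ 1)\<^sup>2)"
    by (intro bcont_power bcont_component C1_bcont_grad[OF f])
  have bc2: "bcont L (\<lambda>p. 4 * (excess2 lo hi (c p) * (g p \<bullet> g p)))"
    by (intro bcont_intros bcont_excess2 C1_bcont[OF c(1)] C1_bcont_grad[OF c(1)])
  have "cell_integral L (\<lambda>p. (excess2 lo hi (c p))\<^sup>2) \<le> L\<^sup>2 / 4 * cell_integral L (\<lambda>p. ((?d (c p) *\<^sub>R g p) $ 1)\<^sup>2)"
    by (rule poincare[OF L f v])
  also have "cell_integral L (\<lambda>p. ((?d (c p) *\<^sub>R g p) $ 1)\<^sup>2) \<le> cell_integral L (\<lambda>p. 4 * (excess2 lo hi (c p) * (g p \<bullet> g p)))"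
  proof (rule ci_mono[OF bc bc2])
    fix p
    have "(?d (c p))\<^sup>2 = 4 * excess2 lo hi (c p)"
      using lo by (auto simp: excess2_def max_def power2_eq_square algebra_simps)
    moreover have "(g p $ 1)\<^sup>2 \<le> g p \<bullet> g p"
      by (simp add: inner_vec_def sum_3 power2_eq_square)
    ultimately show "((?d (c p) *\<^sub>R g p) $ 1)\<^sup>2 \<le> 4 * (excess2 lo hi (c p) * (g p \<bullet> g p))"
      by (simp add: power_mult_distrib mult_left_mono excess2_nonneg)
  qed
  finally show ?thesis
    using L by (simp add: ci_cmult mult_left_mono)
qed

context electrostatics begin

lemma excess_dissipation:
  assumes lo: "0 \<le> lo" "lo \<le> hi"
    and bdry: "\<And>p. p $ 1 = 0 \<or> p $ 1 = L \<Longrightarrow> lo \<le> c1 p \<and> c1 p \<le> hi \<and> lo \<le> c2 p \<and> c2 p \<le> hi"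
    and nonneg: "\<And>p. p \<in> cell L \<Longrightarrow> 0 \<le> c1 p \<and> 0 \<le> c2 p"
  shows "3 * (cell_integral L (\<lambda>p. excess2 lo hi (c1 p) * (g1 p \<bullet> g1 p)) + cell_integral L (\<lambda>p. excess2 lo hi (c2 p) * (g2 p \<bullet> g2 p)))
    \<le> cell_integral L (\<lambda>p. (g1 p + c1 p *\<^sub>R E p) \<bullet> ((3 * excess2 lo hi (c1 p)) *\<^sub>R g1 p)) +
      cell_integral L (\<lambda>p. (g2 p - c2 p *\<^sub>R E p) \<bullet> ((3 * excess2 lo hi (c2 p)) *\<^sub>R g2 p))"
proof -
  have "0 \<le> cell_integral L (\<lambda>p. (excess_flux lo hi (c1 p) - excess_flux lo hi (c2 p)) * (c1 p - c2 p))"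
  proof (rule ci_nonneg)
    fix p assume "p \<in> cell L"
    from nonneg[OF this] show "0 \<le> (excess_flux lo hi (c1 p) - excess_flux lo hi (c2 p)) * (c1 p - c2 p)"
      using excess_flux_mono[of "c1 p" "c2 p" lo hi] excess_flux_mono[of "c2 p" "c1 p" lo hi]
      by (cases "c1 p \<le> c2 p") (auto intro: mult_nonneg_nonneg mult_nonpos_nonpos)
  qed
  with \<epsilon> show ?thesis
    by (subst flux_pairing[where a = "excess3 lo hi" and Q = "excess_flux lo hi", OF DERIV_excess3 _ DERIV_excess_flux])
      (use bdry excess_inside(3) in \<open>auto simp: mult.assoc ci_cmult distrib_left intro!: continuous_intros excess2_continuous\<close>)
qed

end

section \<open>The steady state stays between its boundary values\<close>

lemma Ck_on_real_DERIV:
  fixes f :: "real \<Rightarrow> real"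
  assumes "Ck_on (Suc k) {a<..<b} f" "x \<in> {a<..<b}"
  shows "(f has_real_derivative deriv f x) (at x)" and "Ck_on k {a<..<b} (deriv f)"
proof -
  obtain f' where f': "\<And>x. x \<in> {a<..<b} \<Longrightarrow> (f has_derivative f' x) (at x within {a<..<b})"
    and C: "Ck_on k {a<..<b} (\<lambda>x. f' x 1)"
    using assms(1) unfolding Ck_on.simps(2) Basis_real_def by blast
  have D: "(f has_real_derivative f' x 1) (at x)" if x: "x \<in> {a<..<b}" for x
  proof -
    have d: "(f has_derivative f' x) (at x)"
      using f'[OF x] x by (simp add: at_within_open[of _ "{a<..<b}"])
    then have "linear (f' x)" by (rule has_derivative_linear)
    from linear_cmul[OF this, of _ 1] have "f' x v = v * f' x 1" for v
      unfolding real_scaleR_def mult_1_right .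
    then have "f' x v = f' x 1 * v" for v
      by (rule trans[OF _ mult.commute])
    then have "f' x = (*) (f' x 1)" by (rule ext)
    with d show ?thesis unfolding has_field_derivative_def by (simp only:)
  qed
  then have eq: "deriv f x = f' x 1" if "x \<in> {a<..<b}" for x
    using that DERIV_imp_deriv by blast
  show "(f has_real_derivative deriv f x) (at x)"
    using D assms(2) eq by simp
  show "Ck_on k {a<..<b} (deriv f)"
  proof (cases k)
    case 0
    then show ?thesis
      using C continuous_on_cong[of "{a<..<b}" _ "deriv f" "\<lambda>x. f' x 1", OF refl eq] by simp
  next
    case (Suc j)
    obtain g' where g': "\<And>x. x \<in> {a<..<b} \<Longrightarrow> ((\<lambda>x. f' x 1) has_derivative g' x) (at x within {a<..<b})"
      "Ck_on j {a<..<b} (\<lambda>x. g' x 1)"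
      using C unfolding Suc Ck_on.simps(2) Basis_real_def by blast
    have "(deriv f has_derivative g' x) (at x within {a<..<b})" if "x \<in> {a<..<b}" for x
      using has_derivative_transform[OF that _ g'(1)[OF that], of "deriv f"] eq by auto
    then show ?thesis using g'(2) Suc by (auto intro!: exI[of _ g'])
  qed
qed

text \<open>A function whose derivative does not change sign lies above one of its end values. Applied to the Slotboom variables \<open>c\<^sup>* exp (\<plusminus> \<Phi>\<^sup>*)\<close>, whose derivative is the constant current times a positive factor.\<close>

lemma positive_between:
  fixes f :: "real \<Rightarrow> real"
  assumes x: "x \<in> {0..L}" and cont: "continuous_on {0..L} f"
    and D: "\<And>x. x \<in> {0<..<L} \<Longrightarrow> (f has_real_derivative j * e x) (at x)"
    and e: "\<And>x. x \<in> {0<..<L} \<Longrightarrow> 0 \<le> e x" and f: "0 < f 0" "0 < f L"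
  shows "0 < f x"
proof (cases "j \<ge> 0")
  case True
  have "f 0 \<le> f x"
  proof (rule DERIV_nonneg_imp_increasing_open[of 0 x f])
    show "\<exists>y. DERIV f z :> y \<and> 0 \<le> y" if "0 < z" "z < x" for z
      using D[of z] e[of z] that x True by (intro exI[of _ "j * e z"]) auto
    show "continuous_on {0..x} f" by (rule continuous_on_subset[OF cont]) (use x in auto)
  qed (use x in auto)
  with f show ?thesis by simp
next
  case False
  have "f L \<le> f x"
  proof (rule DERIV_nonpos_imp_decreasing_open[of x L f])
    show "\<exists>y. DERIV f z :> y \<and> y \<le> 0" if "x < z" "z < L" for z
      using D[of z] e[of z] that x False by (intro exI[of _ "j * e z"]) (auto simp: mult_le_0_iff)
    show "continuous_on {x..L} f" by (rule continuous_on_subset[OF cont]) (use x in auto)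
  qed (use x in auto)
  with f show ?thesis by simp
qed

lemma bounded_if_continuous: "continuous_on {0..L} f \<Longrightarrow> bounded (f ` {0<..<L})" for f :: "real \<Rightarrow> real"
  by (rule bounded_subset[of "f ` {0..L}"]) (auto intro: compact_imp_bounded compact_continuous_image)

lemma bounded_mult_fun: "bounded (f ` S) \<Longrightarrow> bounded (g ` S) \<Longrightarrow> bounded ((\<lambda>x. f x * g x :: real) ` S)"
  for S :: "real set"
proof -
  assume "bounded (f ` S)" "bounded (g ` S)"
  then obtain B C where "\<And>x. x \<in> S \<Longrightarrow> norm (f x) \<le> B" "\<And>x. x \<in> S \<Longrightarrow> norm (g x) \<le> C"
    unfolding bounded_iff by (metis (no_types, lifting) image_eqI)
  then have "norm (f x * g x) \<le> B * C" if "x \<in> S" for x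
    using that mult_mono[of "norm (f x)" B "norm (g x)" C] order_trans[OF norm_ge_zero, of "f x" B]
    by (simp add: abs_mult)
  then show ?thesis by (auto intro!: boundedI)
qed

lemma continuous_on_x: "continuous_on {0..L} f \<Longrightarrow> continuous_on (closed_slab L) (\<lambda>p. f (p $ 1))"
  for f :: "real \<Rightarrow> real"
  by (rule continuous_on_compose2[of "{0..L}" f]) (auto intro!: continuous_intros simp: closed_slab_def)

abbreviation e1 :: "real ^ 3" where
  "e1 \<equiv> axis 1 1"

lemma cell_integral_normal_derivative_zero:
  assumes L: "L > 0" and "C1 L f f'" "vanishing L f"
  shows "cell_integral L (\<lambda>p. e1 \<bullet> f' p) = 0"
proof -
  have "has_div L (\<lambda>p. e1) (\<lambda>p. 0)"
    using has_div_normal[OF C1_const[of L 1]] by simp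
  from integration_by_parts[OF L this assms(2,3)] show ?thesis
    by (simp add: cell_integral_def set_lebesgue_integral_def)
qed

text \<open>The field \<open>E\<close> is \<open>\<partial>\<^sub>x \<Phi>\<^sup>*\<close>. Derivatives are known in the open interval only; that \<open>E\<close>, and then the
derivatives of the concentrations, stay bounded up to the ends follows from the Poisson equation.\<close>

locale steady_fields =
  fixes L \<epsilon> lo hi j1 j2 :: real and cs1 cs2 \<Phi>s E :: "real \<Rightarrow> real"
  assumes L: "L > 0" and \<epsilon>: "\<epsilon> > 0" and lo: "lo > 0"
    and cs1_cont: "continuous_on {0..L} cs1" and cs2_cont: "continuous_on {0..L} cs2"
    and \<Phi>s_cont: "continuous_on {0..L} \<Phi>s"
    and cs1_deriv: "\<And>x. x \<in> {0<..<L} \<Longrightarrow> (cs1 has_real_derivative j1 - cs1 x * E x) (at x)"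
    and cs2_deriv: "\<And>x. x \<in> {0<..<L} \<Longrightarrow> (cs2 has_real_derivative j2 + cs2 x * E x) (at x)"
    and \<Phi>s_deriv: "\<And>x. x \<in> {0<..<L} \<Longrightarrow> (\<Phi>s has_real_derivative E x) (at x)"
    and E_deriv: "\<And>x. x \<in> {0<..<L} \<Longrightarrow> (E has_real_derivative - (cs1 x - cs2 x) / \<epsilon>) (at x)"
    and ends: "cs1 0 \<in> {lo..hi}" "cs1 L \<in> {lo..hi}" "cs2 0 \<in> {lo..hi}" "cs2 L \<in> {lo..hi}"
begin

lemma lo_le_hi: "lo \<le> hi"
  using ends by simp

lemma steady_positive: "x \<in> {0..L} \<Longrightarrow> 0 < cs1 x \<and> 0 < cs2 x"
proof
  assume x: "x \<in> {0..L}"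
  have "0 < cs1 x * exp (\<Phi>s x)"
    by (rule positive_between[OF x, where j = j1 and e = "\<lambda>x. exp (\<Phi>s x)"])
      (use ends lo in \<open>auto intro!: continuous_intros cs1_cont \<Phi>s_cont derivative_eq_intros cs1_deriv \<Phi>s_deriv simp: algebra_simps\<close>)
  then show "0 < cs1 x" by (simp add: zero_less_mult_iff)
  have "0 < cs2 x * exp (- \<Phi>s x)"
    by (rule positive_between[OF x, where j = j2 and e = "\<lambda>x. exp (- \<Phi>s x)"])
      (use ends lo in \<open>auto intro!: continuous_intros cs2_cont \<Phi>s_cont derivative_eq_intros cs2_deriv \<Phi>s_deriv simp: algebra_simps\<close>)
  then show "0 < cs2 x" by (simp add: zero_less_mult_iff)
qed

lemma E_cont: "continuous_on {0<..<L} E"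
  using DERIV_isCont[OF E_deriv] by (intro continuous_at_imp_continuous_on) auto

lemma E_bounded: "bounded (E ` {0<..<L})"
proof -
  have "bounded ((\<lambda>x. - (cs1 x - cs2 x) / \<epsilon>) ` {0<..<L})"
    by (intro bounded_if_continuous continuous_intros cs1_cont cs2_cont) (use \<epsilon> in auto)
  then obtain B where B: "\<And>x. x \<in> {0<..<L} \<Longrightarrow> norm (- (cs1 x - cs2 x) / \<epsilon>) \<le> B"
    unfolding bounded_iff by (metis (no_types, lifting) image_eqI)
  have "norm (E x - E (L / 2)) \<le> B * L" if x: "x \<in> {0<..<L}" for x
  proof -
    have "norm (E x - E (L / 2)) \<le> B * norm (x - L / 2)"
    proof (rule field_differentiable_bound)
      show "(E has_real_derivative - (cs1 z - cs2 z) / \<epsilon>) (at z within {0<..<L})" if "z \<in> {0<..<L}" for z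
        by (rule has_field_derivative_at_within[OF E_deriv[OF that]])
    qed (use x L B in auto)
    also have "\<dots> \<le> B * L"
      using x L order_trans[OF norm_ge_zero B[OF x]] by (intro mult_left_mono) auto
    finally show ?thesis .
  qed
  then have "norm (E x) \<le> B * L + norm (E (L / 2))" if "x \<in> {0<..<L}" for x
    using that norm_triangle_sub[of "E x" "E (L / 2)"] by (smt (verit))
  then show ?thesis by (intro boundedI[of _ "B * L + norm (E (L / 2))"]) auto
qed

lemma cs1_C1: "C1 L (\<lambda>p. cs1 (p $ 1)) (\<lambda>p. (j1 - cs1 (p $ 1) * E (p $ 1)) *\<^sub>R e1)"
proof (rule C1_of_x)
  show "continuous_on {0<..<L} (\<lambda>x. j1 - cs1 x * E x)"
    by (intro continuous_intros E_cont continuous_on_subset[OF cs1_cont]) auto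
  show "bounded ((\<lambda>x. j1 - cs1 x * E x) ` {0<..<L})"
    by (intro bounded_minus_comp bounded_mult_fun E_bounded bounded_if_continuous[OF cs1_cont] bounded_if_continuous continuous_on_const)
qed (use cs1_deriv bounded_if_continuous[OF cs1_cont] in auto)

lemma cs2_C1: "C1 L (\<lambda>p. cs2 (p $ 1)) (\<lambda>p. (j2 + cs2 (p $ 1) * E (p $ 1)) *\<^sub>R e1)"
proof (rule C1_of_x)
  show "continuous_on {0<..<L} (\<lambda>x. j2 + cs2 x * E x)"
    by (intro continuous_intros E_cont continuous_on_subset[OF cs2_cont]) auto
  show "bounded ((\<lambda>x. j2 + cs2 x * E x) ` {0<..<L})"
    by (intro bounded_plus_comp bounded_mult_fun E_bounded bounded_if_continuous[OF cs2_cont] bounded_if_continuous continuous_on_const)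
qed (use cs2_deriv bounded_if_continuous[OF cs2_cont] in auto)

lemma \<Phi>s_C1: "C1 L (\<lambda>p. \<Phi>s (p $ 1)) (\<lambda>p. E (p $ 1) *\<^sub>R e1)"
  by (rule C1_of_x) (use \<Phi>s_deriv in \<open>auto intro!: E_cont bounded_if_continuous \<Phi>s_cont E_bounded\<close>)

lemma E_C1: "C1 L (\<lambda>p. E (p $ 1)) (\<lambda>p. (- (cs1 (p $ 1) - cs2 (p $ 1)) / \<epsilon>) *\<^sub>R e1)"
  by (rule C1_of_x[where f' = "\<lambda>x. - (cs1 x - cs2 x) / \<epsilon>"])
    (use E_deriv \<epsilon> in \<open>auto intro!: E_bounded continuous_intros bounded_if_continuous
      continuous_on_subset[OF cs1_cont] continuous_on_subset[OF cs2_cont]\<close>)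

lemma E_has_div: "has_div L (\<lambda>p. E (p $ 1) *\<^sub>R e1) (\<lambda>p. - (cs1 (p $ 1) - cs2 (p $ 1)) / \<epsilon>)"
  using has_div_normal[OF E_C1] by simp

sublocale electrostatics L \<epsilon> "\<lambda>p. cs1 (p $ 1)" "\<lambda>p. cs2 (p $ 1)"
  "\<lambda>p. (j1 - cs1 (p $ 1) * E (p $ 1)) *\<^sub>R e1" "\<lambda>p. (j2 + cs2 (p $ 1) * E (p $ 1)) *\<^sub>R e1" "\<lambda>p. E (p $ 1) *\<^sub>R e1"
  by unfold_locales (intro L \<epsilon> cs1_C1 cs2_C1 continuous_on_x cs1_cont cs2_cont E_has_div)+

text \<open>The fluxes are constant and the test functions vanish at the ends, so the pairing of \<open>excess_dissipation\<close> is zero.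
Hence the excess over \<open>[lo, hi]\<close> is zero by the Poincare inequality.\<close>

theorem steady_bounds:
  assumes "x \<in> {0..L}"
  shows "cs1 x \<in> {lo..hi}" "cs2 x \<in> {lo..hi}"
proof -
  let ?r = "excess2 lo hi"
  let ?G1 = "\<lambda>p. (j1 - cs1 (p $ 1) * E (p $ 1)) *\<^sub>R e1" and ?G2 = "\<lambda>p. (j2 + cs2 (p $ 1) * E (p $ 1)) *\<^sub>R e1"
  have pos: "\<And>p. p \<in> cell L \<Longrightarrow> 0 \<le> cs1 (p $ 1) \<and> 0 \<le> cs2 (p $ 1)"
    using steady_positive by (auto simp: cell_def less_imp_le)
  have bdry: "lo \<le> cs1 (p $ 1) \<and> cs1 (p $ 1) \<le> hi \<and> lo \<le> cs2 (p $ 1) \<and> cs2 (p $ 1) \<le> hi"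
    if "p $ 1 = 0 \<or> p $ 1 = L" for p :: "real ^ 3"
    using that ends by auto
  have zero: "cell_integral L (\<lambda>p. (j *\<^sub>R e1) \<bullet> ((3 * ?r (c (p $ 1))) *\<^sub>R g p)) = 0"
    if c: "C1 L (\<lambda>p. c (p $ 1)) g" "continuous_on {0..L} c" "c 0 \<in> {lo..hi}" "c L \<in> {lo..hi}" for j c g
  proof -
    have "cell_integral L (\<lambda>p. e1 \<bullet> ((3 * ?r (c (p $ 1))) *\<^sub>R g p)) = 0"
    proof (rule cell_integral_normal_derivative_zero[OF L])
      show "C1 L (\<lambda>p. excess3 lo hi (c (p $ 1))) (\<lambda>p. (3 * ?r (c (p $ 1))) *\<^sub>R g p)"
        by (intro C1_compose c DERIV_excess3 continuous_intros excess2_continuous)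
      have "continuous_on UNIV (excess3 lo hi)"
        using DERIV_isCont[OF DERIV_excess3] by (intro continuous_at_imp_continuous_on) auto
      then show "vanishing L (\<lambda>p. excess3 lo hi (c (p $ 1)))"
        by (rule vanishing_compose[OF continuous_on_x[OF c(2)]]) (use c excess_inside in auto)
    qed
    then have "cell_integral L (\<lambda>p. j * (e1 \<bullet> ((3 * ?r (c (p $ 1))) *\<^sub>R g p))) = 0"
      by (simp only: ci_cmult)
    then show ?thesis by (simp add: ac_simps)
  qed
  have f1: "(\<lambda>p. ?G1 p + cs1 (p $ 1) *\<^sub>R (E (p $ 1) *\<^sub>R e1)) = (\<lambda>p. j1 *\<^sub>R e1)"
    and f2: "(\<lambda>p. ?G2 p - cs2 (p $ 1) *\<^sub>R (E (p $ 1) *\<^sub>R e1)) = (\<lambda>p. j2 *\<^sub>R e1)"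
    by (auto simp: algebra_simps)
  let ?S1 = "cell_integral L (\<lambda>p. ?r (cs1 (p $ 1)) * (?G1 p \<bullet> ?G1 p))"
    and ?S2 = "cell_integral L (\<lambda>p. ?r (cs2 (p $ 1)) * (?G2 p \<bullet> ?G2 p))"
  have "3 * (?S1 + ?S2) \<le> 0"
    using excess_dissipation[of lo hi, OF less_imp_le[OF lo] lo_le_hi bdry pos]
      zero[OF cs1_C1 cs1_cont ends(1,2), of j1] zero[OF cs2_C1 cs2_cont ends(3,4), of j2]
    by (simp only: fun_cong[OF f1] fun_cong[OF f2] add_0)
  moreover have "0 \<le> ?S1" "0 \<le> ?S2"
    by (intro ci_nonneg mult_nonneg_nonneg excess2_nonneg inner_ge_zero)+
  moreover have "x = 0 \<and> y = 0" if "3 * (x + y) \<le> 0" "0 \<le> x" "0 \<le> y" for x y :: real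
    using that by simp
  ultimately have S: "?S1 = 0" "?S2 = 0" by blast+
  have z: "c x \<in> {lo..hi}" if c: "C1 L (\<lambda>p. c (p $ 1)) g" "continuous_on {0..L} c" "c 0 \<in> {lo..hi}" "c L \<in> {lo..hi}"
      and S: "cell_integral L (\<lambda>p. ?r (c (p $ 1)) * (g p \<bullet> g p)) = 0" for c g
  proof (cases "x = 0 \<or> x = L")
    case False
    let ?p = "\<chi> i. if i = 1 then x else 0 :: real ^ 3"
    have p: "?p \<in> cell L" using False assms by (auto simp: cell_def)
    have "cell_integral L (\<lambda>p. (?r (c (p $ 1)))\<^sup>2) \<le> L\<^sup>2 * 0"
      unfolding S[symmetric]
      by (rule excess_poincare[OF L c(1) continuous_on_x[OF c(2)] lo_le_hi]) (use c in auto)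
    then have "(?r (c (?p $ 1)))\<^sup>2 = 0"
      by (intro ci_zero_imp_zero[OF _ _ _ p] bcont_power bcont_excess2 C1_bcont[OF c(1)]) auto
    then have "?r (c x) = 0" by simp
    then show ?thesis using excess2_eq_0 by simp
  qed (use c in auto)
  show "cs1 x \<in> {lo..hi}" by (rule z[OF cs1_C1 cs1_cont ends(1,2) S(1)])
  show "cs2 x \<in> {lo..hi}" by (rule z[OF cs2_C1 cs2_cont ends(3,4) S(2)])
qed

end

lemma steady_current_fields:
  assumes L: "L > 0" and \<epsilon>: "\<epsilon> > 0" and pos: "\<alpha>1 > 0" "\<alpha>2 > 0" "\<beta>1 > 0" "\<beta>2 > 0"
    and s: "steady_current L \<epsilon> \<alpha>1 \<alpha>2 \<beta>1 \<beta>2 V cs1 cs2 \<Phi>s"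
    and j1: "\<forall>x\<in>{0<..<L}. p_flux cs1 \<Phi>s x = j1"
    and j2: "\<forall>x\<in>{0<..<L}. n_flux cs2 \<Phi>s x = j2"
  shows "steady_fields L \<epsilon> (Min {\<alpha>1, \<alpha>2, \<beta>1, \<beta>2}) (Max {\<alpha>1, \<alpha>2, \<beta>1, \<beta>2}) j1 j2 cs1 cs2 \<Phi>s (deriv \<Phi>s)"
proof -
  have C: "Ck_on (Suc (Suc 0)) {0<..<L} f" "continuous_on {0..L} f" if "f \<in> {cs1, cs2, \<Phi>s}" for f
    using s that unfolding steady_current_def smooth_on_def by blast+
  have D: "(f has_real_derivative deriv f x) (at x)" if "f \<in> {cs1, cs2, \<Phi>s}" "x \<in> {0<..<L}" for f x
    using Ck_on_real_DERIV(1)[OF C(1)] that by blast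
  show ?thesis
  proof
    fix x assume x: "x \<in> {0<..<L}"
    show "(cs1 has_real_derivative j1 - cs1 x * deriv \<Phi>s x) (at x)"
    proof -
      have "deriv cs1 x = j1 - cs1 x * deriv \<Phi>s x" using bspec[OF j1 x] unfolding p_flux_def by linarith
      with D[of cs1 x] x show ?thesis by simp
    qed
    show "(cs2 has_real_derivative j2 + cs2 x * deriv \<Phi>s x) (at x)"
    proof -
      have "deriv cs2 x = j2 + cs2 x * deriv \<Phi>s x" using bspec[OF j2 x] unfolding n_flux_def by linarith
      with D[of cs2 x] x show ?thesis by simp
    qed
    show "(\<Phi>s has_real_derivative deriv \<Phi>s x) (at x)" using D x by simp
    have "(deriv \<Phi>s has_real_derivative deriv (deriv \<Phi>s) x) (at x)"
      using Ck_on_real_DERIV(1)[OF Ck_on_real_DERIV(2)[OF C(1)]] x by blast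
    moreover have "- \<epsilon> * deriv (deriv \<Phi>s) x = cs1 x - cs2 x"
      using s x by (auto simp: steady_current_def)
    then have "deriv (deriv \<Phi>s) x = - (cs1 x - cs2 x) / \<epsilon>"
      using \<epsilon> by (simp add: field_simps)
    ultimately show "(deriv \<Phi>s has_real_derivative - (cs1 x - cs2 x) / \<epsilon>) (at x)" by simp
  qed (use L \<epsilon> pos C(2) s in \<open>auto simp: steady_current_def\<close>)
qed

section \<open>Weak form of the transport equations\<close>

text \<open>The subtracted affine function of \<open>c\<close> provides for relative entropies, which are measured from
the tangent of a convex function at a fixed profile.\<close>

lemma density_derivative:
  fixes c :: "real \<Rightarrow> real ^ 3 \<Rightarrow> real"
  assumes c: "spacetime_smooth L c" and t: "t > 0" and \<eta>: "\<And>s. (\<eta> has_real_derivative a s) (at s)" and a: "continuous_on UNIV a"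
    and k: "bcont L k" and m: "bcont L m"
  shows "((\<lambda>t. cell_integral L (\<lambda>p. \<eta> (c t p) - k p * c t p - m p)) has_real_derivative
    cell_integral L (\<lambda>p. (a (c t p) - k p) * deriv (\<lambda>s. c s p) t)) (at t)"
proof -
  obtain B where B: "\<And>s p. s \<in> {t/2..2*t} \<Longrightarrow> p \<in> closed_cell L \<Longrightarrow> \<bar>c s p\<bar> \<le> B"
    using spacetime_locally_bounded[OF spacetime_smooth_continuous[OF c], of "t/2" "2*t"] t by (metis half_gt_zero)
  obtain B2 where B2: "\<And>s p. s \<in> {t/2..2*t} \<Longrightarrow> p \<in> closed_cell L \<Longrightarrow> \<bar>deriv (\<lambda>s. c s p) s\<bar> \<le> B2"
    using spacetime_smooth_time_derivative(3)[OF c, of "t/2" "2*t"] t by (metis half_gt_zero)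
  have "bounded (a ` {-B..B})"
    by (intro compact_imp_bounded compact_continuous_image continuous_on_subset[OF a]) auto
  then obtain B3 where B3: "\<And>s. s \<in> {-B..B} \<Longrightarrow> \<bar>a s\<bar> \<le> B3"
    unfolding bounded_iff real_norm_def by blast
  obtain B4 where B4: "\<And>p. p \<in> closed_cell L \<Longrightarrow> \<bar>k p\<bar> \<le> B4"
    using k unfolding bcont_def bounded_iff real_norm_def by blast
  have cont_\<eta>: "continuous_on UNIV \<eta>"
    using DERIV_isCont[OF \<eta>] by (intro continuous_at_imp_continuous_on) auto
  show ?thesis
  proof (rule cell_integral_has_derivative[where a = "t/2" and b = "2*t" and B = "(B3 + B4) * B2"])
    fix s p assume s: "t / 2 < s" "s < 2 * t" and p: "p \<in> cell L"
    then have s0: "s > 0" and p2: "p \<in> closed_cell L" and s2: "s \<in> {t/2..2*t}"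
      using t cell_subset_closed_cell by auto
    have D: "((\<lambda>s. c s p) has_real_derivative deriv (\<lambda>s. c s p) s) (at s)"
      by (rule spacetime_smooth_time_derivative(1)[OF c s0 cell_open_slab[OF p]])
    have "((\<lambda>s. \<eta> (c s p)) has_real_derivative a (c s p) * deriv (\<lambda>s. c s p) s) (at s)"
      by (rule DERIV_chain2[OF \<eta> D])
    from DERIV_diff[OF DERIV_diff[OF this DERIV_cmult[OF D, of "k p"]] DERIV_const[of "m p"]]
    show "((\<lambda>s. \<eta> (c s p) - k p * c s p - m p) has_real_derivative (a (c s p) - k p) * deriv (\<lambda>s. c s p) s) (at s)"
      by (simp add: algebra_simps)
    have "\<bar>a (c s p) - k p\<bar> \<le> B3 + B4"
      using B3[of "c s p"] B[OF s2 p2] B4[OF p2] by (auto simp: abs_le_iff)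
    then show "\<bar>(a (c s p) - k p) * deriv (\<lambda>s. c s p) s\<bar> \<le> (B3 + B4) * B2"
      using B2[OF s2 p2] by (auto simp: abs_mult intro!: mult_mono)
  next
    fix s assume "t / 2 < s" "s < 2 * t"
    with t have s0: "s > 0" by simp
    show "bcont L (\<lambda>p. \<eta> (c s p) - k p * c s p - m p)"
      by (intro bcont_intros bcont_compose_UNIV[OF _ cont_\<eta>] C1_bcont[OF spacetime_smooth_C1(1)[OF c s0]] k m)
  next
    show "bcont L (\<lambda>p. (a (c t p) - k p) * deriv (\<lambda>s. c s p) t)"
      by (intro bcont_intros bcont_compose_UNIV[OF _ a] C1_bcont[OF spacetime_smooth_C1(1)[OF c t]] k spacetime_smooth_time_derivative(2)[OF c t])
  qed (use t in auto)
qed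

text \<open>One species with valence sign \<open>\<sigma>\<close>. Both species of the system are instances, so each
energy identity is proved once.\<close>

locale ion_transport =
  fixes L Dc \<sigma> :: real and c :: "real \<Rightarrow> real ^ 3 \<Rightarrow> real" and u :: "real \<Rightarrow> real ^ 3 \<Rightarrow> real ^ 3"
    and \<Phi> :: "real \<Rightarrow> real ^ 3 \<Rightarrow> real"
  assumes L: "L > 0"
    and c: "spacetime_smooth L c" and u: "spacetime_smooth L u" and \<Phi>: "spacetime_smooth L \<Phi>"
    and transport: "\<And>t p. t > 0 \<Longrightarrow> p \<in> open_slab L \<Longrightarrow>
      deriv (\<lambda>s. c s p) t + u t p \<bullet> grad (c t) p
        = Dc * divg (\<lambda>q. grad (c t) q + (\<sigma> * c t q) *\<^sub>R grad (\<Phi> t) q) p"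
    and incompressible: "\<And>t p. t > 0 \<Longrightarrow> p \<in> open_slab L \<Longrightarrow> divg (u t) p = 0"
    and no_slip: "\<And>t p. t > 0 \<Longrightarrow> p $ 1 = 0 \<or> p $ 1 = L \<Longrightarrow> u t p = 0"
begin

definition flux :: "real \<Rightarrow> real ^ 3 \<Rightarrow> real ^ 3" where
  "flux t p = grad (c t) p + (\<sigma> * c t p) *\<^sub>R grad (\<Phi> t) p"

lemma flux_has_div: "t > 0 \<Longrightarrow> has_div L (flux t) (divg (flux t))"
proof -
  assume t: "t > 0"
  note * = has_div_add[OF spacetime_smooth_C1(2)[OF c t]
      has_div_scale[OF spacetime_smooth_C1(2)[OF \<Phi> t] C1_cmult[OF spacetime_smooth_C1(1)[OF c t], of \<sigma>]],
      folded flux_def]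
  show ?thesis by (rule has_div_cong[OF *]) (rule divg_eq[OF *])
qed

lemma u_solenoidal: "t > 0 \<Longrightarrow> has_div L (u t) (\<lambda>p. 0)"
  by (rule has_div_cong[OF spacetime_smooth_has_div[OF u]]) (auto simp: incompressible)

lemma u_continuous: "t > 0 \<Longrightarrow> continuous_on (closed_slab L) (u t)"
  by (rule spacetime_slice[OF spacetime_smooth_continuous[OF u]])

lemma u_vanishing: "t > 0 \<Longrightarrow> vanishing_bound L (u t)"
  unfolding vanishing_bound_def vanishing_def
  by (rule exI[of _ "\<lambda>p. norm (u t p)"], rule exI[of _ 1])
    (auto simp: no_slip intro!: continuous_intros u_continuous)

lemma c_continuous: "t > 0 \<Longrightarrow> continuous_on (closed_slab L) (c t)"
  by (rule spacetime_slice[OF spacetime_smooth_continuous[OF c]])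

lemmas c_C1 = spacetime_smooth_C1(1)[OF c]

lemma c_locally_bounded: "a > 0 \<Longrightarrow> \<exists>B. \<forall>t\<in>{a..b}. \<forall>p\<in>closed_cell L. \<bar>c t p\<bar> \<le> B"
  by (rule spacetime_locally_bounded[OF spacetime_smooth_continuous[OF c]])

lemma weak_form:
  assumes t: "t > 0" and \<psi>: "C1 L \<psi> \<psi>'" "vanishing L \<psi>"
  shows "cell_integral L (\<lambda>p. \<psi> p * deriv (\<lambda>s. c s p) t) =
    - Dc * cell_integral L (\<lambda>p. flux t p \<bullet> \<psi>' p) - cell_integral L (\<lambda>p. \<psi> p * (u t p \<bullet> grad (c t) p))"
proof -
  note J = flux_has_div[OF t]
  note bc = bcont_intros C1_bcont[OF \<psi>(1)] has_div_bcont[OF u_solenoidal[OF t]]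
    C1_bcont_grad[OF c_C1[OF t]] has_div_bcont_div[OF J]
  have "cell_integral L (\<lambda>p. \<psi> p * deriv (\<lambda>s. c s p) t) =
    cell_integral L (\<lambda>p. Dc * (\<psi> p * divg (flux t) p) - \<psi> p * (u t p \<bullet> grad (c t) p))"
  proof (rule ci_cong)
    fix p assume p: "p \<in> open_slab L"
    have "deriv (\<lambda>s. c s p) t = Dc * divg (flux t) p - u t p \<bullet> grad (c t) p"
      using transport[OF t p] unfolding flux_def[abs_def] by simp
    then show "\<psi> p * deriv (\<lambda>s. c s p) t = Dc * (\<psi> p * divg (flux t) p) - \<psi> p * (u t p \<bullet> grad (c t) p)"
      by (simp only: right_diff_distrib mult.left_commute)
  qed
  also have "\<dots> = cell_integral L (\<lambda>p. Dc * (\<psi> p * divg (flux t) p)) - cell_integral L (\<lambda>p. \<psi> p * (u t p \<bullet> grad (c t) p))"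
    by (rule ci_diff) (intro bc)+
  finally show ?thesis
    by (simp add: ci_cmult integration_by_parts[OF L J \<psi>])
qed

text \<open>Convection by a solenoidal field leaves every integral \<open>\<integral> \<eta>(c)\<close> unchanged, since \<open>\<eta>'(c) u \<bullet> \<nabla>c = u \<bullet> \<nabla>\<eta>(c)\<close>.\<close>

lemma functional_derivative:
  assumes t: "t > 0" and \<eta>: "\<And>s. (\<eta> has_real_derivative a s) (at s)"
    and a: "\<And>s. (a has_real_derivative a' s) (at s)" "continuous_on UNIV a'"
    and bdry: "\<And>p. p $ 1 = 0 \<or> p $ 1 = L \<Longrightarrow> a (c t p) = 0"
  shows "((\<lambda>t. cell_integral L (\<lambda>p. \<eta> (c t p))) has_real_derivative
    - Dc * cell_integral L (\<lambda>p. flux t p \<bullet> (a' (c t p) *\<^sub>R grad (c t) p))) (at t)"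
proof -
  have ca: "continuous_on UNIV a"
    using DERIV_isCont[OF a(1)] by (intro continuous_at_imp_continuous_on) auto
  have v: "vanishing L (\<lambda>p. a (c t p))"
    by (rule vanishing_compose[OF c_continuous[OF t] ca bdry])
  have \<psi>: "C1 L (\<lambda>p. a (c t p)) (\<lambda>p. a' (c t p) *\<^sub>R grad (c t) p)"
    by (intro C1_compose c_C1 t a)
  have "C1 L (\<lambda>p. \<eta> (c t p)) (\<lambda>p. a (c t p) *\<^sub>R grad (c t) p)"
    by (intro C1_compose c_C1 t \<eta> ca)
  from solenoidal_gradient_integral_zero[OF L u_solenoidal[OF t] u_vanishing[OF t] this]
  have "cell_integral L (\<lambda>p. a (c t p) * (u t p \<bullet> grad (c t) p)) = 0" by simp
  with weak_form[OF t \<psi> v] density_derivative[OF c t \<eta> ca bcont_const[of L 0] bcont_const[of L 0]]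
  show ?thesis by simp
qed

end

text \<open>The comparison functionals grow linearly, for which convergence in \<open>L\<^sup>1\<close> suffices; it follows from
\<open>|x| \<le> \<theta> + x\<^sup>2 / \<theta>\<close> on the cell of finite volume.\<close>

lemma initial_L1:
  fixes f :: "real \<Rightarrow> real ^ 3 \<Rightarrow> real"
  assumes f: "\<And>t. t > 0 \<Longrightarrow> bcont L (f t)" and f0: "bcont L f0" and init: "attains_initial L f f0"
  shows "((\<lambda>t. cell_integral L (\<lambda>p. \<bar>f t p - f0 p\<bar>)) \<longlongrightarrow> 0) (at_right 0)"
proof (rule tendstoI)
  fix e :: real assume e: "e > 0"
  define m where "m = measure lborel (cell L)"
  have m: "m \<ge> 0" by (simp add: m_def)
  define \<theta> where "\<theta> = e / (2 * (m + 1))"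
  have \<theta>: "\<theta> > 0" "\<theta> * m < e / 2"
    using e m by (auto simp: \<theta>_def field_simps)
  have lim: "((\<lambda>t. cell_integral L (\<lambda>p. (f t p - f0 p)\<^sup>2)) \<longlongrightarrow> 0) (at_right 0)"
    using init by (simp add: attains_initial_def cell_integral_def)
  have "\<forall>\<^sub>F t in at_right 0. cell_integral L (\<lambda>p. (f t p - f0 p)\<^sup>2) < \<theta> * e / 2"
    using \<theta> e by (intro order_tendstoD[OF lim]) auto
  moreover have "\<forall>\<^sub>F t in at_right 0. (0::real) < t" by (simp add: eventually_at_right_less)
  ultimately show "\<forall>\<^sub>F t in at_right 0. dist (cell_integral L (\<lambda>p. \<bar>f t p - f0 p\<bar>)) 0 < e"
  proof eventually_elim
    case (elim t)
    note bc = bcont_intros f[OF elim(2)] f0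
    have "cell_integral L (\<lambda>p. \<bar>f t p - f0 p\<bar>) \<le> cell_integral L (\<lambda>p. \<theta> + 1 / \<theta> * (f t p - f0 p)\<^sup>2)"
    proof (rule ci_mono)
      fix p
      have "x \<le> \<theta> + 1 / \<theta> * x\<^sup>2" if "x \<ge> 0" for x
      proof (cases "x \<le> \<theta>")
        case True
        then show ?thesis using \<theta> by (smt (verit) divide_nonneg_pos mult_nonneg_nonneg zero_le_power2)
      next
        case False
        then have "\<theta> * x \<le> x * x" using that by (intro mult_right_mono) auto
        then have "x \<le> 1 / \<theta> * x\<^sup>2" using \<theta> by (simp add: field_simps power2_eq_square)
        then show ?thesis using \<theta> by simp
      qed
      from this[of "\<bar>f t p - f0 p\<bar>"] show "\<bar>f t p - f0 p\<bar> \<le> \<theta> + 1 / \<theta> * (f t p - f0 p)\<^sup>2" by simp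
    qed (intro bc)+
    also have "\<dots> = \<theta> * m + 1 / \<theta> * cell_integral L (\<lambda>p. (f t p - f0 p)\<^sup>2)"
      by (subst ci_add) (intro bc, intro bc, simp only: ci_cmult measure_cell_nonneg_integral m_def)
    also have "\<dots> < e / 2 + 1 / \<theta> * (\<theta> * e / 2)"
      using \<theta> elim(1) by (intro add_strict_mono mult_strict_left_mono) auto
    also have "\<dots> = e" using \<theta> by simp
    finally show ?case
      using ci_nonneg[of L "\<lambda>p. \<bar>f t p - f0 p\<bar>"] by (simp add: dist_real_def)
  qed
qed

lemma smooth_initial_bcont:
  fixes f :: "real ^ 3 \<Rightarrow> real"
  assumes "smooth_on (closed_slab L) f"
  shows "bcont L f"
proof -
  have c: "continuous_on (closed_slab L) f"
    using assms Ck_on_continuous unfolding smooth_on_def by blast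
  have "cbox 0 (\<chi> i. if i = 1 then L else 1 :: real ^ 3) \<subseteq> closed_slab L"
    by (auto simp: closed_slab_def mem_box_cart forall_3)
  then have "bounded (f ` cbox 0 (\<chi> i. if i = 1 then L else 1))"
    by (intro compact_imp_bounded compact_continuous_image continuous_on_subset[OF c] compact_cbox)
  moreover have "closed_cell L \<subseteq> cbox 0 (\<chi> i. if i = 1 then L else 1)"
    by (auto simp: closed_cell_def open_slab_def mem_box_cart forall_3)
  ultimately show ?thesis
    unfolding bcont_def
    by (auto intro: bounded_subset[OF _ image_mono] continuous_on_subset[OF c] simp: open_slab_closed_slab subset_eq)
qed

lemma arctan_less_self: "x > 0 \<Longrightarrow> arctan x < x"
proof -
  assume x: "x > 0"
  have "(\<lambda>x. x - arctan x) 0 < (\<lambda>x. x - arctan x) x"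
  proof (rule DERIV_pos_imp_increasing_open[OF x])
    fix z :: real assume "0 < z"
    then have "((\<lambda>x. x - arctan x) has_real_derivative 1 - inverse (1 + z\<^sup>2)) (at z)"
      by (auto intro!: derivative_eq_intros)
    moreover have "inverse (1 + z\<^sup>2) < 1" using \<open>0 < z\<close> by (intro inverse_less_1_iff[THEN iffD2]) auto
    ultimately show "\<exists>y. ((\<lambda>x. x - arctan x) has_real_derivative y) (at z) \<and> 0 < y" by force
  qed (auto intro!: continuous_intros)
  then show ?thesis by simp
qed

section \<open>A priori bounds on concentrations and potential\<close>

text \<open>With \<open>n = max s 0\<close>, the function \<open>n - \<delta> arctan (n / \<delta>)\<close> approximates \<open>n\<close> for small \<open>\<delta>\<close>. It is convex,
twice continuously differentiable and of linear growth. The third function is the associated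
antiderivative \<open>Q\<close> in \<open>flux_pairing\<close> (up to reflection); it is of order \<open>\<delta>\<close>.\<close>

lemma DERIV_truncated:
  fixes \<delta> :: real
  assumes \<delta>: "\<delta> > 0"
  shows "((\<lambda>s. max s 0 - \<delta> * arctan (max s 0 / \<delta>)) has_real_derivative 1 - \<delta>\<^sup>2 / (\<delta>\<^sup>2 + (max s 0)\<^sup>2)) (at s)"
    and "((\<lambda>s. 1 - \<delta>\<^sup>2 / (\<delta>\<^sup>2 + (max s 0)\<^sup>2)) has_real_derivative 2 * max s 0 * \<delta>\<^sup>2 / (\<delta>\<^sup>2 + (max s 0)\<^sup>2)\<^sup>2) (at s)"
    and "((\<lambda>s. \<delta> * arctan (max s 0 / \<delta>) - max s 0 * \<delta>\<^sup>2 / (\<delta>\<^sup>2 + (max s 0)\<^sup>2)) has_real_derivative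
       max s 0 * (2 * max s 0 * \<delta>\<^sup>2 / (\<delta>\<^sup>2 + (max s 0)\<^sup>2)\<^sup>2)) (at s)"
proof -
  have pos: "\<delta>\<^sup>2 + x\<^sup>2 > 0" for x using \<delta> by (simp add: add_pos_nonneg)
  then have nz: "\<delta>\<^sup>2 + x\<^sup>2 \<noteq> 0" for x by (metis less_irrefl)
  have at: "((\<lambda>x. \<delta> * arctan (x / \<delta>)) has_real_derivative \<delta>\<^sup>2 / (\<delta>\<^sup>2 + x\<^sup>2)) (at x)" for x
  proof -
    have "((\<lambda>x. \<delta> * arctan (x / \<delta>)) has_real_derivative \<delta> * (inverse (1 + (x / \<delta>)\<^sup>2) * (1 / \<delta>))) (at x)"
      using \<delta> by (intro DERIV_cmult DERIV_chain2[OF DERIV_arctan]) (auto intro!: derivative_eq_intros)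
    moreover have "1 + (x / \<delta>)\<^sup>2 = (\<delta>\<^sup>2 + x\<^sup>2) / \<delta>\<^sup>2"
      using \<delta> by (simp add: field_simps power2_eq_square)
    ultimately show ?thesis using \<delta> by simp
  qed
  show "((\<lambda>s. max s 0 - \<delta> * arctan (max s 0 / \<delta>)) has_real_derivative 1 - \<delta>\<^sup>2 / (\<delta>\<^sup>2 + (max s 0)\<^sup>2)) (at s)"
    by (rule DERIV_pos_part[where F = "\<lambda>x. x - \<delta> * arctan (x / \<delta>)" and F' = "\<lambda>x. 1 - \<delta>\<^sup>2 / (\<delta>\<^sup>2 + x\<^sup>2)"])
      (use \<delta> in \<open>auto intro!: DERIV_diff at\<close>)
  have 2: "((\<lambda>x. \<delta>\<^sup>2 / (\<delta>\<^sup>2 + x\<^sup>2)) has_real_derivative - (2 * x * \<delta>\<^sup>2 / (\<delta>\<^sup>2 + x\<^sup>2)\<^sup>2)) (at x)" for x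
    using nz[of x] by (auto intro!: derivative_eq_intros simp: power2_eq_square)
  show "((\<lambda>s. 1 - \<delta>\<^sup>2 / (\<delta>\<^sup>2 + (max s 0)\<^sup>2)) has_real_derivative 2 * max s 0 * \<delta>\<^sup>2 / (\<delta>\<^sup>2 + (max s 0)\<^sup>2)\<^sup>2) (at s)"
    by (rule DERIV_pos_part[where F = "\<lambda>x. 1 - \<delta>\<^sup>2 / (\<delta>\<^sup>2 + x\<^sup>2)" and F' = "\<lambda>x. 2 * x * \<delta>\<^sup>2 / (\<delta>\<^sup>2 + x\<^sup>2)\<^sup>2"])
      (auto intro!: DERIV_cong[OF DERIV_diff[OF DERIV_const 2]])
  have 3: "((\<lambda>x. \<delta> * arctan (x / \<delta>) - x * (\<delta>\<^sup>2 / (\<delta>\<^sup>2 + x\<^sup>2))) has_real_derivative x * (2 * x * \<delta>\<^sup>2 / (\<delta>\<^sup>2 + x\<^sup>2)\<^sup>2)) (at x)" for x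
    by (rule DERIV_cong[OF DERIV_diff[OF at DERIV_mult[OF DERIV_ident 2]]]) simp
  show "((\<lambda>s. \<delta> * arctan (max s 0 / \<delta>) - max s 0 * \<delta>\<^sup>2 / (\<delta>\<^sup>2 + (max s 0)\<^sup>2)) has_real_derivative
       max s 0 * (2 * max s 0 * \<delta>\<^sup>2 / (\<delta>\<^sup>2 + (max s 0)\<^sup>2)\<^sup>2)) (at s)"
    by (rule DERIV_pos_part[where F = "\<lambda>x. \<delta> * arctan (x / \<delta>) - x * \<delta>\<^sup>2 / (\<delta>\<^sup>2 + x\<^sup>2)" and F' = "\<lambda>x. x * (2 * x * \<delta>\<^sup>2 / (\<delta>\<^sup>2 + x\<^sup>2)\<^sup>2)"])
      (use 3 in auto)
qed

text \<open>Maximum principle by testing with the cube of the positive part, which gives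
\<open>\<integral> (max v 0)\<^sup>2 |\<nabla>v|\<^sup>2 \<le> 0\<close>; the Poincare inequality for the square of the positive part concludes.\<close>

lemma weakly_subharmonic_nonpos:
  assumes L: "L > 0" and v: "C1 L v v'" "has_div L v' d" "continuous_on (closed_slab L) v"
    and d: "\<And>p. p \<in> cell L \<Longrightarrow> 0 \<le> d p"
    and bdry: "\<And>p. p $ 1 = 0 \<or> p $ 1 = L \<Longrightarrow> v p \<le> 0"
    and p: "p \<in> cell L"
  shows "v p \<le> 0"
proof -
  note D = DERIV_parts[of 0, unfolded diff_0_right]
  note bc = bcont_intros C1_bcont[OF v(1)] C1_bcont_grad[OF v(1)] has_div_bcont_div[OF v(2)]
    bcont_compose_UNIV[of L v "\<lambda>s. max s 0"]
  have cm: "continuous_on UNIV (\<lambda>s::real. max s 0)" by (intro continuous_intros)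
  have \<psi>: "C1 L (\<lambda>p. max (v p) 0 ^ 3) (\<lambda>p. (3 * (max (v p) 0)\<^sup>2) *\<^sub>R v' p)"
    by (intro C1_compose v D continuous_intros)
  have v\<psi>: "vanishing L (\<lambda>p. max (v p) 0 ^ 3)"
    by (rule vanishing_compose[OF v(3)]) (use bdry in \<open>auto intro!: continuous_intros\<close>)
  have f: "C1 L (\<lambda>p. (max (v p) 0)\<^sup>2) (\<lambda>p. (2 * max (v p) 0) *\<^sub>R v' p)"
    by (intro C1_compose v D continuous_intros)
  have vf: "vanishing L (\<lambda>p. (max (v p) 0)\<^sup>2)"
    by (rule vanishing_compose[OF v(3)]) (use bdry in \<open>auto intro!: continuous_intros\<close>)
  let ?S = "cell_integral L (\<lambda>p. (max (v p) 0)\<^sup>2 * (v' p \<bullet> v' p))"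
  have "0 \<le> cell_integral L (\<lambda>p. max (v p) 0 ^ 3 * d p)"
    by (intro ci_nonneg mult_nonneg_nonneg d) auto
  also have "\<dots> = - cell_integral L (\<lambda>p. v' p \<bullet> ((3 * (max (v p) 0)\<^sup>2) *\<^sub>R v' p))"
    by (rule integration_by_parts[OF L v(2) \<psi> v\<psi>])
  also have "cell_integral L (\<lambda>p. v' p \<bullet> ((3 * (max (v p) 0)\<^sup>2) *\<^sub>R v' p)) = 3 * ?S"
    unfolding ci_cmult[symmetric] by (intro ci_cong) simp
  finally have S: "?S \<le> 0" by simp
  have "cell_integral L (\<lambda>p. ((max (v p) 0)\<^sup>2)\<^sup>2) \<le> L\<^sup>2 / 4 * cell_integral L (\<lambda>p. (((2 * max (v p) 0) *\<^sub>R v' p) $ 1)\<^sup>2)"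
    by (rule poincare[OF L f vf])
  also have "\<dots> \<le> L\<^sup>2 / 4 * cell_integral L (\<lambda>p. 4 * ((max (v p) 0)\<^sup>2 * (v' p \<bullet> v' p)))"
  proof (intro mult_left_mono ci_mono)
    fix p
    have "(v' p $ 1)\<^sup>2 \<le> v' p \<bullet> v' p"
      by (simp add: inner_vec_def sum_3 power2_eq_square)
    then show "(((2 * max (v p) 0) *\<^sub>R v' p) $ 1)\<^sup>2 \<le> 4 * ((max (v p) 0)\<^sup>2 * (v' p \<bullet> v' p))"
      by (simp add: power_mult_distrib mult_left_mono)
  qed (intro bc cm, intro bc cm, simp)
  also have "\<dots> \<le> 0"
    using S by (simp add: ci_cmult mult_nonneg_nonpos)
  finally have "((max (v p) 0)\<^sup>2)\<^sup>2 = 0"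
    by (intro ci_zero_imp_zero[OF _ _ _ p]) (intro bc cm, auto)
  then show ?thesis by (simp add: max_def split: if_splits)
qed

locale nps_flow =
  fixes L D1 D2 \<epsilon> \<nu> K \<alpha>1 \<alpha>2 \<beta>1 \<beta>2 V :: real
    and c10 c20 :: "real ^ 3 \<Rightarrow> real" and u0 :: "real ^ 3 \<Rightarrow> real ^ 3"
    and c1 c2 :: "real \<Rightarrow> real ^ 3 \<Rightarrow> real" and u :: "real \<Rightarrow> real ^ 3 \<Rightarrow> real ^ 3"
    and \<Phi> pr :: "real \<Rightarrow> real ^ 3 \<Rightarrow> real"
  assumes L: "L > 0" and D1: "D1 > 0" and D2: "D2 > 0" and \<epsilon>: "\<epsilon> > 0" and \<nu>: "\<nu> > 0" and K: "K > 0"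
    and bpos: "\<alpha>1 > 0" "\<alpha>2 > 0" "\<beta>1 > 0" "\<beta>2 > 0" and V: "V > 0"
    and init: "smooth_initial_data L c10 c20 u0"
    and sol: "nps_solution L D1 D2 \<epsilon> \<nu> K \<alpha>1 \<alpha>2 \<beta>1 \<beta>2 V c10 c20 u0 c1 c2 u \<Phi> pr"
begin

lemma smooth: "spacetime_smooth L c1" "spacetime_smooth L c2" "spacetime_smooth L u"
    "spacetime_smooth L \<Phi>" "spacetime_smooth L pr"
  and eqs: "nps_equations L D1 D2 \<epsilon> \<nu> K c1 c2 u \<Phi> pr"
  and bdry: "nps_boundary L \<alpha>1 \<alpha>2 \<beta>1 \<beta>2 V c1 c2 u \<Phi>"
  and attained: "attains_initial L c1 c10" "attains_initial L c2 c20"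
  using sol by (auto simp: nps_solution_def)

lemma boundary_values:
  assumes "t > 0" "p $ 1 = 0 \<or> p $ 1 = L"
  shows "c1 t p \<in> {\<alpha>1, \<beta>1}" "c2 t p \<in> {\<alpha>2, \<beta>2}" "\<Phi> t p \<in> {- V, 0}" "u t p = 0"
  using bdry assms unfolding nps_boundary_def by auto

lemma divg_u: "t > 0 \<Longrightarrow> p \<in> open_slab L \<Longrightarrow> divg (u t) p = 0"
  using eqs by (auto simp: nps_equations_def)

sublocale ion1: ion_transport L D1 1 c1 u \<Phi>
proof
  show "deriv (\<lambda>s. c1 s p) t + u t p \<bullet> grad (c1 t) p = D1 * divg (\<lambda>q. grad (c1 t) q + (1 * c1 t q) *\<^sub>R grad (\<Phi> t) q) p"
    if "t > 0" "p \<in> open_slab L" for t p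
    using eqs that by (simp add: nps_equations_def)
qed (use L smooth divg_u boundary_values in auto)

sublocale ion2: ion_transport L D2 "-1" c2 u \<Phi>
proof
  show "deriv (\<lambda>s. c2 s p) t + u t p \<bullet> grad (c2 t) p = D2 * divg (\<lambda>q. grad (c2 t) q + (-1 * c2 t q) *\<^sub>R grad (\<Phi> t) q) p"
    if "t > 0" "p \<in> open_slab L" for t p
    using eqs that by (simp add: nps_equations_def)
qed (use L smooth divg_u boundary_values in auto)

lemma potential_has_div: "t > 0 \<Longrightarrow> has_div L (grad (\<Phi> t)) (\<lambda>p. - (c1 t p - c2 t p) / \<epsilon>)"
proof (rule has_div_cong[OF spacetime_smooth_C1(2)[OF smooth(4)]])
  fix p assume t: "t > 0" and p: "p \<in> open_slab L"
  then have "- \<epsilon> * laplace (\<Phi> t) p = c1 t p - c2 t p"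
    using eqs by (auto simp: nps_equations_def)
  then show "- (c1 t p - c2 t p) / \<epsilon> = laplace (\<Phi> t) p"
    using \<epsilon> by (auto simp: field_simps)
qed

lemma snapshot: "t > 0 \<Longrightarrow> electrostatics L \<epsilon> (c1 t) (c2 t) (grad (c1 t)) (grad (c2 t)) (grad (\<Phi> t))"
  by unfold_locales
    (intro L \<epsilon> ion1.c_C1 ion2.c_C1 ion1.c_continuous ion2.c_continuous potential_has_div; assumption)+

lemma comparison_derivative:
  assumes t: "t > 0" and \<eta>: "\<And>s. (\<eta> has_real_derivative a s) (at s)"
    and a: "\<And>s. (a has_real_derivative a' s) (at s)" "continuous_on UNIV a'"
    and Q: "\<And>s. (Q has_real_derivative s * a' s) (at s)"
    and zero: "\<And>s. s \<in> {\<alpha>1, \<alpha>2, \<beta>1, \<beta>2} \<Longrightarrow> a s = 0 \<and> Q s = 0"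
  shows "((\<lambda>t. cell_integral L (\<lambda>p. \<eta> (c1 t p)) / D1 + cell_integral L (\<lambda>p. \<eta> (c2 t p)) / D2) has_real_derivative
    - (cell_integral L (\<lambda>p. a' (c1 t p) * (grad (c1 t) p \<bullet> grad (c1 t) p)) +
       cell_integral L (\<lambda>p. a' (c2 t p) * (grad (c2 t) p \<bullet> grad (c2 t) p)) +
       cell_integral L (\<lambda>p. (Q (c1 t p) - Q (c2 t p)) * (c1 t p - c2 t p)) / \<epsilon>)) (at t)"
proof -
  interpret electrostatics L \<epsilon> "c1 t" "c2 t" "grad (c1 t)" "grad (c2 t)" "grad (\<Phi> t)"
    by (rule snapshot[OF t])
  have b: "a (c1 t p) = 0" "a (c2 t p) = 0" "Q (c1 t p) = 0 \<and> Q (c2 t p) = 0" if "p $ 1 = 0 \<or> p $ 1 = L" for p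
    using boundary_values[OF t that] zero by auto
  note F = flux_pairing[OF a Q b(3)]
  have "((\<lambda>t. cell_integral L (\<lambda>p. \<eta> (c1 t p)) / D1 + cell_integral L (\<lambda>p. \<eta> (c2 t p)) / D2) has_real_derivative
    - D1 * cell_integral L (\<lambda>p. ion1.flux t p \<bullet> (a' (c1 t p) *\<^sub>R grad (c1 t) p)) / D1 +
    - D2 * cell_integral L (\<lambda>p. ion2.flux t p \<bullet> (a' (c2 t p) *\<^sub>R grad (c2 t) p)) / D2) (at t)"
    by (intro DERIV_add DERIV_cdivide ion1.functional_derivative[OF t \<eta> a b(1)]
        ion2.functional_derivative[OF t \<eta> a b(2)])
  moreover have "ion1.flux t = (\<lambda>p. grad (c1 t) p + c1 t p *\<^sub>R grad (\<Phi> t) p)"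
    "ion2.flux t = (\<lambda>p. grad (c2 t) p - c2 t p *\<^sub>R grad (\<Phi> t) p)"
    by (auto simp: ion1.flux_def ion2.flux_def)
  moreover have "- D1 * x / D1 + - D2 * y / D2 = - z" if "x + y = z" for x y z
    using that D1 D2 by simp
  from this[OF F] have "- D1 * cell_integral L (\<lambda>p. (grad (c1 t) p + c1 t p *\<^sub>R grad (\<Phi> t) p) \<bullet> (a' (c1 t p) *\<^sub>R grad (c1 t) p)) / D1 +
    - D2 * cell_integral L (\<lambda>p. (grad (c2 t) p - c2 t p *\<^sub>R grad (\<Phi> t) p) \<bullet> (a' (c2 t p) *\<^sub>R grad (c2 t) p)) / D2 = - (
      cell_integral L (\<lambda>p. a' (c1 t p) * (grad (c1 t) p \<bullet> grad (c1 t) p)) +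
       cell_integral L (\<lambda>p. a' (c2 t p) * (grad (c2 t) p \<bullet> grad (c2 t) p)) +
       cell_integral L (\<lambda>p. (Q (c1 t p) - Q (c2 t p)) * (c1 t p - c2 t p)) / \<epsilon>)" .
  ultimately show ?thesis by (simp only:)
qed

lemma initial_data:
  "bcont L c10" "bcont L c20"
  "\<And>p. p \<in> cell L \<Longrightarrow> 0 \<le> c10 p" "\<And>p. p \<in> cell L \<Longrightarrow> 0 \<le> c20 p"
  using init smooth_initial_bcont cell_open_slab open_slab_closed_slab
  by (auto simp: smooth_initial_data_def)

lemma initial_limit:
  "((\<lambda>t. cell_integral L (\<lambda>p. \<bar>c1 t p - c10 p\<bar>) / D1 + cell_integral L (\<lambda>p. \<bar>c2 t p - c20 p\<bar>) / D2) \<longlongrightarrow> 0) (at_right 0)"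
proof -
  have "((\<lambda>t. cell_integral L (\<lambda>p. \<bar>c1 t p - c10 p\<bar>) / D1 + cell_integral L (\<lambda>p. \<bar>c2 t p - c20 p\<bar>) / D2) \<longlongrightarrow> 0 / D1 + 0 / D2) (at_right 0)"
    using D1 D2
    by (intro tendsto_intros initial_L1 initial_data attained C1_bcont[OF ion1.c_C1] C1_bcont[OF ion2.c_C1]) auto
  then show ?thesis by simp
qed

text \<open>Initial values are attained only in \<open>L\<^sup>2\<close>, so smallness is transported to time \<open>t\<close> from times \<open>s\<close> that tend to zero.\<close>

lemma nonincreasing_functional_zero:
  assumes t: "t > 0"
    and mono: "\<And>s. 0 < s \<Longrightarrow> s \<le> t \<Longrightarrow> y \<le> cell_integral L (\<lambda>p. \<eta> (c1 s p)) / D1 + cell_integral L (\<lambda>p. \<eta> (c2 s p)) / D2"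
    and \<eta>: "continuous_on UNIV \<eta>"
    and le: "\<And>s p. p \<in> cell L \<Longrightarrow> \<eta> s \<le> \<bar>s - c10 p\<bar> \<and> \<eta> s \<le> \<bar>s - c20 p\<bar>"
  shows "y \<le> 0"
proof (rule tendsto_lowerbound[OF initial_limit])
  have "\<forall>\<^sub>F s in at_right 0. 0 < s \<and> s < t"
    using t by (auto simp: eventually_at_right_field intro: exI[of _ t])
  then show "\<forall>\<^sub>F s in at_right 0. y \<le> cell_integral L (\<lambda>p. \<bar>c1 s p - c10 p\<bar>) / D1 + cell_integral L (\<lambda>p. \<bar>c2 s p - c20 p\<bar>) / D2"
  proof eventually_elim
    case (elim s)
    note bc = C1_bcont[OF ion1.c_C1] C1_bcont[OF ion2.c_C1] bcont_compose_UNIV[OF _ \<eta>] bcont_intros initial_data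
    have "cell_integral L (\<lambda>p. \<eta> (c1 s p)) / D1 + cell_integral L (\<lambda>p. \<eta> (c2 s p)) / D2
      \<le> cell_integral L (\<lambda>p. \<bar>c1 s p - c10 p\<bar>) / D1 + cell_integral L (\<lambda>p. \<bar>c2 s p - c20 p\<bar>) / D2"
      using D1 D2 elim le
      by (intro add_mono divide_right_mono ci_mono) (auto intro!: bc)
    with mono[of s] elim show ?case by simp
  qed
qed simp

lemma functional_zero:
  assumes t: "t > 0" and \<eta>: "continuous_on UNIV \<eta>" "\<And>s. 0 \<le> \<eta> s"
    and le: "cell_integral L (\<lambda>p. \<eta> (c1 t p)) / D1 + cell_integral L (\<lambda>p. \<eta> (c2 t p)) / D2 \<le> 0"
    and p: "p \<in> cell L"
  shows "\<eta> (c1 t p) = 0 \<and> \<eta> (c2 t p) = 0"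
proof -
  have nn: "0 \<le> cell_integral L (\<lambda>p. \<eta> (c1 t p)) / D1" "0 \<le> cell_integral L (\<lambda>p. \<eta> (c2 t p)) / D2"
    using D1 D2 by (auto intro!: divide_nonneg_pos ci_nonneg \<eta>)
  with le have "cell_integral L (\<lambda>p. \<eta> (c1 t p)) \<le> 0" "cell_integral L (\<lambda>p. \<eta> (c2 t p)) \<le> 0"
    using D1 D2 by (smt (verit) divide_pos_pos)+
  then show ?thesis
    using ci_zero_imp_zero[OF bcont_compose_UNIV[OF C1_bcont[OF ion1.c_C1[OF t]] \<eta>(1)] \<eta>(2) _ p]
      ci_zero_imp_zero[OF bcont_compose_UNIV[OF C1_bcont[OF ion2.c_C1[OF t]] \<eta>(1)] \<eta>(2) _ p] by blast
qed

text \<open>\<open>M\<close> bounds the initial and boundary values. The functional is built from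
\<open>n - arctan n\<close> with \<open>n = max (c - M) 0\<close>; here \<open>Q\<close> is increasing because \<open>M\<close> is positive, so the
functional decreases whatever the sign of the concentrations.\<close>

lemma upper_bound:
  obtains M where "M > 0" "\<And>t p. t > 0 \<Longrightarrow> p \<in> cell L \<Longrightarrow> c1 t p \<le> M \<and> c2 t p \<le> M"
proof -
  obtain B1 B2 where B: "\<And>p. p \<in> closed_cell L \<Longrightarrow> \<bar>c10 p\<bar> \<le> B1" "\<And>p. p \<in> closed_cell L \<Longrightarrow> \<bar>c20 p\<bar> \<le> B2"
    using initial_data(1,2) unfolding bcont_def bounded_iff real_norm_def by (metis image_eqI)
  define M where "M = Max {\<alpha>1, \<alpha>2, \<beta>1, \<beta>2, B1, B2}"
  have M: "\<alpha>1 \<le> M" "\<alpha>2 \<le> M" "\<beta>1 \<le> M" "\<beta>2 \<le> M" "B1 \<le> M" "B2 \<le> M" by (auto simp: M_def)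
  have M0: "M > 0" using bpos M by linarith
  have c0: "c10 p \<le> M" "c20 p \<le> M" if "p \<in> cell L" for p
    using B[of p] M that cell_subset_closed_cell by fastforce+
  define \<eta> where "\<eta> s = max (s - M) 0 - arctan (max (s - M) 0)" for s
  define a where "a s = 1 - 1 / (1 + (max (s - M) 0)\<^sup>2)" for s
  define a' where "a' s = 2 * max (s - M) 0 / (1 + (max (s - M) 0)\<^sup>2)\<^sup>2" for s
  have nz: "1 + x\<^sup>2 \<noteq> 0" for x :: real by (smt (verit) zero_le_power2)
  have shift: "((\<lambda>s. s - M) has_real_derivative 1) (at s)" for s
    by (auto intro!: derivative_eq_intros)
  have d\<eta>: "(\<eta> has_real_derivative a s) (at s)" for s
    unfolding \<eta>_def a_def using DERIV_chain2[OF DERIV_truncated(1)[of 1] shift] by simp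
  have da: "(a has_real_derivative a' s) (at s)" for s
    unfolding a_def a'_def using DERIV_chain2[OF DERIV_truncated(2)[of 1] shift] by simp
  have ca: "continuous_on UNIV a'"
    unfolding a'_def by (intro continuous_intros) (simp add: nz)
  have c\<eta>: "continuous_on UNIV \<eta>"
    unfolding \<eta>_def by (intro continuous_intros)
  have "continuous_on UNIV (\<lambda>s. s * a' s)" by (intro continuous_intros ca)
  then obtain Q0 where Q0: "\<And>s. (Q0 has_real_derivative s * a' s) (at s)"
    by (rule antiderivative_exists) blast
  define Q where "Q s = Q0 s - Q0 M" for s
  have Q: "(Q has_real_derivative s * a' s) (at s)" for s
    unfolding Q_def using DERIV_diff[OF Q0 DERIV_const] by simp
  have Q_le: "Q s = 0" if "s \<le> M" for s
  proof -
    have "Q M = Q s"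
    proof (cases "s = M")
      case False
      show ?thesis
      proof (rule DERIV_isconst2[of s M Q])
        show "continuous_on {s..M} Q"
          using DERIV_isCont[OF Q] by (intro continuous_at_imp_continuous_on) auto
        show "(Q has_real_derivative 0) (at x)" if "s < x" "x < M" for x
          using Q[of x] that by (simp add: a'_def)
      qed (use that False in auto)
    qed simp
    then show ?thesis by (simp add: Q_def)
  qed
  have Q_mono: "Q s \<le> Q s'" if "s \<le> s'" for s s'
  proof (rule DERIV_nonneg_imp_nondecreasing[OF that])
    fix x show "\<exists>y. (Q has_real_derivative y) (at x) \<and> 0 \<le> y"
      using Q[of x] M0 by (intro exI[of _ "x * a' x"]) (auto simp: a'_def max_def)
  qed
  have zero: "a s = 0 \<and> Q s = 0" if "s \<in> {\<alpha>1, \<alpha>2, \<beta>1, \<beta>2}" for s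
    using that M Q_le by (auto simp: a_def)
  have a'_nn: "0 \<le> a' s" for s by (simp add: a'_def)
  let ?Y = "\<lambda>t. cell_integral L (\<lambda>p. \<eta> (c1 t p)) / D1 + cell_integral L (\<lambda>p. \<eta> (c2 t p)) / D2"
  have Y: "?Y t \<le> ?Y s" if s: "0 < s" "s \<le> t" for s t
  proof (rule DERIV_nonpos_imp_nonincreasing[OF s(2)])
    fix x assume "s \<le> x"
    with s have x: "x > 0" by simp
    have "0 \<le> (Q r - Q r') * (r - r')" for r r'
      using Q_mono[of r r'] Q_mono[of r' r]
      by (cases "r \<le> r'") (auto intro: mult_nonneg_nonneg mult_nonpos_nonpos)
    then have "0 \<le> cell_integral L (\<lambda>p. (Q (c1 x p) - Q (c2 x p)) * (c1 x p - c2 x p)) / \<epsilon>"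
      using \<epsilon> by (intro divide_nonneg_pos ci_nonneg)
    then have "0 \<le> cell_integral L (\<lambda>p. a' (c1 x p) * (grad (c1 x) p \<bullet> grad (c1 x) p)) +
       cell_integral L (\<lambda>p. a' (c2 x p) * (grad (c2 x) p \<bullet> grad (c2 x) p)) +
       cell_integral L (\<lambda>p. (Q (c1 x p) - Q (c2 x p)) * (c1 x p - c2 x p)) / \<epsilon>"
      by (intro add_nonneg_nonneg[OF add_nonneg_nonneg]) (intro ci_nonneg mult_nonneg_nonneg a'_nn inner_ge_zero)+
    then show "\<exists>y. (?Y has_real_derivative y) (at x) \<and> y \<le> 0"
      using comparison_derivative[OF x d\<eta> da ca Q zero] by (intro exI conjI) (assumption, simp only: neg_le_0_iff_le)
  qed
  have \<eta>_nn: "0 \<le> \<eta> s" for s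
    using arctan_less_self[of "s - M"] by (cases "s > M") (auto simp: \<eta>_def max_def)
  have "\<eta> s \<le> \<bar>s - c\<bar>" if "c \<le> M" for s c
  proof (cases "s > M")
    case True
    then have "0 < arctan (s - M)" by simp
    moreover have "\<eta> s = (s - M) - arctan (s - M)" using True by (simp add: \<eta>_def)
    ultimately show ?thesis using True that by linarith
  qed (simp add: \<eta>_def max_def)
  then have le: "\<eta> s \<le> \<bar>s - c10 p\<bar> \<and> \<eta> s \<le> \<bar>s - c20 p\<bar>" if "p \<in> cell L" for s p
    using c0[OF that] by blast
  have "c1 t p \<le> M \<and> c2 t p \<le> M" if t: "t > 0" and p: "p \<in> cell L" for t p
  proof -
    have "?Y t \<le> 0"
      by (rule nonincreasing_functional_zero[OF t _ c\<eta> le]) (rule Y)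
    from functional_zero[OF t c\<eta> \<eta>_nn this p]
    have "\<eta> (c1 t p) = 0" "\<eta> (c2 t p) = 0" by auto
    moreover have "s \<le> M" if "\<eta> s = 0" for s
      using that arctan_less_self[of "s - M"] by (cases "s > M") (auto simp: \<eta>_def max_def)
    ultimately show ?thesis by blast
  qed
  with M0 show thesis by (rule that)
qed

text \<open>Near zero the monotonicity of \<open>Q\<close> is lost, since \<open>s * a'(s)\<close> is negative for negative \<open>s\<close>. The integral of
the negative part itself is still nonincreasing: for its approximation with parameter \<open>\<delta>\<close> the charge term is
of order \<open>\<delta>\<close>, uniformly on compact time intervals, and \<open>\<delta>\<close> tends to zero before the initial time is approached.\<close>

lemma nonnegative:
  assumes t: "t > 0" and p: "p \<in> cell L"
  shows "0 \<le> c1 t p \<and> 0 \<le> c2 t p"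
proof -
  let ?n = "\<lambda>s. max (- s) 0 :: real"
  let ?N = "\<lambda>t. cell_integral L (\<lambda>p. ?n (c1 t p)) / D1 + cell_integral L (\<lambda>p. ?n (c2 t p)) / D2"
  have cn: "continuous_on UNIV ?n" by (intro continuous_intros)
  have N: "?N t \<le> ?N s" if s: "0 < s" "s \<le> t" for s
  proof -
    obtain B where B: "\<And>r p. r \<in> {s..t} \<Longrightarrow> p \<in> closed_cell L \<Longrightarrow> \<bar>c1 r p\<bar> \<le> B \<and> \<bar>c2 r p\<bar> \<le> B"
    proof -
      obtain B1 B2 where "\<forall>r\<in>{s..t}. \<forall>p\<in>closed_cell L. \<bar>c1 r p\<bar> \<le> B1" "\<forall>r\<in>{s..t}. \<forall>p\<in>closed_cell L. \<bar>c2 r p\<bar> \<le> B2"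
        using ion1.c_locally_bounded[OF s(1)] ion2.c_locally_bounded[OF s(1)] by metis
      then show thesis by (intro that[of "max B1 B2"]) (auto simp: le_max_iff_disj)
    qed
    define m where "m = measure lborel (cell L)"
    have m: "0 \<le> m" by (simp add: m_def)
    define C where "C = pi / 2 * m * (1 / D1 + 1 / D2) + pi * B * m / \<epsilon> * (t - s)"
    have "?N t \<le> ?N s + \<delta> * C" if \<delta>: "\<delta> > 0" for \<delta>
    proof -
      define \<eta> where "\<eta> s = ?n s - \<delta> * arctan (?n s / \<delta>)" for s
      define a where "a s = - (1 - \<delta>\<^sup>2 / (\<delta>\<^sup>2 + (?n s)\<^sup>2))" for s
      define a' where "a' s = 2 * ?n s * \<delta>\<^sup>2 / (\<delta>\<^sup>2 + (?n s)\<^sup>2)\<^sup>2" for s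
      define Q where "Q s = \<delta> * arctan (?n s / \<delta>) - ?n s * \<delta>\<^sup>2 / (\<delta>\<^sup>2 + (?n s)\<^sup>2)" for s
      have neg: "((\<lambda>s. - s :: real) has_real_derivative -1) (at s)" for s
        by (auto intro!: derivative_eq_intros)
      have nz: "\<delta>\<^sup>2 + x\<^sup>2 \<noteq> 0" for x using \<delta> by (smt (verit) zero_le_power2 zero_less_power2)
      have d\<eta>: "(\<eta> has_real_derivative a s) (at s)" for s
        unfolding \<eta>_def[abs_def] a_def using DERIV_chain2[OF DERIV_truncated(1)[OF \<delta>] neg] by simp
      have da: "(a has_real_derivative a' s) (at s)" for s
        unfolding a_def[abs_def] a'_def using DERIV_minus[OF DERIV_chain2[OF DERIV_truncated(2)[OF \<delta>] neg]] by simp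
      have dQ: "(Q has_real_derivative s * a' s) (at s)" for s
      proof -
        have "(Q has_real_derivative ?n s * a' s * -1) (at s)"
          unfolding Q_def[abs_def] a'_def using DERIV_chain2[OF DERIV_truncated(3)[OF \<delta>] neg] by simp
        moreover have "?n s * a' s * -1 = s * a' s" by (auto simp: a'_def max_def)
        ultimately show ?thesis by simp
      qed
      have ca: "continuous_on UNIV a'"
        unfolding a'_def using nz by (intro continuous_intros) (use \<delta> in auto)
      have c\<eta>: "continuous_on UNIV \<eta>"
        unfolding \<eta>_def using \<delta> by (intro continuous_intros) auto
      have cQ: "continuous_on UNIV Q"
        unfolding Q_def using \<delta> nz by (intro continuous_intros) auto
      have zero: "a s = 0 \<and> Q s = 0" if "s \<in> {\<alpha>1, \<alpha>2, \<beta>1, \<beta>2}" for s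
        using that bpos \<delta> by (auto simp: a_def Q_def)
      have a'_nn: "0 \<le> a' s" for s by (simp add: a'_def)
      have at: "0 \<le> \<delta> * arctan (?n s / \<delta>)" "\<delta> * arctan (?n s / \<delta>) \<le> \<delta> * (pi / 2)" for s
        using \<delta> arctan_bounded[of "?n s / \<delta>"] arctan_le_iff[of 0 "?n s / \<delta>"]
        by (auto intro!: mult_left_mono mult_nonneg_nonneg)
      have Q_bd: "Q s \<le> \<delta> * (pi / 2)" for s
      proof -
        have "0 \<le> ?n s * \<delta>\<^sup>2 / (\<delta>\<^sup>2 + (?n s)\<^sup>2)" by (intro divide_nonneg_nonneg mult_nonneg_nonneg) auto
        then show ?thesis
          by (intro order_trans[OF _ at(2)[of s]]) (simp only: Q_def diff_le_eq le_add_same_cancel1)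
      qed
      have Q_nn: "0 \<le> Q s" for s
      proof (cases "s \<ge> 0")
        case False
        have "Q 0 \<le> Q s"
        proof (rule DERIV_nonpos_imp_nonincreasing[of s 0 Q])
          show "\<exists>y. (Q has_real_derivative y) (at x) \<and> y \<le> 0" if "x \<le> 0" for x
            using dQ[of x] that a'_nn[of x] by (intro exI[of _ "x * a' x"]) (auto intro: mult_nonpos_nonneg)
        qed (use False in auto)
        then show ?thesis by (simp add: Q_def)
      qed (simp add: Q_def)
      let ?Y = "\<lambda>t. cell_integral L (\<lambda>p. \<eta> (c1 t p)) / D1 + cell_integral L (\<lambda>p. \<eta> (c2 t p)) / D2"
      let ?R = "\<delta> * (pi * B * m / \<epsilon>)"
      have "?Y t - ?R * t \<le> ?Y s - ?R * s"
      proof (rule DERIV_nonpos_imp_nonincreasing[of s t "\<lambda>r. ?Y r - ?R * r"])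
        fix x assume sx: "s \<le> x" "x \<le> t"
        with s have x: "x > 0" by simp
        have bc: "bcont L (\<lambda>p. (Q (c1 x p) - Q (c2 x p)) * (c1 x p - c2 x p))"
          by (intro bcont_intros bcont_compose_UNIV[OF _ cQ] C1_bcont[OF ion1.c_C1[OF x]] C1_bcont[OF ion2.c_C1[OF x]])
        have "- (\<delta> * (pi / 2) * (2 * B)) * m = cell_integral L (\<lambda>p. - (\<delta> * (pi / 2) * (2 * B)))"
          unfolding m_def by (rule measure_cell_nonneg_integral[symmetric])
        also have "\<dots> \<le> cell_integral L (\<lambda>p. (Q (c1 x p) - Q (c2 x p)) * (c1 x p - c2 x p))"
        proof (rule ci_mono[OF bcont_const bc])
          fix p assume "p \<in> cell L"
          then have "\<bar>c1 x p\<bar> \<le> B" "\<bar>c2 x p\<bar> \<le> B"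
            using B[of x p] sx cell_subset_closed_cell by auto
          then have "\<bar>c1 x p - c2 x p\<bar> \<le> 2 * B" by linarith
          moreover have "\<bar>Q (c1 x p) - Q (c2 x p)\<bar> \<le> \<delta> * (pi / 2)"
            using Q_bd[of "c1 x p"] Q_bd[of "c2 x p"] Q_nn[of "c1 x p"] Q_nn[of "c2 x p"] by linarith
          ultimately have "\<bar>(Q (c1 x p) - Q (c2 x p)) * (c1 x p - c2 x p)\<bar> \<le> \<delta> * (pi / 2) * (2 * B)"
            unfolding abs_mult using \<delta> by (intro mult_mono) auto
          then show "- (\<delta> * (pi / 2) * (2 * B)) \<le> (Q (c1 x p) - Q (c2 x p)) * (c1 x p - c2 x p)"
            by (simp add: abs_le_iff)
        qed
        finally have I: "- ?R \<le> cell_integral L (\<lambda>p. (Q (c1 x p) - Q (c2 x p)) * (c1 x p - c2 x p)) / \<epsilon>"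
          using \<epsilon> by (simp add: field_simps)
        have "0 \<le> cell_integral L (\<lambda>p. a' (c1 x p) * (grad (c1 x) p \<bullet> grad (c1 x) p)) +
           cell_integral L (\<lambda>p. a' (c2 x p) * (grad (c2 x) p \<bullet> grad (c2 x) p))"
          by (intro add_nonneg_nonneg ci_nonneg mult_nonneg_nonneg a'_nn inner_ge_zero)
        with I have "- (cell_integral L (\<lambda>p. a' (c1 x p) * (grad (c1 x) p \<bullet> grad (c1 x) p)) +
           cell_integral L (\<lambda>p. a' (c2 x p) * (grad (c2 x) p \<bullet> grad (c2 x) p)) +
           cell_integral L (\<lambda>p. (Q (c1 x p) - Q (c2 x p)) * (c1 x p - c2 x p)) / \<epsilon>) - ?R \<le> 0"
          by (smt (verit))
        moreover have "((\<lambda>r. ?Y r - ?R * r) has_real_derivative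
          - (cell_integral L (\<lambda>p. a' (c1 x p) * (grad (c1 x) p \<bullet> grad (c1 x) p)) +
           cell_integral L (\<lambda>p. a' (c2 x p) * (grad (c2 x) p \<bullet> grad (c2 x) p)) +
           cell_integral L (\<lambda>p. (Q (c1 x p) - Q (c2 x p)) * (c1 x p - c2 x p)) / \<epsilon>) - ?R) (at x)"
          using DERIV_diff[OF comparison_derivative[OF x d\<eta> da ca dQ zero] DERIV_cmult[OF DERIV_ident, of ?R]] by simp
        ultimately show "\<exists>y. ((\<lambda>r. ?Y r - ?R * r) has_real_derivative y) (at x) \<and> y \<le> 0" by blast
      qed (rule s(2))
      note Y = this
      have low: "cell_integral L (\<lambda>p. ?n (c p)) - \<delta> * (pi / 2) * m \<le> cell_integral L (\<lambda>p. \<eta> (c p))"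
        and up: "cell_integral L (\<lambda>p. \<eta> (c p)) \<le> cell_integral L (\<lambda>p. ?n (c p))" if c: "bcont L c" for c
      proof -
        note bc = bcont_intros bcont_compose_UNIV[OF c cn] bcont_compose_UNIV[OF c c\<eta>]
        show "cell_integral L (\<lambda>p. \<eta> (c p)) \<le> cell_integral L (\<lambda>p. ?n (c p))"
          by (rule ci_mono[OF bcont_compose_UNIV[OF c c\<eta>] bcont_compose_UNIV[OF c cn]])
            (use at in \<open>simp add: \<eta>_def\<close>)
        have "cell_integral L (\<lambda>p. ?n (c p)) - \<delta> * (pi / 2) * m = cell_integral L (\<lambda>p. ?n (c p) - \<delta> * (pi / 2))"
          by (subst ci_diff) (intro bc, intro bc, simp only: measure_cell_nonneg_integral m_def)
        also have "\<dots> \<le> cell_integral L (\<lambda>p. \<eta> (c p))"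
        proof (rule ci_mono)
          show "?n (c p) - \<delta> * (pi / 2) \<le> \<eta> (c p)" for p
            using at(2)[of "c p"] by (simp add: \<eta>_def)
        qed (intro bc)+
        finally show "cell_integral L (\<lambda>p. ?n (c p)) - \<delta> * (pi / 2) * m \<le> cell_integral L (\<lambda>p. \<eta> (c p))" .
      qed
      note c_bc = C1_bcont[OF ion1.c_C1] C1_bcont[OF ion2.c_C1]
      have "?N t - \<delta> * (pi / 2) * m * (1 / D1 + 1 / D2) =
        (cell_integral L (\<lambda>p. ?n (c1 t p)) - \<delta> * (pi / 2) * m) / D1 + (cell_integral L (\<lambda>p. ?n (c2 t p)) - \<delta> * (pi / 2) * m) / D2"
        by (simp add: diff_divide_distrib distrib_left)
      also have "\<dots> \<le> ?Y t"
        using D1 D2 t by (intro add_mono divide_right_mono low c_bc) auto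
      also have "\<dots> \<le> ?Y s + ?R * (t - s)" using Y by (simp add: right_diff_distrib)
      also have "?Y s \<le> ?N s"
        using D1 D2 s by (intro add_mono divide_right_mono up c_bc) auto
      finally show ?thesis by (simp add: C_def algebra_simps)
    qed
    note * = this
    show ?thesis
    proof (rule field_le_epsilon)
      fix e :: real assume e: "e > 0"
      define \<delta> where "\<delta> = e / (\<bar>C\<bar> + 1)"
      have "\<delta> > 0" using e by (simp add: \<delta>_def)
      moreover have "\<delta> * C \<le> e"
      proof -
        have "\<delta> * C \<le> \<delta> * (\<bar>C\<bar> + 1)" using \<open>\<delta> > 0\<close> by (intro mult_left_mono) auto
        then show ?thesis by (simp add: \<delta>_def)
      qed
      ultimately show "?N t \<le> ?N s + e" using *[of \<delta>] by simp
    qed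
  qed
  have le: "?n s \<le> \<bar>s - c10 p\<bar> \<and> ?n s \<le> \<bar>s - c20 p\<bar>" if "p \<in> cell L" for s p
    using initial_data(3,4)[OF that] by auto
  have "?N t \<le> 0"
    by (rule nonincreasing_functional_zero[OF t _ cn le]) (rule N)
  moreover have "0 \<le> ?n s" for s by simp
  ultimately have "?n (c1 t p) = 0 \<and> ?n (c2 t p) = 0"
    by (intro functional_zero[OF t cn _ _ p])
  then show ?thesis by (auto simp: max_def split: if_splits)
qed

end

text \<open>Comparison with the parabola \<open>M / (2 \<epsilon>) * x (L - x)\<close>, whose second derivative dominates the
charge density.\<close>

lemma (in nps_flow) potential_bounded:
  assumes M: "\<And>t p. t > 0 \<Longrightarrow> p \<in> cell L \<Longrightarrow> c1 t p \<le> M \<and> c2 t p \<le> M"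
  obtains P where "P > 0" "\<And>t p. t > 0 \<Longrightarrow> p \<in> cell L \<Longrightarrow> \<bar>\<Phi> t p\<bar> \<le> P"
proof -
  define A where "A = M / \<epsilon>"
  define b where "b x = A / 2 * (x * (L - x))" for x
  have db: "(b has_real_derivative A / 2 * (L - 2 * x)) (at x)" for x
    unfolding b_def by (auto intro!: derivative_eq_intros simp: algebra_simps)
  have cb: "continuous_on {0..L} b"
    unfolding b_def by (intro continuous_intros)
  have bC: "C1 L (\<lambda>p. b (p $ 1)) (\<lambda>p. (A / 2 * (L - 2 * p $ 1)) *\<^sub>R e1)"
    by (rule C1_of_x[where f' = "\<lambda>x. A / 2 * (L - 2 * x)", OF db])
      (intro bounded_if_continuous continuous_intros cb)+
  have "C1 L (\<lambda>p. A / 2 * (L - 2 * p $ 1)) (\<lambda>p. (- A) *\<^sub>R e1)"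
    by (rule C1_of_x[where f' = "\<lambda>x. - A"])
      (auto intro!: derivative_eq_intros continuous_intros bounded_if_continuous)
  from has_div_normal[OF this] have bD: "has_div L (\<lambda>p. (A / 2 * (L - 2 * p $ 1)) *\<^sub>R e1) (\<lambda>p. - A)"
    by simp
  have bcont: "continuous_on (closed_slab L) (\<lambda>p. b (p $ 1))"
    by (rule continuous_on_x) (auto simp: b_def intro!: continuous_intros)
  have d: "- A \<le> - (c1 t p - c2 t p) / \<epsilon> \<and> - (c1 t p - c2 t p) / \<epsilon> \<le> A" if "t > 0" "p \<in> cell L" for t p
  proof -
    have "\<bar>c1 t p - c2 t p\<bar> \<le> M" using M[OF that] nonnegative[OF that] by auto
    then have "\<bar>- (c1 t p - c2 t p) / \<epsilon>\<bar> \<le> A" using \<epsilon> by (simp add: A_def divide_right_mono abs_minus_commute)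
    then show ?thesis using abs_le_D1 abs_le_D2 by fastforce
  qed
  have "\<bar>\<Phi> t p\<bar> \<le> b (p $ 1) + V" if t: "t > 0" and p: "p \<in> cell L" for t p
  proof -
    note P1 = spacetime_smooth_C1(1)[OF smooth(4) t] and P2 = potential_has_div[OF t]
    have Pc: "continuous_on (closed_slab L) (\<Phi> t)"
      by (rule spacetime_slice[OF spacetime_smooth_continuous[OF smooth(4)] t])
    have b0: "b (p $ 1) = 0" if "p $ 1 = 0 \<or> p $ 1 = L" for p :: "real ^ 3"
      using that by (auto simp: b_def)
    have P0: "\<Phi> t p \<le> 0" "- V \<le> \<Phi> t p" if "p $ 1 = 0 \<or> p $ 1 = L" for p
      using boundary_values(3)[OF t that] V by auto
    have "\<Phi> t p - b (p $ 1) \<le> 0"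
    proof (rule weakly_subharmonic_nonpos[OF L C1_diff[OF P1 bC] has_div_diff[OF P2 bD] _ _ _ p])
      show "continuous_on (closed_slab L) (\<lambda>p. \<Phi> t p - b (p $ 1))"
        by (intro continuous_intros Pc bcont)
      show "0 \<le> - (c1 t q - c2 t q) / \<epsilon> - - A" if "q \<in> cell L" for q
        using d[OF t that] by linarith
      show "\<Phi> t q - b (q $ 1) \<le> 0" if "q $ 1 = 0 \<or> q $ 1 = L" for q
        using P0(1)[OF that] b0[OF that] by simp
    qed
    moreover have "(-1 * \<Phi> t p - b (p $ 1)) - V \<le> 0"
    proof (rule weakly_subharmonic_nonpos[OF L C1_diff[OF C1_diff[OF C1_cmult[OF P1] bC] C1_const] _ _ _ _ p])
      show "has_div L (\<lambda>p. - 1 *\<^sub>R grad (\<Phi> t) p - (A / 2 * (L - 2 * p $ 1)) *\<^sub>R e1 - 0) (\<lambda>p. -1 * (- (c1 t p - c2 t p) / \<epsilon>) - - A)"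
        using has_div_diff[OF has_div_cmult[OF P2, of "-1"] bD] by simp
      show "continuous_on (closed_slab L) (\<lambda>p. - 1 * \<Phi> t p - b (p $ 1) - V)"
        by (intro continuous_intros Pc bcont)
      show "0 \<le> -1 * (- (c1 t q - c2 t q) / \<epsilon>) - - A" if "q \<in> cell L" for q
        using d[OF t that] by linarith
      show "- 1 * \<Phi> t q - b (q $ 1) - V \<le> 0" if "q $ 1 = 0 \<or> q $ 1 = L" for q
        using P0(2)[OF that] b0[OF that] by simp
    qed
    ultimately show ?thesis using V by auto
  qed
  moreover have "b x \<le> \<bar>A\<bar> * L\<^sup>2" if "0 < x" "x < L" for x
  proof -
    have "x * (L - x) \<le> L * L" using that by (intro mult_mono) auto
    moreover have "A / 2 \<le> \<bar>A\<bar>" by simp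
    ultimately have "A / 2 * (x * (L - x)) \<le> \<bar>A\<bar> * (L * L)"
      using that by (intro mult_mono) auto
    then show ?thesis by (simp add: b_def power2_eq_square)
  qed
  ultimately have "\<bar>\<Phi> t p\<bar> \<le> \<bar>A\<bar> * L\<^sup>2 + V" if "t > 0" "p \<in> cell L" for t p
  proof -
    have "b (p $ 1) \<le> \<bar>A\<bar> * L\<^sup>2" if "p \<in> cell L" for p
      using \<open>\<And>x. 0 < x \<Longrightarrow> x < L \<Longrightarrow> b x \<le> \<bar>A\<bar> * L\<^sup>2\<close> that by (simp add: cell_def)
    with \<open>\<And>t p. t > 0 \<Longrightarrow> p \<in> cell L \<Longrightarrow> \<bar>\<Phi> t p\<bar> \<le> b (p $ 1) + V\<close>[OF that] that(2)
    show ?thesis by (meson add_right_mono order_trans)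
  qed
  moreover have "0 < \<bar>A\<bar> * L\<^sup>2 + V" using V by (simp add: add_nonneg_pos)
  ultimately show thesis by (intro that)
qed

text \<open>Integrating \<open>\<integral> q \<nabla>\<Phi> \<bullet> \<nabla>\<Phi>\<close> by parts with \<open>q = excess2\<^sup>2\<close> leaves \<open>- \<integral> \<Phi> \<nabla>q \<bullet> \<nabla>\<Phi> - \<integral> \<Phi> q \<Delta>\<Phi>\<close>. Young's
inequality bounds the first term by half of the left-hand side and a multiple of the right-hand side; the second one is
controlled by \<open>\<integral> q\<close>, hence by \<open>excess_poincare\<close>. Thus the field is estimated where the concentration is
out of range without a bound on the field itself.\<close>

lemma excess_field_energy:
  assumes L: "L > 0" and \<Phi>: "C1 L \<Phi> E" "has_div L E d" "continuous_on (closed_slab L) \<Phi>"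
    and c: "C1 L c g" "continuous_on (closed_slab L) c" and lo: "lo \<le> hi"
    and bdry: "\<And>p. p $ 1 = 0 \<or> p $ 1 = L \<Longrightarrow> lo \<le> c p \<and> c p \<le> hi"
    and P: "\<And>p. p \<in> cell L \<Longrightarrow> \<bar>\<Phi> p\<bar> \<le> P" and R: "\<And>p. p \<in> cell L \<Longrightarrow> \<bar>d p\<bar> \<le> R"
    and PR: "0 \<le> P" "0 \<le> R"
  shows "cell_integral L (\<lambda>p. (excess2 lo hi (c p))\<^sup>2 * (E p \<bullet> E p))
    \<le> (16 * P\<^sup>2 + 2 * P * R * L\<^sup>2) * cell_integral L (\<lambda>p. excess2 lo hi (c p) * (g p \<bullet> g p))"
proof -
  let ?r = "\<lambda>p. excess2 lo hi (c p)" and ?q = "\<lambda>p. (excess2 lo hi (c p))\<^sup>2" and ?e = "\<lambda>p. excess3 lo hi (c p)"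
  have c3: "continuous_on UNIV (excess3 lo hi)"
    using DERIV_isCont[OF DERIV_excess3] by (intro continuous_at_imp_continuous_on) auto
  have q: "C1 L ?q (\<lambda>p. (4 * ?e p) *\<^sub>R g p)"
    by (intro C1_compose[OF c(1) DERIV_excess4[OF lo]] continuous_intros c3)
  have \<psi>: "C1 L (\<lambda>p. ?q p * \<Phi> p) (\<lambda>p. ?q p *\<^sub>R E p + \<Phi> p *\<^sub>R ((4 * ?e p) *\<^sub>R g p))"
    by (rule C1_mult[OF q \<Phi>(1)])
  have "vanishing L ?q"
    by (rule vanishing_compose[OF c(2)]) (use bdry excess_inside in \<open>auto intro!: continuous_intros excess2_continuous\<close>)
  then have v: "vanishing L (\<lambda>p. ?q p * \<Phi> p)" by (rule vanishing_mult[OF _ \<Phi>(3)])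
  note bc = bcont_intros C1_bcont[OF \<Phi>(1)] has_div_bcont[OF \<Phi>(2)] has_div_bcont_div[OF \<Phi>(2)]
    C1_bcont_grad[OF c(1)] bcont_excess2[OF C1_bcont[OF c(1)]] bcont_compose_UNIV[OF C1_bcont[OF c(1)] c3]
  let ?X = "cell_integral L (\<lambda>p. ?q p * (E p \<bullet> E p))" and ?S = "cell_integral L (\<lambda>p. ?r p * (g p \<bullet> g p))"
  have "?X + cell_integral L (\<lambda>p. 4 * \<Phi> p * ?e p * (E p \<bullet> g p)) = cell_integral L (\<lambda>p. E p \<bullet> (?q p *\<^sub>R E p + \<Phi> p *\<^sub>R ((4 * ?e p) *\<^sub>R g p)))"
    by (subst ci_add[symmetric]) (intro bc, intro bc, intro ci_cong, simp add: inner_add_right algebra_simps)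
  also have "\<dots> = - cell_integral L (\<lambda>p. ?q p * \<Phi> p * d p)"
    using integration_by_parts[OF L \<Phi>(2) \<psi> v] by simp
  finally have "?X = cell_integral L (\<lambda>p. - (?q p * \<Phi> p * d p) - 4 * \<Phi> p * ?e p * (E p \<bullet> g p))"
    by (subst ci_diff) (intro bc, intro bc, simp add: ci_minus)
  also have "\<dots> \<le> cell_integral L (\<lambda>p. P * R * ?q p + (1 / 2 * (?q p * (E p \<bullet> E p)) + 8 * P\<^sup>2 * (?r p * (g p \<bullet> g p))))"
  proof (rule ci_mono)
    fix p assume p: "p \<in> cell L"
    have "\<bar>\<Phi> p * d p\<bar> \<le> P * R" unfolding abs_mult using P[OF p] R[OF p] PR by (intro mult_mono) auto
    then have "?q p * (- (\<Phi> p * d p)) \<le> ?q p * (P * R)"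
      by (intro mult_left_mono) (auto simp: abs_le_iff)
    moreover have "- (4 * \<Phi> p * ?e p * (E p \<bullet> g p)) \<le> 1 / 2 * (?q p * (E p \<bullet> E p)) + 8 * P\<^sup>2 * (?r p * (g p \<bullet> g p))"
    proof -
      \<comment> \<open>The distance of \<open>c p\<close> to \<open>[lo, hi]\<close>, since at most one summand is nonzero.\<close>
      define m where "m = max (c p - hi) 0 + max (lo - c p) 0"
      have m: "0 \<le> m" "?r p = m\<^sup>2" "\<bar>?e p\<bar> = m ^ 3"
        using lo by (auto simp: m_def excess2_def excess3_def max_def)
      have "- (4 * \<Phi> p * ?e p * (E p \<bullet> g p)) \<le> 4 * \<bar>\<Phi> p\<bar> * \<bar>?e p\<bar> * \<bar>E p \<bullet> g p\<bar>"
        using abs_ge_minus_self[of "4 * \<Phi> p * ?e p * (E p \<bullet> g p)"] by (simp only: abs_mult abs_numeral)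
      also have "\<dots> \<le> 4 * P * m ^ 3 * (norm (E p) * norm (g p))"
        using P[OF p] PR m by (intro mult_mono Cauchy_Schwarz_ineq2) auto
      also have "\<dots> = (m\<^sup>2 * norm (E p)) * (4 * P * m * norm (g p))"
        by (simp add: power2_eq_square power3_eq_cube)
      also have "\<dots> \<le> 1 / 2 * (m\<^sup>2 * norm (E p))\<^sup>2 + 1 / 2 * (4 * P * m * norm (g p))\<^sup>2"
        using sum_squares_bound[of "m\<^sup>2 * norm (E p)" "4 * P * m * norm (g p)"] by simp
      also have "\<dots> = 1 / 2 * (?q p * (E p \<bullet> E p)) + 8 * P\<^sup>2 * (?r p * (g p \<bullet> g p))"
        by (simp add: m power_mult_distrib power2_norm_eq_inner)
      finally show ?thesis .
    qed
    ultimately show "- (?q p * \<Phi> p * d p) - 4 * \<Phi> p * ?e p * (E p \<bullet> g p)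
      \<le> P * R * ?q p + (1 / 2 * (?q p * (E p \<bullet> E p)) + 8 * P\<^sup>2 * (?r p * (g p \<bullet> g p)))"
      by (simp add: algebra_simps)
  qed (intro bc)+
  also have "\<dots> = P * R * cell_integral L ?q + (1 / 2 * ?X + 8 * P\<^sup>2 * ?S)"
    by ((subst ci_add; (intro bc)?)+) (simp only: ci_cmult)
  also have "P * R * cell_integral L ?q \<le> P * R * (L\<^sup>2 * ?S)"
    using PR by (intro mult_left_mono excess_poincare[OF L c lo bdry]) auto
  finally show ?thesis by (simp add: algebra_simps)
qed

section \<open>Relative entropy with a cut-off logarithm\<close>

lemma convex_function_nonneg:
  fixes f f' :: "real \<Rightarrow> real"
  assumes "\<And>x. (f has_real_derivative f' x) (at x)" and "f t = 0"
    and "\<And>x. t \<le> x \<Longrightarrow> 0 \<le> f' x" and "\<And>x. x \<le> t \<Longrightarrow> f' x \<le> 0"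
  shows "0 \<le> f s"
proof (cases "t \<le> s")
  case True
  have "f t \<le> f s" by (rule DERIV_nonneg_imp_nondecreasing[OF True]) (use assms in blast)
  then show ?thesis using assms by simp
next
  case False
  then have "f t \<le> f s"
    by (intro DERIV_nonpos_imp_nonincreasing[of s t f]) (use assms in auto)
  then show ?thesis using assms by simp
qed

text \<open>The logarithm is continued with slopes \<open>1 / a\<close> below \<open>a\<close> and \<open>1 / b\<close> above \<open>b\<close>. Then
\<open>\<nabla>c = cutoff c * \<nabla>(cutoff_ln c)\<close> holds without error, and the slopes of \<open>cutoff_ln\<close> lie between \<open>1 / b\<close> and \<open>1 / a\<close>
everywhere. Additive constants are irrelevant, so antiderivatives are chosen arbitrarily.\<close>

definition cutoff :: "real \<Rightarrow> real \<Rightarrow> real \<Rightarrow> real" where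
  "cutoff a b s = max a (min b s)"

definition cutoff_ln :: "real \<Rightarrow> real \<Rightarrow> real \<Rightarrow> real" where
  "cutoff_ln a b = (SOME g. \<forall>s. (g has_real_derivative 1 / cutoff a b s) (at s))"

definition cutoff_entropy :: "real \<Rightarrow> real \<Rightarrow> real \<Rightarrow> real" where
  "cutoff_entropy a b = (SOME G. \<forall>s. (G has_real_derivative cutoff_ln a b s) (at s))"

context
  fixes a b :: real
  assumes a: "0 < a" and ab: "a \<le> b"
begin

lemma cutoff_bounds: "a \<le> cutoff a b s" "cutoff a b s \<le> b" "0 < cutoff a b s"
  using a ab by (auto simp: cutoff_def)

lemma cutoff_continuous: "continuous_on S (cutoff a b)"
  unfolding cutoff_def by (intro continuous_intros)

lemma inverse_cutoff_continuous: "continuous_on S (\<lambda>s. 1 / cutoff a b s)"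
  using cutoff_bounds(3) by (intro continuous_intros cutoff_continuous) (auto simp: less_imp_neq[symmetric])

lemma DERIV_cutoff_ln: "(cutoff_ln a b has_real_derivative 1 / cutoff a b s) (at s)"
proof -
  obtain g where "\<And>s. (g has_real_derivative 1 / cutoff a b s) (at s)"
    using antiderivative_exists[OF inverse_cutoff_continuous] by blast
  then have "\<exists>g. \<forall>s. (g has_real_derivative 1 / cutoff a b s) (at s)" by blast
  then have "\<forall>s. (cutoff_ln a b has_real_derivative 1 / cutoff a b s) (at s)"
    unfolding cutoff_ln_def by (rule someI_ex)
  then show ?thesis by blast
qed

lemma cutoff_ln_continuous: "continuous_on S (cutoff_ln a b)"
  using DERIV_isCont[OF DERIV_cutoff_ln] by (intro continuous_at_imp_continuous_on) auto

lemma DERIV_cutoff_entropy: "(cutoff_entropy a b has_real_derivative cutoff_ln a b s) (at s)"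
proof -
  obtain G where "\<And>s. (G has_real_derivative cutoff_ln a b s) (at s)"
    using antiderivative_exists[OF cutoff_ln_continuous] by blast
  then have "\<exists>G. \<forall>s. (G has_real_derivative cutoff_ln a b s) (at s)" by blast
  then have "\<forall>s. (cutoff_entropy a b has_real_derivative cutoff_ln a b s) (at s)"
    unfolding cutoff_entropy_def by (rule someI_ex)
  then show ?thesis by blast
qed

lemma cutoff_entropy_continuous: "continuous_on S (cutoff_entropy a b)"
  using DERIV_isCont[OF DERIV_cutoff_entropy] by (intro continuous_at_imp_continuous_on) auto

lemma cutoff_ln_slope:
  assumes "s \<le> t"
  shows "(t - s) / b \<le> cutoff_ln a b t - cutoff_ln a b s" "cutoff_ln a b t - cutoff_ln a b s \<le> (t - s) / a"
proof -
  have "(\<lambda>s. cutoff_ln a b s - s / b) s \<le> (\<lambda>s. cutoff_ln a b s - s / b) t"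
  proof (rule DERIV_nonneg_imp_nondecreasing[OF assms])
    fix x
    have "((\<lambda>s. cutoff_ln a b s - s / b) has_real_derivative 1 / cutoff a b x - 1 / b) (at x)"
      by (intro DERIV_diff DERIV_cutoff_ln DERIV_cdivide DERIV_ident)
    moreover have "0 \<le> 1 / cutoff a b x - 1 / b"
      using cutoff_bounds[of x] by (simp add: frac_le)
    ultimately show "\<exists>y. ((\<lambda>s. cutoff_ln a b s - s / b) has_real_derivative y) (at x) \<and> 0 \<le> y" by blast
  qed
  then show "(t - s) / b \<le> cutoff_ln a b t - cutoff_ln a b s" by (simp add: diff_divide_distrib)
  have "(\<lambda>s. s / a - cutoff_ln a b s) s \<le> (\<lambda>s. s / a - cutoff_ln a b s) t"
  proof (rule DERIV_nonneg_imp_nondecreasing[OF assms])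
    fix x
    have "((\<lambda>s. s / a - cutoff_ln a b s) has_real_derivative 1 / a - 1 / cutoff a b x) (at x)"
      by (intro DERIV_diff DERIV_cutoff_ln DERIV_cdivide DERIV_ident)
    moreover have "0 \<le> 1 / a - 1 / cutoff a b x"
      using cutoff_bounds[of x] a by (simp add: frac_le)
    ultimately show "\<exists>y. ((\<lambda>s. s / a - cutoff_ln a b s) has_real_derivative y) (at x) \<and> 0 \<le> y" by blast
  qed
  then show "cutoff_ln a b t - cutoff_ln a b s \<le> (t - s) / a" by (simp add: diff_divide_distrib)
qed

lemma cutoff_ln_monotone: "(s - t)\<^sup>2 / b \<le> (s - t) * (cutoff_ln a b s - cutoff_ln a b t)"
proof (cases "t \<le> s")
  case True
  then have "(s - t) * ((s - t) / b) \<le> (s - t) * (cutoff_ln a b s - cutoff_ln a b t)"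
    by (intro mult_left_mono cutoff_ln_slope) auto
  then show ?thesis by (simp add: power2_eq_square)
next
  case False
  then have "(t - s) * ((t - s) / b) \<le> (t - s) * (cutoff_ln a b t - cutoff_ln a b s)"
    by (intro mult_left_mono cutoff_ln_slope) auto
  then show ?thesis by (simp add: power2_eq_square algebra_simps)
qed

definition relative_entropy :: "real \<Rightarrow> real \<Rightarrow> real" where
  "relative_entropy s t = cutoff_entropy a b s - cutoff_entropy a b t - cutoff_ln a b t * (s - t)"

lemma relative_entropy_bounds:
  "(s - t)\<^sup>2 / (2 * b) \<le> relative_entropy s t" "relative_entropy s t \<le> (s - t)\<^sup>2 / (2 * a)"
proof -
  have sq: "((\<lambda>s. (s - t)\<^sup>2 / (2 * k)) has_real_derivative (x - t) / k) (at x)" if "k > 0" for k x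
    using that by (auto intro!: derivative_eq_intros simp: field_simps)
  have re: "((\<lambda>s. relative_entropy s t) has_real_derivative cutoff_ln a b x - cutoff_ln a b t) (at x)" for x
  proof -
    have "((\<lambda>s. cutoff_entropy a b s - cutoff_entropy a b t - cutoff_ln a b t * (s - t)) has_real_derivative
      cutoff_ln a b x - 0 - cutoff_ln a b t * (1 - 0)) (at x)"
      by (intro DERIV_diff DERIV_cutoff_entropy DERIV_const DERIV_cmult DERIV_ident)
    then show ?thesis by (simp add: relative_entropy_def)
  qed
  have "0 \<le> (\<lambda>s. relative_entropy s t - (s - t)\<^sup>2 / (2 * b)) s"
  proof (rule convex_function_nonneg[where t = t and f = "\<lambda>s. relative_entropy s t - (s - t)\<^sup>2 / (2 * b)"
        and f' = "\<lambda>x. cutoff_ln a b x - cutoff_ln a b t - (x - t) / b"])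
    show "((\<lambda>s. relative_entropy s t - (s - t)\<^sup>2 / (2 * b)) has_real_derivative cutoff_ln a b x - cutoff_ln a b t - (x - t) / b) (at x)" for x
      using a ab by (intro DERIV_diff[OF re sq]) auto
    show "cutoff_ln a b x - cutoff_ln a b t - (x - t) / b \<le> 0" if "x \<le> t" for x
      using cutoff_ln_slope(1)[OF that] by (simp add: diff_divide_distrib)
  qed (use cutoff_ln_slope(1) in \<open>auto simp: relative_entropy_def\<close>)
  then show "(s - t)\<^sup>2 / (2 * b) \<le> relative_entropy s t" by simp
  have "0 \<le> (\<lambda>s. (s - t)\<^sup>2 / (2 * a) - relative_entropy s t) s"
  proof (rule convex_function_nonneg[where t = t and f = "\<lambda>s. (s - t)\<^sup>2 / (2 * a) - relative_entropy s t"
        and f' = "\<lambda>x. (x - t) / a - (cutoff_ln a b x - cutoff_ln a b t)"])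
    show "((\<lambda>s. (s - t)\<^sup>2 / (2 * a) - relative_entropy s t) has_real_derivative (x - t) / a - (cutoff_ln a b x - cutoff_ln a b t)) (at x)" for x
      using a by (intro DERIV_diff[OF sq re])
    show "(x - t) / a - (cutoff_ln a b x - cutoff_ln a b t) \<le> 0" if "x \<le> t" for x
      using cutoff_ln_slope(2)[OF that] by (simp add: diff_divide_distrib)
  qed (use cutoff_ln_slope(2) in \<open>auto simp: relative_entropy_def\<close>)
  then show "relative_entropy s t \<le> (s - t)\<^sup>2 / (2 * a)" by simp
qed

end

section \<open>Entropy production of one ion species\<close>

text \<open>The pointwise form of the entropy production: \<open>m\<close> is the cut-off concentration, \<open>z\<close> the gradient of \<open>\<zeta>\<close>,
\<open>d\<close> the deviation, \<open>e\<close> the part cut off and \<open>G\<close> the gradient of the potential. Young's inequality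
spends \<open>1/2\<close> of \<open>m |z|\<^sup>2\<close> on the current and \<open>1/8\<close> on the cut-off, which leaves \<open>3/8\<close>.\<close>

lemma relative_flux_bound:
  fixes z G :: "real ^ 3"
  assumes a: "0 < a" "a \<le> m" and lo: "0 < lo" "lo \<le> cs"
    and d: "\<bar>m - cs\<bar> \<le> \<bar>d\<bar>" and \<sigma>: "\<bar>\<sigma>\<bar> = 1"
  shows "j * z $ 1 - (m * (z \<bullet> z) + j * (m / cs) * z $ 1 + \<sigma> * e * (G \<bullet> z))
    \<le> j\<^sup>2 / (2 * a * lo\<^sup>2) * d\<^sup>2 + 2 / a * (e\<^sup>2 * (G \<bullet> G)) - 3 / 8 * a * (z \<bullet> z)"
proof -
  have m: "m > 0" and cs: "cs > 0" using a lo by linarith+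
  define q where "q = j * (m - cs) / cs"
  have "j * z $ 1 - j * (m / cs) * z $ 1 = - q * z $ 1"
    using cs by (simp add: q_def field_simps)
  moreover have "- q * z $ 1 \<le> m / 2 * (z \<bullet> z) + q\<^sup>2 / (2 * m)"
  proof -
    have "0 \<le> (m * z $ 1 + q)\<^sup>2" by simp
    then have "- q * z $ 1 * (2 * m) \<le> m\<^sup>2 * (z $ 1)\<^sup>2 + q\<^sup>2"
      by (simp add: power2_sum power_mult_distrib algebra_simps)
    then have "- q * z $ 1 \<le> (m\<^sup>2 * (z $ 1)\<^sup>2 + q\<^sup>2) / (2 * m)"
      using m by (simp add: pos_le_divide_eq)
    also have "\<dots> = m / 2 * (z $ 1)\<^sup>2 + q\<^sup>2 / (2 * m)"
      using m by (simp add: field_simps power2_eq_square)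
    also have "\<dots> \<le> m / 2 * (z \<bullet> z) + q\<^sup>2 / (2 * m)"
      using m by (intro add_right_mono mult_left_mono) (auto simp: inner_vec_def sum_3 power2_eq_square)
    finally show ?thesis .
  qed
  moreover have "q\<^sup>2 / (2 * m) \<le> j\<^sup>2 / (2 * a * lo\<^sup>2) * d\<^sup>2"
  proof -
    have "q\<^sup>2 \<le> (j * d / lo)\<^sup>2"
    proof -
      have "\<bar>q\<bar> \<le> \<bar>j\<bar> * \<bar>d\<bar> / lo"
        unfolding q_def abs_mult abs_divide using d lo cs by (intro frac_le mult_left_mono) auto
      then show ?thesis
        using lo by (intro abs_le_square_iff[THEN iffD1]) (simp add: abs_mult)
    qed
    then have "q\<^sup>2 / (2 * m) \<le> (j * d / lo)\<^sup>2 / (2 * a)"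
      using a by (intro frac_le) auto
    then show ?thesis by (simp add: power_divide power_mult_distrib mult.commute mult.left_commute)
  qed
  moreover have "- (\<sigma> * e * (G \<bullet> z)) \<le> m / 8 * (z \<bullet> z) + 2 / a * (e\<^sup>2 * (G \<bullet> G))"
  proof -
    have "- (\<sigma> * e * (G \<bullet> z)) \<le> \<bar>\<sigma> * e * (G \<bullet> z)\<bar>" by simp
    also have "\<dots> \<le> \<bar>e\<bar> * (norm G * norm z)"
      unfolding abs_mult \<sigma> using Cauchy_Schwarz_ineq2[of G z] by (simp add: mult_left_mono)
    also have "\<dots> \<le> m / 8 * (norm z)\<^sup>2 + 2 / m * (\<bar>e\<bar> * norm G)\<^sup>2"
    proof -
      have "0 \<le> (m * norm z - 4 * (\<bar>e\<bar> * norm G))\<^sup>2" by simp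
      then have "8 * m * (\<bar>e\<bar> * (norm G * norm z)) \<le> m\<^sup>2 * (norm z)\<^sup>2 + 16 * (\<bar>e\<bar> * norm G)\<^sup>2"
        by (simp add: power2_diff power_mult_distrib algebra_simps)
      then have "\<bar>e\<bar> * (norm G * norm z) \<le> (m\<^sup>2 * (norm z)\<^sup>2 + 16 * (\<bar>e\<bar> * norm G)\<^sup>2) / (8 * m)"
        using m by (simp add: pos_le_divide_eq mult.commute)
      also have "\<dots> = m / 8 * (norm z)\<^sup>2 + 2 / m * (\<bar>e\<bar> * norm G)\<^sup>2"
        using m by (simp add: field_simps power2_eq_square)
      finally show ?thesis .
    qed
    also have "\<dots> \<le> m / 8 * (norm z)\<^sup>2 + 2 / a * (\<bar>e\<bar> * norm G)\<^sup>2"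
      using a by (intro add_left_mono mult_right_mono frac_le) auto
    finally show ?thesis by (simp add: power_mult_distrib power2_norm_eq_inner)
  qed
  moreover have "3 / 8 * a * (z \<bullet> z) \<le> 3 / 8 * m * (z \<bullet> z)"
    using a by (intro mult_right_mono) auto
  ultimately show ?thesis by (simp add: algebra_simps)
qed

text \<open>One species together with its steady profile \<open>cs\<close>, the steady field \<open>E\<close> and the current \<open>j\<close>.\<close>

locale ion_near_steady = ion_transport +
  fixes j lo a b :: real and cs \<Phi>s E :: "real \<Rightarrow> real"
  assumes \<sigma>: "\<bar>\<sigma>\<bar> = 1" and a: "0 < a" "a \<le> lo" "a \<le> b"
    and cs_C1: "C1 L (\<lambda>p. cs (p $ 1)) (\<lambda>p. (j - \<sigma> * cs (p $ 1) * E (p $ 1)) *\<^sub>R e1)"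
    and \<Phi>s_C1: "C1 L (\<lambda>p. \<Phi>s (p $ 1)) (\<lambda>p. E (p $ 1) *\<^sub>R e1)"
    and cs_cont: "continuous_on {0..L} cs" and \<Phi>s_cont: "continuous_on {0..L} \<Phi>s"
    and cs_bounds: "\<And>x. x \<in> {0..L} \<Longrightarrow> lo \<le> cs x \<and> cs x \<le> b"
    and matching: "\<And>t p. t > 0 \<Longrightarrow> p $ 1 = 0 \<or> p $ 1 = L \<Longrightarrow> c t p = cs (p $ 1) \<and> \<Phi> t p = \<Phi>s (p $ 1)"
begin

text \<open>The difference of the electrochemical potentials \<open>ln c + \<sigma> \<Phi>\<close> of the solution and of the steady state.\<close>

definition \<zeta> :: "real \<Rightarrow> real ^ 3 \<Rightarrow> real" where
  "\<zeta> t p = cutoff_ln a b (c t p) - cutoff_ln a b (cs (p $ 1)) + \<sigma> * (\<Phi> t p - \<Phi>s (p $ 1))"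

definition grad_\<zeta> :: "real \<Rightarrow> real ^ 3 \<Rightarrow> real ^ 3" where
  "grad_\<zeta> t p = (1 / cutoff a b (c t p)) *\<^sub>R grad (c t) p - (1 / cutoff a b (cs (p $ 1))) *\<^sub>R ((j - \<sigma> * cs (p $ 1) * E (p $ 1)) *\<^sub>R e1)
     + \<sigma> *\<^sub>R (grad (\<Phi> t) p - E (p $ 1) *\<^sub>R e1)"

lemma open_slab_x: "p \<in> open_slab L \<Longrightarrow> p $ 1 \<in> {0..L}"
  by (auto simp: open_slab_def)

lemma cs_pos: "x \<in> {0..L} \<Longrightarrow> 0 < cs x"
  using cs_bounds a by force

lemma cutoff_cs: "x \<in> {0..L} \<Longrightarrow> cutoff a b (cs x) = cs x"
  using cs_bounds[of x] a by (auto simp: cutoff_def)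

lemma \<Phi>_C1: "t > 0 \<Longrightarrow> C1 L (\<Phi> t) (grad (\<Phi> t))"
  by (rule spacetime_smooth_C1(1)[OF \<Phi>])

lemma \<Phi>_continuous: "t > 0 \<Longrightarrow> continuous_on (closed_slab L) (\<Phi> t)"
  by (rule spacetime_slice[OF spacetime_smooth_continuous[OF \<Phi>]])

lemma \<zeta>_C1: "t > 0 \<Longrightarrow> C1 L (\<zeta> t) (grad_\<zeta> t)"
  unfolding \<zeta>_def[abs_def] grad_\<zeta>_def[abs_def]
  by (intro C1_add C1_diff C1_cmult C1_compose[where g = "cutoff_ln a b"] c_C1 cs_C1 \<Phi>_C1 \<Phi>s_C1
      DERIV_cutoff_ln inverse_cutoff_continuous a)

lemma \<zeta>_vanishing: "t > 0 \<Longrightarrow> vanishing L (\<zeta> t)"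
proof -
  assume t: "t > 0"
  have "continuous_on (closed_slab L) (\<zeta> t)"
    unfolding \<zeta>_def[abs_def]
    by (intro continuous_intros continuous_on_compose2[OF cutoff_ln_continuous[OF a(1,3), of UNIV]]
        c_continuous \<Phi>_continuous continuous_on_x cs_cont \<Phi>s_cont t) auto
  then show ?thesis
    using matching[OF t] by (auto simp: vanishing_def \<zeta>_def)
qed

lemma grad_\<zeta>_eq:
  assumes "p \<in> open_slab L"
  shows "grad_\<zeta> t p = (1 / cutoff a b (c t p)) *\<^sub>R grad (c t) p + \<sigma> *\<^sub>R grad (\<Phi> t) p - (j / cs (p $ 1)) *\<^sub>R e1"
proof -
  have pos: "cs (p $ 1) > 0" by (rule cs_pos[OF open_slab_x[OF assms]])
  have "1 / cs (p $ 1) * (j - \<sigma> * cs (p $ 1) * E (p $ 1)) + \<sigma> * E (p $ 1) = j / cs (p $ 1)"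
    using pos by (simp add: field_simps)
  then have "(1 / cs (p $ 1)) *\<^sub>R ((j - \<sigma> * cs (p $ 1) * E (p $ 1)) *\<^sub>R e1) + \<sigma> *\<^sub>R (E (p $ 1) *\<^sub>R e1) = (j / cs (p $ 1)) *\<^sub>R e1"
    by (simp only: scaleR_scaleR scaleR_add_left[symmetric])
  then show ?thesis
    unfolding grad_\<zeta>_def cutoff_cs[OF open_slab_x[OF assms]]
    by (simp add: algebra_simps)
qed

text \<open>The flux is the mobility \<open>cutoff c\<close> times the gradient of the electrochemical potential, whose steady part is \<open>j / c\<^sup>*\<close>;
only the drift of the part that is cut off remains.\<close>

lemma flux_eq:
  assumes "p \<in> open_slab L"
  shows "flux t p = cutoff a b (c t p) *\<^sub>R (grad_\<zeta> t p + (j / cs (p $ 1)) *\<^sub>R e1)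
     + (\<sigma> * (c t p - cutoff a b (c t p))) *\<^sub>R grad (\<Phi> t) p"
  using cutoff_bounds(3)[OF a(1,3), of "c t p"]
  by (simp add: flux_def grad_\<zeta>_eq[OF assms] algebra_simps)

lemma flux_bcont: "t > 0 \<Longrightarrow> bcont L (flux t)"
  by (rule has_div_bcont[OF flux_has_div])

text \<open>Before the pointwise bound is integrated, \<open>j \<partial>\<^sub>x \<zeta>\<close>, whose integral is zero, is subtracted: this replaces
\<open>c / c\<^sup>*\<close> by \<open>(c - c\<^sup>*) / c\<^sup>*\<close> in the term with the current.\<close>

lemma dissipation:
  assumes t: "t > 0"
  shows "- cell_integral L (\<lambda>p. flux t p \<bullet> grad_\<zeta> t p) \<le>
    j\<^sup>2 / (2 * a * lo\<^sup>2) * cell_integral L (\<lambda>p. (c t p - cs (p $ 1))\<^sup>2)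
    + 2 / a * cell_integral L (\<lambda>p. (c t p - cutoff a b (c t p))\<^sup>2 * (grad (\<Phi> t) p \<bullet> grad (\<Phi> t) p))
    - 3 / 8 * a * cell_integral L (\<lambda>p. grad_\<zeta> t p \<bullet> grad_\<zeta> t p)"
proof -
  note bc = bcont_intros flux_bcont[OF t] C1_bcont_grad[OF \<zeta>_C1[OF t]] C1_bcont[OF c_C1[OF t]] C1_bcont[OF cs_C1]
    bcont_compose_UNIV[OF C1_bcont[OF c_C1[OF t]] cutoff_continuous] C1_bcont_grad[OF \<Phi>_C1[OF t]]
  have "cell_integral L (\<lambda>p. e1 \<bullet> grad_\<zeta> t p) = 0"
    by (rule cell_integral_normal_derivative_zero[OF L \<zeta>_C1[OF t] \<zeta>_vanishing[OF t]])
  then have "- cell_integral L (\<lambda>p. flux t p \<bullet> grad_\<zeta> t p) = j * cell_integral L (\<lambda>p. e1 \<bullet> grad_\<zeta> t p) - cell_integral L (\<lambda>p. flux t p \<bullet> grad_\<zeta> t p)"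
    by simp
  also have "\<dots> = cell_integral L (\<lambda>p. j * (e1 \<bullet> grad_\<zeta> t p) - flux t p \<bullet> grad_\<zeta> t p)"
    unfolding ci_cmult[symmetric] by (rule ci_diff[symmetric]) (intro bc)+
  also have "\<dots> \<le> cell_integral L (\<lambda>p. (j\<^sup>2 / (2 * a * lo\<^sup>2) * (c t p - cs (p $ 1))\<^sup>2
      + 2 / a * ((c t p - cutoff a b (c t p))\<^sup>2 * (grad (\<Phi> t) p \<bullet> grad (\<Phi> t) p))) - 3 / 8 * a * (grad_\<zeta> t p \<bullet> grad_\<zeta> t p))"
  proof (rule ci_mono)
    fix p assume "p \<in> cell L"
    then have p: "p \<in> open_slab L" by (rule cell_open_slab)
    note x = open_slab_x[OF p]
    let ?m = "cutoff a b (c t p)" and ?z = "grad_\<zeta> t p"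
    have "\<bar>?m - cs (p $ 1)\<bar> \<le> \<bar>c t p - cs (p $ 1)\<bar>"
      using cs_bounds[OF x] a by (auto simp: cutoff_def)
    from relative_flux_bound[OF a(1) cutoff_bounds(1)[OF a(1,3), of "c t p"] _ _ this \<sigma>, of lo j ?z "c t p - ?m" "grad (\<Phi> t) p"]
    have *: "j * ?z $ 1 - (?m * (?z \<bullet> ?z) + j * (?m / cs (p $ 1)) * ?z $ 1 + \<sigma> * (c t p - ?m) * (grad (\<Phi> t) p \<bullet> ?z))
      \<le> j\<^sup>2 / (2 * a * lo\<^sup>2) * (c t p - cs (p $ 1))\<^sup>2 + 2 / a * ((c t p - ?m)\<^sup>2 * (grad (\<Phi> t) p \<bullet> grad (\<Phi> t) p)) - 3 / 8 * a * (?z \<bullet> ?z)"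
      using cs_bounds[OF x] a by simp
    have "flux t p \<bullet> ?z = ?m * (?z \<bullet> ?z) + j * (?m / cs (p $ 1)) * ?z $ 1 + \<sigma> * (c t p - ?m) * (grad (\<Phi> t) p \<bullet> ?z)"
      unfolding flux_eq[OF p] by (simp add: inner_add_left inner_axis' algebra_simps)
    with * show "j * (e1 \<bullet> ?z) - flux t p \<bullet> ?z \<le> (j\<^sup>2 / (2 * a * lo\<^sup>2) * (c t p - cs (p $ 1))\<^sup>2
      + 2 / a * ((c t p - ?m)\<^sup>2 * (grad (\<Phi> t) p \<bullet> grad (\<Phi> t) p))) - 3 / 8 * a * (?z \<bullet> ?z)"
      by (simp add: inner_axis')
  qed (intro bc a)+
  also have "\<dots> = j\<^sup>2 / (2 * a * lo\<^sup>2) * cell_integral L (\<lambda>p. (c t p - cs (p $ 1))\<^sup>2)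
    + 2 / a * cell_integral L (\<lambda>p. (c t p - cutoff a b (c t p))\<^sup>2 * (grad (\<Phi> t) p \<bullet> grad (\<Phi> t) p))
    - 3 / 8 * a * cell_integral L (\<lambda>p. grad_\<zeta> t p \<bullet> grad_\<zeta> t p)"
    unfolding ci_cmult[symmetric]
    by (subst ci_diff, (intro bc a)+, subst ci_add, (intro bc a)+) (rule refl)
  finally show ?thesis .
qed

text \<open>The convective term is turned into \<open>c u \<bullet> \<nabla>\<zeta>\<close>. Its diffusive part is a gradient tested with a
solenoidal field and disappears; the field part is the work that the fluid does on the charges and cancels in
the total energy.\<close>

lemma entropy_production:
  assumes t: "t > 0"
  shows "cell_integral L (\<lambda>p. \<zeta> t p * deriv (\<lambda>s. c s p) t) =
    - Dc * cell_integral L (\<lambda>p. flux t p \<bullet> grad_\<zeta> t p)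
    + \<sigma> * cell_integral L (\<lambda>p. c t p * (u t p \<bullet> grad (\<Phi> t) p))
    - j * cell_integral L (\<lambda>p. (c t p - cs (p $ 1)) / cs (p $ 1) * u t p $ 1)"
proof -
  note ub = u_solenoidal[OF t] u_vanishing[OF t]
  have inv_cs: "bcont L (\<lambda>p. 1 / cs (p $ 1))"
  proof -
    have "bcont L (\<lambda>p. 1 / cutoff a b (cs (p $ 1)))"
      by (rule bcont_compose_UNIV[OF C1_bcont[OF cs_C1] inverse_cutoff_continuous[OF a(1,3)]])
    then show ?thesis
      by (rule bcont_cong[THEN iffD1, rotated]) (simp add: cutoff_cs[OF open_slab_x])
  qed
  note bc = bcont_intros C1_bcont[OF \<zeta>_C1[OF t]] C1_bcont_grad[OF \<zeta>_C1[OF t]] C1_bcont[OF c_C1[OF t]] C1_bcont[OF cs_C1]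
    C1_bcont_grad[OF c_C1[OF t]] C1_bcont_grad[OF \<Phi>_C1[OF t]] has_div_bcont[OF ub(1)] inv_cs
    bcont_compose_UNIV[OF C1_bcont[OF c_C1[OF t]] inverse_cutoff_continuous[OF a(1,3)]]
  have "cell_integral L (\<lambda>p. u t p \<bullet> (\<zeta> t p *\<^sub>R grad (c t) p + c t p *\<^sub>R grad_\<zeta> t p)) = 0"
    by (rule solenoidal_gradient_integral_zero[OF L ub C1_mult[OF \<zeta>_C1[OF t] c_C1[OF t]]])
  moreover have "cell_integral L (\<lambda>p. u t p \<bullet> (\<zeta> t p *\<^sub>R grad (c t) p + c t p *\<^sub>R grad_\<zeta> t p)) =
    cell_integral L (\<lambda>p. \<zeta> t p * (u t p \<bullet> grad (c t) p)) + cell_integral L (\<lambda>p. c t p * (u t p \<bullet> grad_\<zeta> t p))"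
    by (subst ci_add[symmetric]) (intro bc, intro bc, intro ci_cong, simp add: inner_add_right)
  ultimately have adv: "cell_integral L (\<lambda>p. \<zeta> t p * (u t p \<bullet> grad (c t) p)) = - cell_integral L (\<lambda>p. c t p * (u t p \<bullet> grad_\<zeta> t p))"
    by simp
  have zero1: "cell_integral L (\<lambda>p. u t p \<bullet> ((c t p * (1 / cutoff a b (c t p))) *\<^sub>R grad (c t) p)) = 0"
  proof -
    have cont: "continuous_on UNIV (\<lambda>s. s * (1 / cutoff a b s))"
      by (intro continuous_on_mult continuous_on_id inverse_cutoff_continuous a)
    then obtain H where "\<And>s. (H has_real_derivative s * (1 / cutoff a b s)) (at s)"
      by (rule antiderivative_exists) blast
    from solenoidal_gradient_integral_zero[OF L ub C1_compose[OF c_C1[OF t] this cont]]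
    show ?thesis .
  qed
  \<comment> \<open>The normal velocity is \<open>u \<bullet> \<nabla>x\<close>.\<close>
  have zero2: "cell_integral L (\<lambda>p. u t p $ 1) = 0"
  proof -
    have "C1 L (\<lambda>p. p $ 1) (\<lambda>p. 1 *\<^sub>R e1)"
      by (rule C1_of_x[where f = "\<lambda>x. x" and f' = "\<lambda>x. 1"]) (auto intro!: continuous_intros bounded_if_continuous)
    from solenoidal_gradient_integral_zero[OF L ub this] show ?thesis by (simp add: inner_axis)
  qed
  have "cell_integral L (\<lambda>p. c t p * (u t p \<bullet> grad_\<zeta> t p)) =
    cell_integral L (\<lambda>p. ((u t p \<bullet> ((c t p * (1 / cutoff a b (c t p))) *\<^sub>R grad (c t) p)
      + \<sigma> * (c t p * (u t p \<bullet> grad (\<Phi> t) p))) - j * ((c t p - cs (p $ 1)) * (1 / cs (p $ 1)) * u t p $ 1)) - j * u t p $ 1)"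
  proof (rule ci_cong)
    fix p assume p: "p \<in> open_slab L"
    have "j * (c t p / cs (p $ 1)) * u t p $ 1 = j * ((c t p - cs (p $ 1)) * (1 / cs (p $ 1)) * u t p $ 1) + j * u t p $ 1"
      using cs_pos[OF open_slab_x[OF p]] by (simp add: field_simps)
    then show "c t p * (u t p \<bullet> grad_\<zeta> t p) = ((u t p \<bullet> ((c t p * (1 / cutoff a b (c t p))) *\<^sub>R grad (c t) p)
      + \<sigma> * (c t p * (u t p \<bullet> grad (\<Phi> t) p))) - j * ((c t p - cs (p $ 1)) * (1 / cs (p $ 1)) * u t p $ 1)) - j * u t p $ 1"
      unfolding grad_\<zeta>_eq[OF p] by (simp add: inner_add_right inner_diff_right inner_axis algebra_simps)
  qed
  also have "\<dots> = ((0 + \<sigma> * cell_integral L (\<lambda>p. c t p * (u t p \<bullet> grad (\<Phi> t) p)))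
      - j * cell_integral L (\<lambda>p. (c t p - cs (p $ 1)) * (1 / cs (p $ 1)) * u t p $ 1)) - j * 0"
    by (subst ci_diff, (intro bc)+, subst ci_diff, (intro bc)+, subst ci_add, (intro bc)+)
      (simp only: ci_cmult zero1 zero2)
  finally show ?thesis
    unfolding weak_form[OF t \<zeta>_C1[OF t] \<zeta>_vanishing[OF t]] adv by simp
qed

lemma entropy_derivative:
  assumes t: "t > 0"
  shows "((\<lambda>t. cell_integral L (\<lambda>p. relative_entropy a b (c t p) (cs (p $ 1)))) has_real_derivative
    cell_integral L (\<lambda>p. (cutoff_ln a b (c t p) - cutoff_ln a b (cs (p $ 1))) * deriv (\<lambda>s. c s p) t)) (at t)"
proof -
  note ac = a(1,3)
  let ?k = "\<lambda>p. cutoff_ln a b (cs (p $ 1))"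
  let ?m = "\<lambda>p. cutoff_entropy a b (cs (p $ 1)) - ?k p * cs (p $ 1)"
  have k: "bcont L ?k" by (rule bcont_compose_UNIV[OF C1_bcont[OF cs_C1] cutoff_ln_continuous[OF ac]])
  have m: "bcont L ?m"
    by (intro bcont_intros k C1_bcont[OF cs_C1] bcont_compose_UNIV[OF C1_bcont[OF cs_C1] cutoff_entropy_continuous[OF ac]])
  have "(\<lambda>t. cell_integral L (\<lambda>p. cutoff_entropy a b (c t p) - ?k p * c t p - ?m p)) =
    (\<lambda>t. cell_integral L (\<lambda>p. relative_entropy a b (c t p) (cs (p $ 1))))"
    by (intro ext ci_cong) (simp add: relative_entropy_def[OF ac] algebra_simps)
  then show ?thesis
    using density_derivative[OF c t DERIV_cutoff_entropy[OF ac] cutoff_ln_continuous[OF ac] k m] by simp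
qed

end

section \<open>The Lyapunov functional\<close>

lemma ci_le_nonneg:
  assumes g: "bcont L g" and "\<And>p. p \<in> cell L \<Longrightarrow> 0 \<le> f p" "\<And>p. p \<in> cell L \<Longrightarrow> f p \<le> g p"
  shows "cell_integral L f \<le> cell_integral L g"
  unfolding cell_integral_def set_lebesgue_integral_def
proof (rule integral_mono')
  show "integrable lborel (\<lambda>p. indicator (cell L) p *\<^sub>R g p)"
    using bcont_integrable[OF g] by (simp add: set_integrable_def)
next
  show "indicator (cell L) p *\<^sub>R f p \<le> indicator (cell L) p *\<^sub>R g p" for p
    using assms(3)[of p] by (auto simp: indicator_def)
next
  show "0 \<le> indicator (cell L) p *\<^sub>R g p" for p
    using assms(2,3)[of p] by (auto simp: indicator_def)
qed

lemma psi_le: "0 \<le> s \<Longrightarrow> 0 \<le> psi s \<and> psi s \<le> (s - 1)\<^sup>2"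
proof (cases "s = 0")
  case False
  assume "0 \<le> s"
  with False have s: "s > 0" by simp
  have "s * ln s \<le> s * (s - 1)" using s ln_le_minus_one[of s] by (intro mult_left_mono) auto
  moreover have "s * (- ln s) \<le> s * (1 / s - 1)"
    using s ln_le_minus_one[of "1 / s"] by (intro mult_left_mono) (auto simp: ln_div)
  ultimately show ?thesis using s by (simp add: psi_def power2_eq_square algebra_simps)
qed (simp add: psi_def)

text \<open>Where the concentration is cut off at all, its distance to \<open>[lo, hi]\<close> is at least \<open>lo / 5\<close>, so
one power of the distance can be traded for two.\<close>

lemma cutoff_excess:
  fixes c lo hi :: real
  assumes "0 < lo" "lo \<le> hi"
  shows "(c - cutoff (4 / 5 * lo) (5 / 4 * hi) c)\<^sup>2 \<le> 25 / lo\<^sup>2 * (excess2 lo hi c)\<^sup>2"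
proof -
  have key: "x\<^sup>2 \<le> 25 / lo\<^sup>2 * (y\<^sup>2)\<^sup>2" if "0 \<le> x" "x \<le> y" "lo / 5 \<le> y" for x y :: real
  proof -
    \<comment> \<open>One factor \<open>y\<^sup>2 \<ge> lo\<^sup>2 / 25\<close> is inserted.\<close>
    have "lo\<^sup>2 \<le> 25 * y\<^sup>2"
      using power_mono[OF that(3), of 2] assms by (simp add: power_divide)
    then have "y\<^sup>2 * lo\<^sup>2 \<le> y\<^sup>2 * (25 * y\<^sup>2)" by (intro mult_left_mono) auto
    then have "y\<^sup>2 \<le> 25 / lo\<^sup>2 * (y\<^sup>2)\<^sup>2"
      using assms by (simp add: pos_le_divide_eq power2_eq_square mult.assoc)
    moreover have "x\<^sup>2 \<le> y\<^sup>2" using that by (intro power_mono) auto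
    ultimately show ?thesis by linarith
  qed
  consider "c < 4 / 5 * lo" | "5 / 4 * hi < c" | "4 / 5 * lo \<le> c" "c \<le> 5 / 4 * hi" by linarith
  then show ?thesis
  proof cases
    case 1
    then have "(c - cutoff (4 / 5 * lo) (5 / 4 * hi) c)\<^sup>2 = (4 / 5 * lo - c)\<^sup>2" "excess2 lo hi c = (lo - c)\<^sup>2"
      using assms by (auto simp: cutoff_def excess2_def max_def min_def power2_commute)
    then show ?thesis using key[of "4 / 5 * lo - c" "lo - c"] 1 assms by simp
  next
    case 2
    then have "(c - cutoff (4 / 5 * lo) (5 / 4 * hi) c)\<^sup>2 = (c - 5 / 4 * hi)\<^sup>2" "excess2 lo hi c = (c - hi)\<^sup>2"
      using assms by (auto simp: cutoff_def excess2_def max_def min_def)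
    then show ?thesis using key[of "c - 5 / 4 * hi" "c - hi"] 2 assms by simp
  next
    case 3
    then have "cutoff (4 / 5 * lo) (5 / 4 * hi) c = c" by (simp add: cutoff_def)
    then show ?thesis by simp
  qed
qed

lemma exponential_decay:
  fixes F :: "real \<Rightarrow> real"
  assumes D: "\<And>t. t \<ge> 1 \<Longrightarrow> \<exists>y. (F has_real_derivative y) (at t) \<and> y \<le> - \<kappa> * F t" and t: "t \<ge> 1"
  shows "F t \<le> F 1 * exp \<kappa> * exp (- \<kappa> * t)"
proof -
  have "F t * exp (\<kappa> * t) \<le> F 1 * exp (\<kappa> * 1)"
  proof (rule DERIV_nonpos_imp_nonincreasing[OF t])
    fix x :: real assume "1 \<le> x"
    from D[OF this] obtain y where y: "(F has_real_derivative y) (at x)" "y \<le> - \<kappa> * F x" by blast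
    have "((\<lambda>t. F t * exp (\<kappa> * t)) has_real_derivative (y + \<kappa> * F x) * exp (\<kappa> * x)) (at x)"
      using y(1) by (auto intro!: derivative_eq_intros simp: algebra_simps)
    moreover have "(y + \<kappa> * F x) * exp (\<kappa> * x) \<le> 0" using y(2) by (intro mult_nonpos_nonneg) auto
    ultimately show "\<exists>y. ((\<lambda>t. F t * exp (\<kappa> * t)) has_real_derivative y) (at x) \<and> y \<le> 0" by blast
  qed
  then have "F t * exp (\<kappa> * t) * exp (- \<kappa> * t) \<le> F 1 * exp \<kappa> * exp (- \<kappa> * t)"
    by (intro mult_right_mono) auto
  then show ?thesis by (simp add: mult.assoc flip: exp_add)
qed

text \<open>The smallness of the currents is stated in the form in which it is used: by \<open>small1\<close> and \<open>small2\<close> the coefficients of the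
deviations in the entropy production are at most a multiple of \<open>D lo / (L\<^sup>2 hi\<^sup>2)\<close>.\<close>

locale nps_near_steady =
  nps_flow L D1 D2 \<epsilon> \<nu> K \<alpha>1 \<alpha>2 \<beta>1 \<beta>2 V c10 c20 u0 c1 c2 u \<Phi> pr +
  steady: steady_fields L \<epsilon> lo hi j1 j2 cs1 cs2 \<Phi>s E
  for L D1 D2 \<epsilon> \<nu> K \<alpha>1 \<alpha>2 \<beta>1 \<beta>2 V c10 c20 u0 c1 c2 u \<Phi> pr lo hi j1 j2 cs1 cs2 \<Phi>s E +
  fixes D :: real
  assumes steady_ends: "cs1 0 = \<alpha>1" "cs1 L = \<beta>1" "cs2 0 = \<alpha>2" "cs2 L = \<beta>2" "\<Phi>s 0 = - V" "\<Phi>s L = 0"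
    and D: "D > 0" "D \<le> D1" "D \<le> D2"
    and small1: "j1\<^sup>2 * (D1 / (2 * lo ^ 3) + K * L\<^sup>2 / (\<nu> * lo\<^sup>2)) \<le> D * lo / (2 * L\<^sup>2 * hi\<^sup>2)"
    and small2: "j2\<^sup>2 * (D2 / (2 * lo ^ 3) + K * L\<^sup>2 / (\<nu> * lo\<^sup>2)) \<le> D * lo / (2 * L\<^sup>2 * hi\<^sup>2)"
begin

text \<open>The factor \<open>5/4\<close> in both cut-off levels loses \<open>(5/4)\<^sup>4 < 5/2\<close> in total, which the
Poincare constant \<open>L\<^sup>2 / 4\<close> makes affordable.\<close>

definition ca :: real where "ca = 4 / 5 * lo"
definition cb :: real where "cb = 5 / 4 * hi"

lemma lo: "0 < lo" and lo_hi: "lo \<le> hi" and cutoffs: "0 < ca" "ca \<le> lo" "ca \<le> cb"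
  using steady.lo steady.lo_le_hi by (auto simp: ca_def cb_def)

lemma cs_bounds: "x \<in> {0..L} \<Longrightarrow> cs1 x \<in> {lo..hi} \<and> cs2 x \<in> {lo..hi}"
  using steady.steady_bounds by blast

sublocale near1: ion_near_steady L D1 1 c1 u \<Phi> j1 lo ca cb cs1 \<Phi>s E
proof
  show "C1 L (\<lambda>p. cs1 (p $ 1)) (\<lambda>p. (j1 - 1 * cs1 (p $ 1) * E (p $ 1)) *\<^sub>R e1)"
    using steady.cs1_C1 by simp
  show "c1 t p = cs1 (p $ 1) \<and> \<Phi> t p = \<Phi>s (p $ 1)" if "t > 0" "p $ 1 = 0 \<or> p $ 1 = L" for t p
    using bdry that L unfolding nps_boundary_def steady_ends[symmetric] by auto
  show "lo \<le> cs1 x \<and> cs1 x \<le> cb" if "x \<in> {0..L}" for x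
    using cs_bounds[OF that] lo lo_hi by (auto simp: cb_def)
qed (use cutoffs steady.\<Phi>s_C1 steady.cs1_cont steady.\<Phi>s_cont in auto)

sublocale near2: ion_near_steady L D2 "-1" c2 u \<Phi> j2 lo ca cb cs2 \<Phi>s E
proof
  show "C1 L (\<lambda>p. cs2 (p $ 1)) (\<lambda>p. (j2 - -1 * cs2 (p $ 1) * E (p $ 1)) *\<^sub>R e1)"
    using steady.cs2_C1 by simp
  show "c2 t p = cs2 (p $ 1) \<and> \<Phi> t p = \<Phi>s (p $ 1)" if "t > 0" "p $ 1 = 0 \<or> p $ 1 = L" for t p
    using bdry that L unfolding nps_boundary_def steady_ends[symmetric] by auto
  show "lo \<le> cs2 x \<and> cs2 x \<le> cb" if "x \<in> {0..L}" for x
    using cs_bounds[OF that] lo lo_hi by (auto simp: cb_def)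
qed (use cutoffs steady.\<Phi>s_C1 steady.cs2_cont steady.\<Phi>s_cont in auto)

definition \<phi> where "\<phi> t p = \<Phi> t p - \<Phi>s (p $ 1)"
definition grad_\<phi> where "grad_\<phi> t p = grad (\<Phi> t) p - E (p $ 1) *\<^sub>R e1"
definition d1 where "d1 t p = c1 t p - cs1 (p $ 1)"
definition d2 where "d2 t p = c2 t p - cs2 (p $ 1)"

definition deviation where
  "deviation t = cell_integral L (\<lambda>p. (d1 t p)\<^sup>2) + cell_integral L (\<lambda>p. (d2 t p)\<^sup>2)"
definition field_energy where
  "field_energy t = cell_integral L (\<lambda>p. grad_\<phi> t p \<bullet> grad_\<phi> t p)"
definition kinetic where
  "kinetic t = (\<Sum>i\<in>UNIV. cell_integral L (\<lambda>p. (u t p $ i)\<^sup>2))"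
definition viscous where
  "viscous t = (\<Sum>i\<in>UNIV. cell_integral L (\<lambda>p. grad (\<lambda>q. u t q $ i) p \<bullet> grad (\<lambda>q. u t q $ i) p))"
definition ionic where
  "ionic t = cell_integral L (\<lambda>p. near1.grad_\<zeta> t p \<bullet> near1.grad_\<zeta> t p) + cell_integral L (\<lambda>p. near2.grad_\<zeta> t p \<bullet> near2.grad_\<zeta> t p)"
definition excess_energy where
  "excess_energy t = cell_integral L (\<lambda>p. excess2 lo hi (c1 t p) * (grad (c1 t) p \<bullet> grad (c1 t) p)) +
     cell_integral L (\<lambda>p. excess2 lo hi (c2 t p) * (grad (c2 t) p \<bullet> grad (c2 t) p))"
definition entropy where
  "entropy t = cell_integral L (\<lambda>p. relative_entropy ca cb (c1 t p) (cs1 (p $ 1))) +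
     cell_integral L (\<lambda>p. relative_entropy ca cb (c2 t p) (cs2 (p $ 1))) + \<epsilon> / 2 * field_energy t + kinetic t / (2 * K)"

lemma \<phi>_C1: "t > 0 \<Longrightarrow> C1 L (\<phi> t) (grad_\<phi> t)"
  unfolding \<phi>_def[abs_def] grad_\<phi>_def[abs_def] by (intro C1_diff near1.\<Phi>_C1 steady.\<Phi>s_C1)

lemma \<phi>_vanishing: "t > 0 \<Longrightarrow> vanishing L (\<phi> t)"
  unfolding vanishing_def \<phi>_def[abs_def]
  using near1.matching
  by (auto intro!: continuous_intros near1.\<Phi>_continuous continuous_on_x steady.\<Phi>s_cont)

lemma grad_\<phi>_has_div: "t > 0 \<Longrightarrow> has_div L (grad_\<phi> t) (\<lambda>p. - (d1 t p - d2 t p) / \<epsilon>)"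
  unfolding grad_\<phi>_def[abs_def]
  by (rule has_div_cong[OF has_div_diff[OF potential_has_div steady.E_has_div]])
    (auto simp: d1_def d2_def diff_divide_distrib)

lemma d1_C1: "t > 0 \<Longrightarrow> C1 L (d1 t) (\<lambda>p. grad (c1 t) p - (j1 - cs1 (p $ 1) * E (p $ 1)) *\<^sub>R e1)"
  unfolding d1_def[abs_def] by (intro C1_diff ion1.c_C1 steady.cs1_C1)

lemma d2_C1: "t > 0 \<Longrightarrow> C1 L (d2 t) (\<lambda>p. grad (c2 t) p - (j2 + cs2 (p $ 1) * E (p $ 1)) *\<^sub>R e1)"
  unfolding d2_def[abs_def] by (intro C1_diff ion2.c_C1 steady.cs2_C1)

lemma bconts:
  assumes t: "t > 0"
  shows "bcont L (d1 t)" "bcont L (d2 t)" "bcont L (\<phi> t)" "bcont L (grad_\<phi> t)" "bcont L (u t)"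
    "bcont L (near1.\<zeta> t)" "bcont L (near1.grad_\<zeta> t)" "bcont L (near2.\<zeta> t)" "bcont L (near2.grad_\<zeta> t)"
    "bcont L (c1 t)" "bcont L (c2 t)" "bcont L (grad (\<Phi> t))" "bcont L (grad (c1 t))" "bcont L (grad (c2 t))"
  using C1_bcont[OF d1_C1[OF t]] C1_bcont[OF d2_C1[OF t]] C1_bcont[OF \<phi>_C1[OF t]] C1_bcont_grad[OF \<phi>_C1[OF t]]
    has_div_bcont[OF ion1.u_solenoidal[OF t]] C1_bcont[OF near1.\<zeta>_C1[OF t]] C1_bcont_grad[OF near1.\<zeta>_C1[OF t]]
    C1_bcont[OF near2.\<zeta>_C1[OF t]] C1_bcont_grad[OF near2.\<zeta>_C1[OF t]]
    C1_bcont[OF ion1.c_C1[OF t]] C1_bcont[OF ion2.c_C1[OF t]] C1_bcont_grad[OF near1.\<Phi>_C1[OF t]]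
    C1_bcont_grad[OF ion1.c_C1[OF t]] C1_bcont_grad[OF ion2.c_C1[OF t]]
  by auto

text \<open>Sum \<open>d\<^sub>i \<zeta>\<^sub>i\<close> over the species. The logarithmic parts give at least \<open>d\<^sub>i\<^sup>2 / cb\<close>, since \<open>cutoff_ln\<close> has slope at
least \<open>1 / cb\<close>; the electric parts combine to \<open>(d1 - d2) \<phi>\<close>, whose integral is \<open>\<epsilon>\<close> times the field energy. Then apply
Young's and Poincare's inequalities.\<close>

lemma coercivity:
  assumes t: "t > 0"
  shows "deviation t / (2 * cb) + \<epsilon> * field_energy t \<le> cb * L\<^sup>2 / 8 * ionic t"
proof -
  note bc = bcont_intros bconts[OF t]
  have cb: "cb > 0" using cutoffs by simp
  have "\<epsilon> * field_energy t = cell_integral L (\<lambda>p. \<phi> t p * (d1 t p - d2 t p))"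
  proof -
    \<comment> \<open>The Poisson equation for \<open>\<phi>\<close>, tested with \<open>\<phi>\<close> itself.\<close>
    have "field_energy t = - cell_integral L (\<lambda>p. \<phi> t p * (- (d1 t p - d2 t p) / \<epsilon>))"
      using integration_by_parts[OF L grad_\<phi>_has_div[OF t] \<phi>_C1[OF t] \<phi>_vanishing[OF t]]
      by (simp add: field_energy_def)
    also have "\<dots> = cell_integral L (\<lambda>p. 1 / \<epsilon> * (\<phi> t p * (d1 t p - d2 t p)))"
      unfolding ci_minus[symmetric] by (intro ci_cong) (simp add: minus_divide_left[symmetric] algebra_simps diff_divide_distrib)
    finally show ?thesis using \<epsilon> by (simp only: ci_cmult) simp
  qed
  moreover have "deviation t / cb = cell_integral L (\<lambda>p. 1 / cb * ((d1 t p)\<^sup>2 + (d2 t p)\<^sup>2))"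
    unfolding ci_cmult deviation_def by (subst ci_add) (intro bc, intro bc, simp)
  ultimately have "deviation t / cb + \<epsilon> * field_energy t =
      cell_integral L (\<lambda>p. 1 / cb * ((d1 t p)\<^sup>2 + (d2 t p)\<^sup>2) + \<phi> t p * (d1 t p - d2 t p))"
    by (subst ci_add) (intro bc, intro bc, simp)
  also have "\<dots> \<le> cell_integral L (\<lambda>p. 1 / (2 * cb) * ((d1 t p)\<^sup>2 + (d2 t p)\<^sup>2) + cb / 2 * ((near1.\<zeta> t p)\<^sup>2 + (near2.\<zeta> t p)\<^sup>2))"
  proof (rule ci_mono)
    fix p
    have young: "d * z \<le> 1 / (2 * cb) * d\<^sup>2 + cb / 2 * z\<^sup>2" for d z
    proof -
      have "0 \<le> (d - cb * z)\<^sup>2 / (2 * cb)" using cb by simp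
      also have "\<dots> = 1 / (2 * cb) * d\<^sup>2 + cb / 2 * z\<^sup>2 - d * z"
        using cb by (simp add: power2_diff power2_eq_square field_simps)
      finally show ?thesis by simp
    qed
    have "1 / cb * (d1 t p)\<^sup>2 + \<phi> t p * d1 t p \<le> d1 t p * near1.\<zeta> t p"
      using cutoff_ln_monotone[OF cutoffs(1,3), of "c1 t p" "cs1 (p $ 1)"]
      by (simp add: d1_def near1.\<zeta>_def \<phi>_def algebra_simps)
    moreover have "1 / cb * (d2 t p)\<^sup>2 - \<phi> t p * d2 t p \<le> d2 t p * near2.\<zeta> t p"
      using cutoff_ln_monotone[OF cutoffs(1,3), of "c2 t p" "cs2 (p $ 1)"]
      by (simp add: d2_def near2.\<zeta>_def \<phi>_def algebra_simps)
    ultimately show "1 / cb * ((d1 t p)\<^sup>2 + (d2 t p)\<^sup>2) + \<phi> t p * (d1 t p - d2 t p) \<le>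
      1 / (2 * cb) * ((d1 t p)\<^sup>2 + (d2 t p)\<^sup>2) + cb / 2 * ((near1.\<zeta> t p)\<^sup>2 + (near2.\<zeta> t p)\<^sup>2)"
      using young[of "d1 t p" "near1.\<zeta> t p"] young[of "d2 t p" "near2.\<zeta> t p"]
      by (simp only: distrib_left right_diff_distrib)
  qed (intro bc)+
  also have "\<dots> = deviation t / (2 * cb) + cb / 2 * (cell_integral L (\<lambda>p. (near1.\<zeta> t p)\<^sup>2) + cell_integral L (\<lambda>p. (near2.\<zeta> t p)\<^sup>2))"
    unfolding deviation_def
    by (subst ci_add, (intro bc)+, simp only: ci_cmult, subst ci_add, (intro bc)+, subst ci_add, (intro bc)+) simp
  also have "cell_integral L (\<lambda>p. (near1.\<zeta> t p)\<^sup>2) + cell_integral L (\<lambda>p. (near2.\<zeta> t p)\<^sup>2) \<le> L\<^sup>2 / 4 * ionic t"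
  proof -
    have comp: "cell_integral L (\<lambda>p. (g p $ 1)\<^sup>2) \<le> cell_integral L (\<lambda>p. g p \<bullet> g p)" if "bcont L g" for g :: "real ^ 3 \<Rightarrow> real ^ 3"
      by (rule ci_mono) (auto intro!: bcont_intros that simp: inner_vec_def sum_3 power2_eq_square)
    have "cell_integral L (\<lambda>p. (near1.\<zeta> t p)\<^sup>2) \<le> L\<^sup>2 / 4 * cell_integral L (\<lambda>p. near1.grad_\<zeta> t p \<bullet> near1.grad_\<zeta> t p)"
      by (rule order_trans[OF poincare[OF L near1.\<zeta>_C1[OF t] near1.\<zeta>_vanishing[OF t]]])
        (intro mult_left_mono comp bconts t, simp)
    moreover have "cell_integral L (\<lambda>p. (near2.\<zeta> t p)\<^sup>2) \<le> L\<^sup>2 / 4 * cell_integral L (\<lambda>p. near2.grad_\<zeta> t p \<bullet> near2.grad_\<zeta> t p)"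
      by (rule order_trans[OF poincare[OF L near2.\<zeta>_C1[OF t] near2.\<zeta>_vanishing[OF t]]])
        (intro mult_left_mono comp bconts t, simp)
    ultimately show ?thesis unfolding ionic_def distrib_left by (rule add_mono)
  qed
  finally have "deviation t / cb + \<epsilon> * field_energy t \<le> deviation t / (2 * cb) + cb / 2 * (L\<^sup>2 / 4 * ionic t)"
    using cb by (simp add: mult_left_mono)
  moreover have "deviation t / cb = deviation t / (2 * cb) + deviation t / (2 * cb)"
    by simp
  moreover have "cb / 2 * (L\<^sup>2 / 4 * ionic t) = cb * L\<^sup>2 / 8 * ionic t"
    by simp
  ultimately show ?thesis by linarith
qed

text \<open>A polarized form of \<open>d/dt (\<epsilon>/2) \<integral> |\<nabla>\<phi>|\<^sup>2 = \<integral> \<phi> \<partial>\<^sub>t \<rho>\<close>. Comparing two times avoids interchanging the time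
derivative with the gradient of the potential.\<close>

lemma field_energy_increment:
  assumes s: "s > 0" and t: "t > 0"
  shows "\<epsilon> / 2 * field_energy s = \<epsilon> / 2 * field_energy t +
    cell_integral L (\<lambda>p. 1 / 2 * ((\<phi> s p + \<phi> t p) * ((c1 s p - c2 s p) - (c1 t p - c2 t p))))"
proof -
  note bc = bcont_intros bconts[OF t] bconts[OF s]
  have "field_energy s - field_energy t = cell_integral L (\<lambda>p. (grad_\<phi> s p - grad_\<phi> t p) \<bullet> (grad_\<phi> s p + grad_\<phi> t p))"
    unfolding field_energy_def
    by (subst ci_diff[symmetric]) (intro bc, intro bc, intro ci_cong, simp add: inner_diff_left inner_diff_right inner_add_right inner_add_left inner_commute)
  also have "\<dots> = - cell_integral L (\<lambda>p. (\<phi> s p + \<phi> t p) * (- (d1 s p - d2 s p) / \<epsilon> - - (d1 t p - d2 t p) / \<epsilon>))"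
    using integration_by_parts[OF L has_div_diff[OF grad_\<phi>_has_div[OF s] grad_\<phi>_has_div[OF t]]
        C1_add[OF \<phi>_C1[OF s] \<phi>_C1[OF t]] vanishing_add[OF \<phi>_vanishing[OF s] \<phi>_vanishing[OF t]]] by simp
  also have "\<dots> = cell_integral L (\<lambda>p. 2 / \<epsilon> * (1 / 2 * ((\<phi> s p + \<phi> t p) * ((c1 s p - c2 s p) - (c1 t p - c2 t p)))))"
    unfolding ci_minus[symmetric]
    by (intro ci_cong) (use \<epsilon> in \<open>simp add: d1_def d2_def field_simps\<close>)
  finally show ?thesis using \<epsilon> by (simp only: ci_cmult) (simp add: field_simps)
qed

lemma field_energy_derivative:
  assumes t: "t > 0"
  shows "((\<lambda>t. \<epsilon> / 2 * field_energy t) has_real_derivative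
    cell_integral L (\<lambda>p. \<phi> t p * (deriv (\<lambda>s. c1 s p) t - deriv (\<lambda>s. c2 s p) t))) (at t)"
proof -
  have bound: "\<exists>B. \<forall>s\<in>{t/2..2*t}. \<forall>p\<in>closed_cell L. \<bar>f s p\<bar> \<le> B \<and> \<bar>deriv (\<lambda>s. f s p) s\<bar> \<le> B" if f: "spacetime_smooth L f" for f
  proof -
    have "0 < t / 2" using t by simp
    then obtain B1 B2 where "\<forall>s\<in>{t/2..2*t}. \<forall>p\<in>closed_cell L. \<bar>f s p\<bar> \<le> B1"
      "\<forall>s\<in>{t/2..2*t}. \<forall>p\<in>closed_cell L. \<bar>deriv (\<lambda>s. f s p) s\<bar> \<le> B2"
      using spacetime_locally_bounded[OF spacetime_smooth_continuous[OF f], of "t/2" "2*t"]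
        spacetime_smooth_time_derivative(3)[OF f, of "t/2" "2*t"] by metis
    then show ?thesis by (intro exI[of _ "max B1 B2"]) (simp add: le_max_iff_disj)
  qed
  obtain B1 B2 B3 where B:
    "\<forall>s\<in>{t/2..2*t}. \<forall>p\<in>closed_cell L. \<bar>c1 s p\<bar> \<le> B1 \<and> \<bar>deriv (\<lambda>s. c1 s p) s\<bar> \<le> B1"
    "\<forall>s\<in>{t/2..2*t}. \<forall>p\<in>closed_cell L. \<bar>c2 s p\<bar> \<le> B2 \<and> \<bar>deriv (\<lambda>s. c2 s p) s\<bar> \<le> B2"
    "\<forall>s\<in>{t/2..2*t}. \<forall>p\<in>closed_cell L. \<bar>\<Phi> s p\<bar> \<le> B3 \<and> \<bar>deriv (\<lambda>s. \<Phi> s p) s\<bar> \<le> B3"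
    using bound[OF smooth(1)] bound[OF smooth(2)] bound[OF smooth(4)] by metis
  obtain B4 where B4: "\<And>p. p \<in> closed_cell L \<Longrightarrow> \<bar>\<Phi>s (p $ 1)\<bar> \<le> B4"
    using C1_bcont[OF steady.\<Phi>s_C1] unfolding bcont_def bounded_iff real_norm_def by blast
  \<comment> \<open>The increment of \<open>field_energy_increment\<close>; its derivative is needed at \<open>s = t\<close> only.\<close>
  define F where "F s p = 1 / 2 * ((\<phi> s p + \<phi> t p) * ((c1 s p - c2 s p) - (c1 t p - c2 t p)))" for s p
  define F' where "F' s p = 1 / 2 * (deriv (\<lambda>s. \<Phi> s p) s * ((c1 s p - c2 s p) - (c1 t p - c2 t p))
      + (\<phi> s p + \<phi> t p) * (deriv (\<lambda>s. c1 s p) s - deriv (\<lambda>s. c2 s p) s))" for s p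
  have "((\<lambda>s. cell_integral L (F s)) has_real_derivative cell_integral L (F' t)) (at t)"
  proof (rule cell_integral_has_derivative[where a = "t/2" and b = "2*t" and
        B = "1 / 2 * (B3 * (2 * (B1 + B2)) + (2 * (B3 + B4)) * (B1 + B2))"])
    fix s p assume s: "t / 2 < s" "s < 2 * t" and p: "p \<in> cell L"
    then have s0: "s > 0" and p2: "p \<in> closed_cell L" and s2: "s \<in> {t/2..2*t}" and t2: "t \<in> {t/2..2*t}"
      using t cell_subset_closed_cell by auto
    note D = spacetime_smooth_time_derivative(1)[OF _ s0 cell_open_slab[OF p]]
    show "((\<lambda>s. F s p) has_real_derivative F' s p) (at s)"
      unfolding F_def F'_def \<phi>_def
      by (rule DERIV_cong[OF DERIV_cmult[OF DERIV_mult[OF DERIV_add[OF DERIV_diff[OF D[OF smooth(4)] DERIV_const] DERIV_const]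
              DERIV_diff[OF DERIV_diff[OF D[OF smooth(1)] D[OF smooth(2)]] DERIV_const]]]]) simp
    have b: "\<bar>c1 s p\<bar> \<le> B1" "\<bar>c2 s p\<bar> \<le> B2" "\<bar>c1 t p\<bar> \<le> B1" "\<bar>c2 t p\<bar> \<le> B2" "\<bar>\<Phi> s p\<bar> \<le> B3" "\<bar>\<Phi> t p\<bar> \<le> B3"
      "\<bar>deriv (\<lambda>s. c1 s p) s\<bar> \<le> B1" "\<bar>deriv (\<lambda>s. c2 s p) s\<bar> \<le> B2" "\<bar>deriv (\<lambda>s. \<Phi> s p) s\<bar> \<le> B3" "\<bar>\<Phi>s (p $ 1)\<bar> \<le> B4"
      using B s2 t2 p2 B4 by blast+
    have e: "\<bar>(c1 s p - c2 s p) - (c1 t p - c2 t p)\<bar> \<le> 2 * (B1 + B2)"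
      "\<bar>\<phi> s p + \<phi> t p\<bar> \<le> 2 * (B3 + B4)" "\<bar>deriv (\<lambda>s. c1 s p) s - deriv (\<lambda>s. c2 s p) s\<bar> \<le> B1 + B2"
      unfolding \<phi>_def using b unfolding abs_le_iff by auto
    have "\<bar>deriv (\<lambda>s. \<Phi> s p) s * ((c1 s p - c2 s p) - (c1 t p - c2 t p))\<bar> \<le> B3 * (2 * (B1 + B2))"
      unfolding abs_mult by (rule mult_mono[OF b(9) e(1) order_trans[OF abs_ge_zero b(9)] abs_ge_zero])
    moreover have "\<bar>(\<phi> s p + \<phi> t p) * (deriv (\<lambda>s. c1 s p) s - deriv (\<lambda>s. c2 s p) s)\<bar> \<le> (2 * (B3 + B4)) * (B1 + B2)"
      unfolding abs_mult by (rule mult_mono[OF e(2,3) order_trans[OF abs_ge_zero e(2)] abs_ge_zero])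
    moreover have "\<bar>1 / 2 * (x + y)\<bar> \<le> 1 / 2 * (X + Y)" if "\<bar>x\<bar> \<le> X" "\<bar>y\<bar> \<le> Y" for x y X Y :: real
      using that by (simp add: abs_le_iff)
    ultimately show "\<bar>F' s p\<bar> \<le> 1 / 2 * (B3 * (2 * (B1 + B2)) + (2 * (B3 + B4)) * (B1 + B2))"
      unfolding F'_def by blast
  next
    fix s assume "t / 2 < s" "s < 2 * t"
    with t have "s > 0" by simp
    then show "bcont L (F s)"
      unfolding F_def by (intro bcont_intros bconts t)
  next
    show "bcont L (F' t)"
      unfolding F'_def by (intro bcont_intros bconts t spacetime_smooth_time_derivative(2) smooth)
  qed (use t in auto)
  moreover have "cell_integral L (F' t) = cell_integral L (\<lambda>p. \<phi> t p * (deriv (\<lambda>s. c1 s p) t - deriv (\<lambda>s. c2 s p) t))"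
    by (intro ci_cong) (simp add: F'_def)
  ultimately have "((\<lambda>s. cell_integral L (F s)) has_real_derivative
      cell_integral L (\<lambda>p. \<phi> t p * (deriv (\<lambda>s. c1 s p) t - deriv (\<lambda>s. c2 s p) t))) (at t)"
    by (simp only:)
  from DERIV_add[OF DERIV_const this, of "\<epsilon> / 2 * field_energy t"]
  have "((\<lambda>s. \<epsilon> / 2 * field_energy t + cell_integral L (F s)) has_real_derivative
      cell_integral L (\<lambda>p. \<phi> t p * (deriv (\<lambda>s. c1 s p) t - deriv (\<lambda>s. c2 s p) t))) (at t)"
    by (simp only: add_0)
  then show ?thesis
  proof (rule has_field_derivative_transform_within_open[where S = "{0<..}"])
    show "\<epsilon> / 2 * field_energy t + cell_integral L (F s) = \<epsilon> / 2 * field_energy s" if "s \<in> {0<..}" for s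
      unfolding F_def[abs_def] by (rule field_energy_increment[symmetric]) (use that t in auto)
  qed (use t in auto)
qed

lemma u_component_C1: "t > 0 \<Longrightarrow> C1 L (\<lambda>p. u t p $ i) (grad (\<lambda>q. u t q $ i))"
  by (rule spacetime_smooth_C1(1)[OF spacetime_smooth_component[OF smooth(3)]])

lemma u_component_vanishing: "t > 0 \<Longrightarrow> vanishing L (\<lambda>p. u t p $ i)"
  using boundary_values(4) by (auto simp: vanishing_def intro!: continuous_intros ion1.u_continuous)

lemma kinetic_derivative:
  assumes t: "t > 0"
  shows "(kinetic has_real_derivative
    2 * (- \<nu> * viscous t - K * cell_integral L (\<lambda>p. (c1 t p - c2 t p) * (u t p \<bullet> grad (\<Phi> t) p)))) (at t)"
proof -
  note bc = bcont_intros bconts[OF t]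
  let ?lap = "\<lambda>i. laplace (\<lambda>q. u t q $ i)"
  have lap: "has_div L (grad (\<lambda>q. u t q $ i)) (?lap i)" for i
    by (rule spacetime_smooth_C1(2)[OF spacetime_smooth_component[OF smooth(3)] t])
  have dt: "bcont L (\<lambda>p. deriv (\<lambda>s. u s p $ i) t)" for i
    by (rule spacetime_smooth_time_derivative(2)[OF spacetime_smooth_component[OF smooth(3)] t])
  have pr: "C1 L (pr t) (grad (pr t))" by (rule spacetime_smooth_C1(1)[OF smooth(5) t])
  note bc = bc dt has_div_bcont_div[OF lap] C1_bcont_grad[OF pr]
  have sq: "((\<lambda>s::real. s\<^sup>2) has_real_derivative 2 * s) (at s)" for s
    by (auto intro!: derivative_eq_intros)
  have "((\<lambda>t. cell_integral L (\<lambda>p. (u t p $ i)\<^sup>2)) has_real_derivative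
      2 * cell_integral L (\<lambda>p. u t p $ i * deriv (\<lambda>s. u s p $ i) t)) (at t)" for i
    using density_derivative[OF spacetime_smooth_component[OF smooth(3)] t sq _ bcont_const[of L 0] bcont_const[of L 0]]
    by (simp add: continuous_intros mult.assoc ci_cmult)
  then have "((\<lambda>t. kinetic t) has_real_derivative
      (\<Sum>i\<in>UNIV. 2 * cell_integral L (\<lambda>p. u t p $ i * deriv (\<lambda>s. u s p $ i) t))) (at t)"
    unfolding kinetic_def by (intro DERIV_sum)
  moreover have "(\<Sum>i\<in>UNIV. cell_integral L (\<lambda>p. u t p $ i * deriv (\<lambda>s. u s p $ i) t)) =
    - \<nu> * viscous t - K * cell_integral L (\<lambda>p. (c1 t p - c2 t p) * (u t p \<bullet> grad (\<Phi> t) p))"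
  proof -
    have "(\<Sum>i\<in>UNIV. cell_integral L (\<lambda>p. u t p $ i * deriv (\<lambda>s. u s p $ i) t)) =
      cell_integral L (\<lambda>p. \<Sum>i\<in>UNIV. u t p $ i * deriv (\<lambda>s. u s p $ i) t)"
      by (rule ci_sum[symmetric]) (intro bc)
    also have "\<dots> = cell_integral L (\<lambda>p. (\<nu> * (\<Sum>i\<in>UNIV. u t p $ i * ?lap i p) - u t p \<bullet> grad (pr t) p)
        - K * ((c1 t p - c2 t p) * (u t p \<bullet> grad (\<Phi> t) p)))"
    proof (rule ci_cong)
      fix p assume p: "p \<in> open_slab L"
      have *: "deriv (\<lambda>s. u s p $ i) t = \<nu> * ?lap i p - grad (pr t) p $ i - K * (c1 t p - c2 t p) * grad (\<Phi> t) p $ i" for i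
      proof -
        have "vector_derivative (\<lambda>s. u s p) (at t) - \<nu> *\<^sub>R vlaplace (u t) p + grad (pr t) p
          = - (K * (c1 t p - c2 t p)) *\<^sub>R grad (\<Phi> t) p"
          using eqs t p by (auto simp: nps_equations_def)
        from arg_cong[OF this, of "\<lambda>v. v $ i"] show ?thesis
          by (simp add: vector_derivative_component[OF smooth(3) t p, symmetric] vlaplace_def algebra_simps)
      qed
      have "u t p $ i * deriv (\<lambda>s. u s p $ i) t = \<nu> * (u t p $ i * ?lap i p) - u t p $ i * grad (pr t) p $ i
          - K * ((c1 t p - c2 t p) * (u t p $ i * grad (\<Phi> t) p $ i))" for i
        unfolding * by (simp add: algebra_simps)
      then show "(\<Sum>i\<in>UNIV. u t p $ i * deriv (\<lambda>s. u s p $ i) t) = (\<nu> * (\<Sum>i\<in>UNIV. u t p $ i * ?lap i p) - u t p \<bullet> grad (pr t) p)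
        - K * ((c1 t p - c2 t p) * (u t p \<bullet> grad (\<Phi> t) p))"
        by (simp add: inner_vec_def sum_subtractf sum_distrib_left)
    qed
    also have "\<dots> = (\<nu> * (\<Sum>i\<in>UNIV. cell_integral L (\<lambda>p. u t p $ i * ?lap i p)) - cell_integral L (\<lambda>p. u t p \<bullet> grad (pr t) p))
        - K * cell_integral L (\<lambda>p. (c1 t p - c2 t p) * (u t p \<bullet> grad (\<Phi> t) p))"
      by (subst ci_diff, (intro bc)+, subst ci_diff, (intro bc)+, simp only: ci_cmult, subst ci_sum, (intro bc)+) (rule refl)
    also have "cell_integral L (\<lambda>p. u t p \<bullet> grad (pr t) p) = 0"
      by (rule solenoidal_gradient_integral_zero[OF L ion1.u_solenoidal[OF t] ion1.u_vanishing[OF t] pr])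
    also have "(\<Sum>i\<in>UNIV. cell_integral L (\<lambda>p. u t p $ i * ?lap i p)) = - viscous t"
      unfolding viscous_def sum_negf[symmetric]
      by (intro sum.cong refl integration_by_parts[OF L lap u_component_C1[OF t] u_component_vanishing[OF t]])
    finally show ?thesis by simp
  qed
  ultimately show ?thesis by (simp only: sum_distrib_left[symmetric])
qed

lemma velocity_poincare:
  assumes t: "t > 0"
  shows "cell_integral L (\<lambda>p. (u t p $ i)\<^sup>2) \<le> L\<^sup>2 / 4 * cell_integral L (\<lambda>p. grad (\<lambda>q. u t q $ i) p \<bullet> grad (\<lambda>q. u t q $ i) p)"
proof -
  have "cell_integral L (\<lambda>p. (grad (\<lambda>q. u t q $ i) p $ 1)\<^sup>2) \<le> cell_integral L (\<lambda>p. grad (\<lambda>q. u t q $ i) p \<bullet> grad (\<lambda>q. u t q $ i) p)"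
    by (rule ci_mono) (auto intro!: bcont_intros C1_bcont_grad[OF u_component_C1[OF t]] simp: inner_vec_def sum_3 power2_eq_square)
  then show ?thesis
    using poincare[OF L u_component_C1[OF t] u_component_vanishing[OF t], of i]
    by (meson mult_left_mono order_trans zero_le_divide_iff zero_le_numeral zero_le_power2)
qed

lemma kinetic_le: "t > 0 \<Longrightarrow> kinetic t \<le> L\<^sup>2 / 4 * viscous t"
  unfolding kinetic_def viscous_def sum_distrib_left by (intro sum_mono velocity_poincare)

lemma normal_velocity_le: "t > 0 \<Longrightarrow> cell_integral L (\<lambda>p. (u t p $ 1)\<^sup>2) \<le> L\<^sup>2 / 4 * viscous t"
proof -
  assume t: "t > 0"
  have "cell_integral L (\<lambda>p. grad (\<lambda>q. u t q $ 1) p \<bullet> grad (\<lambda>q. u t q $ 1) p) \<le> viscous t"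
    unfolding viscous_def sum_3 by (simp add: ci_nonneg)
  then show ?thesis
    using velocity_poincare[OF t, of 1]
    by (meson mult_left_mono order_trans zero_le_divide_iff zero_le_numeral zero_le_power2)
qed

end

context nps_near_steady begin

definition dissipation_rate where
  "dissipation_rate t = D * lo / 20 * ionic t + \<nu> / (2 * K) * viscous t"

definition residual where
  "residual t = cell_integral L (\<lambda>p. (c1 t p - cutoff ca cb (c1 t p))\<^sup>2 * (grad (\<Phi> t) p \<bullet> grad (\<Phi> t) p)) +
     cell_integral L (\<lambda>p. (c2 t p - cutoff ca cb (c2 t p))\<^sup>2 * (grad (\<Phi> t) p \<bullet> grad (\<Phi> t) p))"

text \<open>The coefficients of the energies in \<open>entropy\<close> are chosen such that the time derivatives combine to
the pairings with \<open>\<zeta>\<^sub>i\<close> and the electric work \<open>\<integral> (c1 - c2) u \<bullet> \<nabla>\<Phi>\<close> cancels.\<close>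

lemma entropy_identity:
  assumes t: "t > 0"
  shows "(entropy has_real_derivative
    - D1 * cell_integral L (\<lambda>p. ion1.flux t p \<bullet> near1.grad_\<zeta> t p) - D2 * cell_integral L (\<lambda>p. ion2.flux t p \<bullet> near2.grad_\<zeta> t p)
    - j1 * cell_integral L (\<lambda>p. d1 t p / cs1 (p $ 1) * u t p $ 1) - j2 * cell_integral L (\<lambda>p. d2 t p / cs2 (p $ 1) * u t p $ 1)
    - \<nu> / K * viscous t) (at t)"
proof -
  note dt = spacetime_smooth_time_derivative(2)[OF smooth(1) t] spacetime_smooth_time_derivative(2)[OF smooth(2) t]
  have ln: "bcont L (\<lambda>p. cutoff_ln ca cb (c1 t p) - cutoff_ln ca cb (cs1 (p $ 1)))"
     "bcont L (\<lambda>p. cutoff_ln ca cb (c2 t p) - cutoff_ln ca cb (cs2 (p $ 1)))"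
    by (intro bcont_diff bcont_compose_UNIV[OF _ cutoff_ln_continuous[OF cutoffs(1,3)]] bconts t
      C1_bcont[OF steady.cs1_C1] C1_bcont[OF steady.cs2_C1])+
  note bc = bcont_intros bconts[OF t] dt ln
  let ?I1 = "cell_integral L (\<lambda>p. (cutoff_ln ca cb (c1 t p) - cutoff_ln ca cb (cs1 (p $ 1))) * deriv (\<lambda>s. c1 s p) t)"
  let ?I2 = "cell_integral L (\<lambda>p. (cutoff_ln ca cb (c2 t p) - cutoff_ln ca cb (cs2 (p $ 1))) * deriv (\<lambda>s. c2 s p) t)"
  let ?W = "cell_integral L (\<lambda>p. \<phi> t p * (deriv (\<lambda>s. c1 s p) t - deriv (\<lambda>s. c2 s p) t))"
  let ?P = "cell_integral L (\<lambda>p. (c1 t p - c2 t p) * (u t p \<bullet> grad (\<Phi> t) p))"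
  let ?P1 = "cell_integral L (\<lambda>p. c1 t p * (u t p \<bullet> grad (\<Phi> t) p))" and ?P2 = "cell_integral L (\<lambda>p. c2 t p * (u t p \<bullet> grad (\<Phi> t) p))"
  have "(entropy has_real_derivative ?I1 + ?I2 + ?W + 2 * (- \<nu> * viscous t - K * ?P) / (2 * K)) (at t)"
    unfolding entropy_def[abs_def]
    by (intro DERIV_add DERIV_cdivide near1.entropy_derivative near2.entropy_derivative field_energy_derivative kinetic_derivative t)
  moreover have "?I1 + ?I2 + ?W = cell_integral L (\<lambda>p. near1.\<zeta> t p * deriv (\<lambda>s. c1 s p) t) + cell_integral L (\<lambda>p. near2.\<zeta> t p * deriv (\<lambda>s. c2 s p) t)"
  proof -
    have "?I1 + ?I2 + ?W = cell_integral L (\<lambda>p. (cutoff_ln ca cb (c1 t p) - cutoff_ln ca cb (cs1 (p $ 1))) * deriv (\<lambda>s. c1 s p) t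
       + (cutoff_ln ca cb (c2 t p) - cutoff_ln ca cb (cs2 (p $ 1))) * deriv (\<lambda>s. c2 s p) t + \<phi> t p * (deriv (\<lambda>s. c1 s p) t - deriv (\<lambda>s. c2 s p) t))"
      by (subst ci_add, (intro bc)+, subst ci_add, (intro bc)+) (rule refl)
    also have "\<dots> = cell_integral L (\<lambda>p. near1.\<zeta> t p * deriv (\<lambda>s. c1 s p) t + near2.\<zeta> t p * deriv (\<lambda>s. c2 s p) t)"
      by (intro ci_cong) (simp add: near1.\<zeta>_def near2.\<zeta>_def \<phi>_def algebra_simps)
    also have "\<dots> = cell_integral L (\<lambda>p. near1.\<zeta> t p * deriv (\<lambda>s. c1 s p) t) + cell_integral L (\<lambda>p. near2.\<zeta> t p * deriv (\<lambda>s. c2 s p) t)"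
      by (rule ci_add) (intro bc)+
    finally show ?thesis .
  qed
  moreover have "?P = ?P1 - ?P2"
    by (subst ci_diff[symmetric]) (intro bc, intro bc, intro ci_cong, simp add: left_diff_distrib)
  moreover have "2 * (- \<nu> * x - K * y) / (2 * K) = - \<nu> / K * x - y" for x y
    using K by (simp add: field_simps)
  ultimately show ?thesis
    using near1.entropy_production[OF t] near2.entropy_production[OF t]
    by (auto simp only: d1_def d2_def elim!: DERIV_cong)
qed

text \<open>The weight \<open>k = \<nu> / (K L\<^sup>2)\<close> in Young's inequality makes the velocity terms of the two species together
cost half of the viscous dissipation.\<close>

lemma drift_bound:
  assumes t: "t > 0" and cs: "\<And>p. p \<in> cell L \<Longrightarrow> lo \<le> cs (p $ 1)"
    and d: "bcont L d" and dcs: "bcont L (\<lambda>p. d p / cs (p $ 1) * u t p $ 1)"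
  shows "- j * cell_integral L (\<lambda>p. d p / cs (p $ 1) * u t p $ 1)
    \<le> j\<^sup>2 * K * L\<^sup>2 / (4 * \<nu> * lo\<^sup>2) * cell_integral L (\<lambda>p. (d p)\<^sup>2) + \<nu> / (4 * K) * viscous t"
proof -
  note bc = bcont_intros bconts[OF t] d dcs
  define k where "k = \<nu> / (K * L\<^sup>2)"
  have k: "k > 0" using \<nu> K L by (simp add: k_def)
  have "- j * cell_integral L (\<lambda>p. d p / cs (p $ 1) * u t p $ 1) = cell_integral L (\<lambda>p. - j * (d p / cs (p $ 1) * u t p $ 1))"
    by (simp only: ci_cmult)
  also have "\<dots> \<le> cell_integral L (\<lambda>p. j\<^sup>2 / (4 * k * lo\<^sup>2) * (d p)\<^sup>2 + k * (u t p $ 1)\<^sup>2)"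
  proof (rule ci_mono)
    fix p assume p: "p \<in> cell L"
    have pos: "0 < cs (p $ 1)" using cs[OF p] lo by linarith
    define q where "q = j * d p / cs (p $ 1)"
    have "0 \<le> (2 * k * u t p $ 1 + q)\<^sup>2 / (4 * k)" using k by simp
    also have "\<dots> = k * (u t p $ 1)\<^sup>2 + q * u t p $ 1 + q\<^sup>2 / (4 * k)"
      using k by (simp add: power2_sum power_mult_distrib field_simps) (simp add: power2_eq_square)
    finally have "- j * (d p / cs (p $ 1) * u t p $ 1) \<le> q\<^sup>2 / (4 * k) + k * (u t p $ 1)\<^sup>2"
      by (simp add: q_def)
    also have "q\<^sup>2 \<le> (j * d p)\<^sup>2 / lo\<^sup>2"
      unfolding q_def power_divide using cs[OF p] lo by (intro divide_left_mono power_mono mult_pos_pos) (auto simp: pos)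
    also have "(j * d p)\<^sup>2 / lo\<^sup>2 / (4 * k) = j\<^sup>2 / (4 * k * lo\<^sup>2) * (d p)\<^sup>2"
      by (simp add: power_mult_distrib)
    finally show "- j * (d p / cs (p $ 1) * u t p $ 1) \<le> j\<^sup>2 / (4 * k * lo\<^sup>2) * (d p)\<^sup>2 + k * (u t p $ 1)\<^sup>2"
      using k by (simp add: divide_right_mono)
  qed (intro bc)+
  also have "\<dots> = j\<^sup>2 / (4 * k * lo\<^sup>2) * cell_integral L (\<lambda>p. (d p)\<^sup>2) + k * cell_integral L (\<lambda>p. (u t p $ 1)\<^sup>2)"
    by (subst ci_add) (intro bc, intro bc, simp only: ci_cmult)
  also have "k * cell_integral L (\<lambda>p. (u t p $ 1)\<^sup>2) \<le> k * (L\<^sup>2 / 4 * viscous t)"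
    using k by (intro mult_left_mono normal_velocity_le t) auto
  also have "k * (L\<^sup>2 / 4 * viscous t) = \<nu> / (4 * K) * viscous t"
    using L by (simp add: k_def)
  also have "j\<^sup>2 / (4 * k * lo\<^sup>2) = j\<^sup>2 * K * L\<^sup>2 / (4 * \<nu> * lo\<^sup>2)"
    by (simp add: k_def)
  finally show ?thesis by simp
qed

lemma coefficient_bound:
  assumes small: "j\<^sup>2 * (Di / (2 * lo ^ 3) + K * L\<^sup>2 / (\<nu> * lo\<^sup>2)) \<le> D * lo / (2 * L\<^sup>2 * hi\<^sup>2)" and Di: "Di > 0"
  shows "Di * (j\<^sup>2 / (2 * ca * lo\<^sup>2)) + j\<^sup>2 * K * L\<^sup>2 / (4 * \<nu> * lo\<^sup>2) \<le> 5 / 8 * (D * lo / (L\<^sup>2 * hi\<^sup>2))"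
proof -
  have "Di * (j\<^sup>2 / (2 * ca * lo\<^sup>2)) = 5 / 4 * (j\<^sup>2 * (Di / (2 * lo ^ 3)))"
    using lo by (simp add: ca_def field_simps power2_eq_square power3_eq_cube)
  moreover have "j\<^sup>2 * K * L\<^sup>2 / (4 * \<nu> * lo\<^sup>2) \<le> 5 / 4 * (j\<^sup>2 * (K * L\<^sup>2 / (\<nu> * lo\<^sup>2)))"
  proof -
    have "0 \<le> j\<^sup>2 * (K * L\<^sup>2 / (\<nu> * lo\<^sup>2))" using K \<nu> by simp
    moreover have "j\<^sup>2 * K * L\<^sup>2 / (4 * \<nu> * lo\<^sup>2) = 1 / 4 * (j\<^sup>2 * (K * L\<^sup>2 / (\<nu> * lo\<^sup>2)))" by simp
    ultimately show ?thesis by linarith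
  qed
  moreover have "D * lo / (2 * L\<^sup>2 * hi\<^sup>2) = 1 / 2 * (D * lo / (L\<^sup>2 * hi\<^sup>2))" by simp
  ultimately show ?thesis using small by (simp only: distrib_left)
qed

lemma ci_inner_nonneg: "0 \<le> cell_integral L (\<lambda>p. f p \<bullet> f p)"
  by (intro ci_nonneg) simp

text \<open>The deviation terms cost at most \<open>125/512\<close> of \<open>D * lo * ionic\<close>, while the ionic dissipation
provides \<open>3/10\<close> of it; the difference exceeds \<open>1/20\<close>.\<close>

lemma entropy_decay:
  assumes t: "t > 0"
  obtains y where "(entropy has_real_derivative y) (at t)"
    "y \<le> 2 * (D1 + D2) / ca * residual t - dissipation_rate t"
proof -
  let ?N1 = "cell_integral L (\<lambda>p. (d1 t p)\<^sup>2)" and ?N2 = "cell_integral L (\<lambda>p. (d2 t p)\<^sup>2)"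
  let ?Z1 = "cell_integral L (\<lambda>p. near1.grad_\<zeta> t p \<bullet> near1.grad_\<zeta> t p)" and ?Z2 = "cell_integral L (\<lambda>p. near2.grad_\<zeta> t p \<bullet> near2.grad_\<zeta> t p)"
  let ?R1 = "cell_integral L (\<lambda>p. (c1 t p - cutoff ca cb (c1 t p))\<^sup>2 * (grad (\<Phi> t) p \<bullet> grad (\<Phi> t) p))"
  let ?R2 = "cell_integral L (\<lambda>p. (c2 t p - cutoff ca cb (c2 t p))\<^sup>2 * (grad (\<Phi> t) p \<bullet> grad (\<Phi> t) p))"
  let ?\<beta> = "5 / 8 * (D * lo / (L\<^sup>2 * hi\<^sup>2))"
  have N: "0 \<le> ?N1" "0 \<le> ?N2" by (auto intro!: ci_nonneg)
  have Z: "0 \<le> ?Z1" "0 \<le> ?Z2" by (auto intro!: ci_nonneg)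
  have R: "0 \<le> ?R1" "0 \<le> ?R2" by (auto intro!: ci_nonneg)
  have hi: "0 < hi" and ca: "0 < ca" using lo lo_hi cutoffs by auto
  have csb: "lo \<le> cs1 (p $ 1)" "lo \<le> cs2 (p $ 1)" if "p \<in> cell L" for p
    using cs_bounds[of "p $ 1"] that by (auto simp: cell_def)
  have inv: "bcont L (\<lambda>p. d p / cs (p $ 1) * u t p $ 1)"
    if d: "bcont L d" and cs: "bcont L (\<lambda>p. cs (p $ 1))" and b: "\<And>x. x \<in> {0..L} \<Longrightarrow> lo \<le> cs x \<and> cs x \<le> cb" for d cs
  proof -
    have "bcont L (\<lambda>p. d p * (1 / cutoff ca cb (cs (p $ 1))) * u t p $ 1)"
      by (intro bcont_mult d bcont_component bconts t bcont_compose_UNIV[OF cs inverse_cutoff_continuous[OF cutoffs(1,3)]])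
    then show ?thesis
    proof (rule bcont_cong[THEN iffD1, rotated])
      fix p assume "p \<in> open_slab L"
      then have "p $ 1 \<in> {0..L}" by (auto simp: open_slab_def)
      from b[OF this] have "cutoff ca cb (cs (p $ 1)) = cs (p $ 1)"
        using cutoffs by (simp add: cutoff_def)
      then show "d p * (1 / cutoff ca cb (cs (p $ 1))) * u t p $ 1 = d p / cs (p $ 1) * u t p $ 1" by simp
    qed
  qed
  have F: "- j1 * cell_integral L (\<lambda>p. d1 t p / cs1 (p $ 1) * u t p $ 1) \<le> j1\<^sup>2 * K * L\<^sup>2 / (4 * \<nu> * lo\<^sup>2) * ?N1 + \<nu> / (4 * K) * viscous t"
     "- j2 * cell_integral L (\<lambda>p. d2 t p / cs2 (p $ 1) * u t p $ 1) \<le> j2\<^sup>2 * K * L\<^sup>2 / (4 * \<nu> * lo\<^sup>2) * ?N2 + \<nu> / (4 * K) * viscous t"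
    by (intro drift_bound t csb bconts inv C1_bcont[OF steady.cs1_C1] C1_bcont[OF steady.cs2_C1] near1.cs_bounds near2.cs_bounds; assumption)+
  have diss: "- Di * X \<le> Di * (j\<^sup>2 / (2 * ca * lo\<^sup>2)) * N + 2 * (D1 + D2) / ca * R - 3 / 10 * (D * lo) * Zi"
    if "- X \<le> j\<^sup>2 / (2 * ca * lo\<^sup>2) * N + 2 / ca * R - 3 / 8 * ca * Zi" "0 < Di" "D \<le> Di" "Di \<le> D1 + D2" "0 \<le> R" "0 \<le> Zi" for Di X j N R Zi
  proof -
    have "Di * - X \<le> Di * (j\<^sup>2 / (2 * ca * lo\<^sup>2) * N + 2 / ca * R - 3 / 8 * ca * Zi)"
      using that by (intro mult_left_mono) auto
    also have "\<dots> = Di * (j\<^sup>2 / (2 * ca * lo\<^sup>2)) * N + Di * (2 / ca * R) - Di * (3 / 8 * ca * Zi)"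
      by (simp add: algebra_simps)
    also have "\<dots> \<le> Di * (j\<^sup>2 / (2 * ca * lo\<^sup>2)) * N + (D1 + D2) * (2 / ca * R) - D * (3 / 8 * ca * Zi)"
      using that ca by (intro diff_mono add_left_mono mult_right_mono) auto
    also have "(D1 + D2) * (2 / ca * R) = 2 * (D1 + D2) / ca * R" by simp
    also have "D * (3 / 8 * ca * Zi) = 3 / 10 * (D * lo) * Zi" by (simp add: ca_def)
    finally show ?thesis by simp
  qed
  have D1': "- D1 * cell_integral L (\<lambda>p. ion1.flux t p \<bullet> near1.grad_\<zeta> t p) \<le>
      D1 * (j1\<^sup>2 / (2 * ca * lo\<^sup>2)) * ?N1 + 2 * (D1 + D2) / ca * ?R1 - 3 / 10 * (D * lo) * ?Z1"
    by (rule diss[OF near1.dissipation[OF t, folded d1_def]]) (use D D1 D2 R Z in auto)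
  have D2': "- D2 * cell_integral L (\<lambda>p. ion2.flux t p \<bullet> near2.grad_\<zeta> t p) \<le>
      D2 * (j2\<^sup>2 / (2 * ca * lo\<^sup>2)) * ?N2 + 2 * (D1 + D2) / ca * ?R2 - 3 / 10 * (D * lo) * ?Z2"
    by (rule diss[OF near2.dissipation[OF t, folded d2_def]]) (use D D1 D2 R Z in auto)
  have C1: "(D1 * (j1\<^sup>2 / (2 * ca * lo\<^sup>2)) + j1\<^sup>2 * K * L\<^sup>2 / (4 * \<nu> * lo\<^sup>2)) * ?N1 \<le> ?\<beta> * ?N1"
    by (intro mult_right_mono coefficient_bound small1 D1 N)
  have C2: "(D2 * (j2\<^sup>2 / (2 * ca * lo\<^sup>2)) + j2\<^sup>2 * K * L\<^sup>2 / (4 * \<nu> * lo\<^sup>2)) * ?N2 \<le> ?\<beta> * ?N2"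
    by (intro mult_right_mono coefficient_bound small2 D2 N)
  have dev: "?\<beta> * deviation t \<le> 125 / 512 * (D * lo) * ionic t"
  proof -
    have "0 \<le> \<epsilon> * field_energy t"
      unfolding field_energy_def using \<epsilon> by (intro mult_nonneg_nonneg ci_inner_nonneg) simp
    then have "deviation t / (2 * cb) \<le> cb * L\<^sup>2 / 8 * ionic t" using coercivity[OF t] by linarith
    then have "deviation t \<le> cb\<^sup>2 * L\<^sup>2 / 4 * ionic t"
      using hi by (simp add: cb_def field_simps power2_eq_square)
    then have "?\<beta> * deviation t \<le> ?\<beta> * (cb\<^sup>2 * L\<^sup>2 / 4 * ionic t)"
      using D lo by (intro mult_left_mono) auto
    also have "\<dots> = 125 / 512 * (D * lo) * ionic t"
      using L hi by (simp add: cb_def power_mult_distrib power_divide)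
    finally show ?thesis .
  qed
  have "0 \<le> D * lo * ionic t" using D lo Z by (simp add: ionic_def)
  then have margin: "125 / 512 * (D * lo) * ionic t - 3 / 10 * (D * lo) * ionic t \<le> - (D * lo / 20 * ionic t)"
    by simp
  have "2 * (D1 + D2) / ca * residual t = 2 * (D1 + D2) / ca * ?R1 + 2 * (D1 + D2) / ca * ?R2"
    by (simp only: residual_def distrib_left)
  moreover have "3 / 10 * (D * lo) * ionic t = 3 / 10 * (D * lo) * ?Z1 + 3 / 10 * (D * lo) * ?Z2"
    by (simp only: ionic_def distrib_left)
  moreover have "?\<beta> * deviation t = ?\<beta> * ?N1 + ?\<beta> * ?N2"
    by (simp only: deviation_def distrib_left)
  moreover have "\<nu> / K * viscous t = \<nu> / (4 * K) * viscous t + \<nu> / (4 * K) * viscous t + \<nu> / (2 * K) * viscous t"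
    by simp
  ultimately have "- D1 * cell_integral L (\<lambda>p. ion1.flux t p \<bullet> near1.grad_\<zeta> t p) - D2 * cell_integral L (\<lambda>p. ion2.flux t p \<bullet> near2.grad_\<zeta> t p)
    - j1 * cell_integral L (\<lambda>p. d1 t p / cs1 (p $ 1) * u t p $ 1) - j2 * cell_integral L (\<lambda>p. d2 t p / cs2 (p $ 1) * u t p $ 1)
    - \<nu> / K * viscous t \<le> 2 * (D1 + D2) / ca * residual t - dissipation_rate t"
    using F D1' D2' C1 C2 dev margin unfolding dissipation_rate_def distrib_right[of _ _ ?N1] distrib_right[of _ _ ?N2]
    by linarith
  then show thesis using that[OF entropy_identity[OF t]] by blast
qed

lemma boundary_between: "t > 0 \<Longrightarrow> p $ 1 = 0 \<or> p $ 1 = L \<Longrightarrow> lo \<le> c1 t p \<and> c1 t p \<le> hi \<and> lo \<le> c2 t p \<and> c2 t p \<le> hi"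
  using near1.matching near2.matching steady.ends by auto

lemma residual_le:
  obtains C where "C \<ge> 0" "\<And>t. t > 0 \<Longrightarrow> residual t \<le> C * excess_energy t"
proof -
  obtain M where M: "M > 0" "\<And>t p. t > 0 \<Longrightarrow> p \<in> cell L \<Longrightarrow> c1 t p \<le> M \<and> c2 t p \<le> M"
    by (rule upper_bound) blast
  obtain P where P: "P > 0" "\<And>t p. t > 0 \<Longrightarrow> p \<in> cell L \<Longrightarrow> \<bar>\<Phi> t p\<bar> \<le> P"
    by (rule potential_bounded[OF M(2)]) blast+
  \<comment> \<open>\<open>M / \<epsilon>\<close> bounds the Laplacian of the potential, since both concentrations lie in \<open>[0, M]\<close>.\<close>
  define C where "C = 16 * P\<^sup>2 + 2 * P * (M / \<epsilon>) * L\<^sup>2"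
  have C: "C \<ge> 0" using P M \<epsilon> by (simp add: C_def)
  have one: "cell_integral L (\<lambda>p. (c p - cutoff ca cb (c p))\<^sup>2 * (grad (\<Phi> t) p \<bullet> grad (\<Phi> t) p)) \<le>
     25 / lo\<^sup>2 * C * cell_integral L (\<lambda>p. excess2 lo hi (c p) * (g p \<bullet> g p))"
    if t: "t > 0" and c: "C1 L c g" "continuous_on (closed_slab L) c"
      and bd: "\<And>p. p $ 1 = 0 \<or> p $ 1 = L \<Longrightarrow> lo \<le> c p \<and> c p \<le> hi" for t c g
  proof -
    note bc = bcont_intros bconts[OF t] C1_bcont[OF c(1)] bcont_excess2[OF C1_bcont[OF c(1)]]
      bcont_compose_UNIV[OF C1_bcont[OF c(1)] cutoff_continuous[OF cutoffs(1,3)]]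
    have "cell_integral L (\<lambda>p. (c p - cutoff ca cb (c p))\<^sup>2 * (grad (\<Phi> t) p \<bullet> grad (\<Phi> t) p)) \<le>
      cell_integral L (\<lambda>p. 25 / lo\<^sup>2 * ((excess2 lo hi (c p))\<^sup>2 * (grad (\<Phi> t) p \<bullet> grad (\<Phi> t) p)))"
    proof (rule ci_mono)
      fix p
      show "(c p - cutoff ca cb (c p))\<^sup>2 * (grad (\<Phi> t) p \<bullet> grad (\<Phi> t) p) \<le> 25 / lo\<^sup>2 * ((excess2 lo hi (c p))\<^sup>2 * (grad (\<Phi> t) p \<bullet> grad (\<Phi> t) p))"
        using mult_right_mono[OF cutoff_excess[OF lo lo_hi, of "c p"], of "grad (\<Phi> t) p \<bullet> grad (\<Phi> t) p"]
        unfolding ca_def cb_def by (simp only: mult.assoc inner_ge_zero)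
    qed (intro bc)+
    also have "\<dots> = 25 / lo\<^sup>2 * cell_integral L (\<lambda>p. (excess2 lo hi (c p))\<^sup>2 * (grad (\<Phi> t) p \<bullet> grad (\<Phi> t) p))"
      by (rule ci_cmult)
    also have "\<dots> \<le> 25 / lo\<^sup>2 * (C * cell_integral L (\<lambda>p. excess2 lo hi (c p) * (g p \<bullet> g p)))"
      unfolding C_def
    proof (intro mult_left_mono excess_field_energy[OF L near1.\<Phi>_C1[OF t] potential_has_div[OF t] near1.\<Phi>_continuous[OF t] c lo_hi bd P(2)[OF t]])
      fix p assume p: "p \<in> cell L"
      have "\<bar>c1 t p - c2 t p\<bar> \<le> M" using M(2)[OF t p] nonnegative[OF t p] by auto
      then have "\<bar>c1 t p - c2 t p\<bar> / \<epsilon> \<le> M / \<epsilon>" using \<epsilon> by (intro divide_right_mono) auto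
      then show "\<bar>- (c1 t p - c2 t p) / \<epsilon>\<bar> \<le> M / \<epsilon>"
        using \<epsilon> by (simp add: abs_minus_commute)
    qed (use P M \<epsilon> in auto)
    finally show ?thesis by (simp add: mult.assoc)
  qed
  have "residual t \<le> 25 / lo\<^sup>2 * C * excess_energy t" if t: "t > 0" for t
    unfolding residual_def excess_energy_def distrib_left
    by (intro add_mono one t ion1.c_C1 ion2.c_C1 ion1.c_continuous ion2.c_continuous)
      (use boundary_between[OF t] in auto)
  moreover have "25 / lo\<^sup>2 * C \<ge> 0" using C by simp
  ultimately show thesis by (intro that)
qed

definition excess_functional where
  "excess_functional t = cell_integral L (\<lambda>p. 1 / 4 * (excess2 lo hi (c1 t p))\<^sup>2) / D1 + cell_integral L (\<lambda>p. 1 / 4 * (excess2 lo hi (c2 t p))\<^sup>2) / D2"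

lemma excess_decay:
  assumes t: "t > 0"
  obtains y where "(excess_functional has_real_derivative y) (at t)" "y \<le> - 3 * excess_energy t"
proof -
  interpret snap: electrostatics L \<epsilon> "c1 t" "c2 t" "grad (c1 t)" "grad (c2 t)" "grad (\<Phi> t)"
    by (rule snapshot[OF t])
  let ?X1 = "cell_integral L (\<lambda>p. ion1.flux t p \<bullet> ((3 * excess2 lo hi (c1 t p)) *\<^sub>R grad (c1 t) p))"
  let ?X2 = "cell_integral L (\<lambda>p. ion2.flux t p \<bullet> ((3 * excess2 lo hi (c2 t p)) *\<^sub>R grad (c2 t) p))"
  have \<eta>: "((\<lambda>s. 1 / 4 * (excess2 lo hi s)\<^sup>2) has_real_derivative excess3 lo hi s) (at s)" for s
    using DERIV_cmult[OF DERIV_excess4[OF lo_hi], of "1/4"] by simp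
  have zero: "excess3 lo hi (c1 t p) = 0" "excess3 lo hi (c2 t p) = 0" if "p $ 1 = 0 \<or> p $ 1 = L" for p
    using boundary_between[OF t that] excess_inside by auto
  have cont: "continuous_on UNIV (\<lambda>s. 3 * excess2 lo hi s)" by (intro continuous_intros excess2_continuous)
  have der: "(excess_functional has_real_derivative - D1 * ?X1 / D1 + - D2 * ?X2 / D2) (at t)"
    unfolding excess_functional_def[abs_def]
    by (intro DERIV_add DERIV_cdivide ion1.functional_derivative[OF t \<eta> DERIV_excess3 cont zero(1)]
        ion2.functional_derivative[OF t \<eta> DERIV_excess3 cont zero(2)])
  have fl: "ion1.flux t = (\<lambda>p. grad (c1 t) p + c1 t p *\<^sub>R grad (\<Phi> t) p)"
    "ion2.flux t = (\<lambda>p. grad (c2 t) p - c2 t p *\<^sub>R grad (\<Phi> t) p)"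
    by (auto simp: ion1.flux_def ion2.flux_def)
  have "3 * excess_energy t \<le> ?X1 + ?X2"
    unfolding excess_energy_def fl
    by (rule snap.excess_dissipation) (use lo lo_hi boundary_between[OF t] nonnegative[OF t] in auto)
  moreover have "- D1 * x / D1 + - D2 * y / D2 = - (x + y)" for x y using D1 D2 by simp
  ultimately show thesis using that[OF der] by simp
qed

lemma excess_functional_le:
  assumes t: "t > 0"
  shows "excess_functional t \<le> L\<^sup>2 / (4 * D) * excess_energy t" "0 \<le> excess_functional t"
proof -
  have one: "cell_integral L (\<lambda>p. 1 / 4 * (excess2 lo hi (c p))\<^sup>2) / Di \<le> L\<^sup>2 / (4 * D) * cell_integral L (\<lambda>p. excess2 lo hi (c p) * (g p \<bullet> g p))"
    if c: "C1 L c g" "continuous_on (closed_slab L) c" "\<And>p. p $ 1 = 0 \<or> p $ 1 = L \<Longrightarrow> lo \<le> c p \<and> c p \<le> hi" and Di: "D \<le> Di" for c g Di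
  proof -
    have S: "0 \<le> cell_integral L (\<lambda>p. excess2 lo hi (c p) * (g p \<bullet> g p))"
      by (intro ci_nonneg mult_nonneg_nonneg excess2_nonneg inner_ge_zero)
    have "1 / 4 * cell_integral L (\<lambda>p. (excess2 lo hi (c p))\<^sup>2) / Di \<le> 1 / 4 * (L\<^sup>2 * cell_integral L (\<lambda>p. excess2 lo hi (c p) * (g p \<bullet> g p))) / D"
      using D Di S by (intro frac_le mult_left_mono excess_poincare[OF L c(1,2) lo_hi c(3)]) auto
    then show ?thesis by (simp only: ci_cmult) (simp add: field_simps)
  qed
  show "excess_functional t \<le> L\<^sup>2 / (4 * D) * excess_energy t"
    unfolding excess_functional_def excess_energy_def distrib_left
    by (intro add_mono one ion1.c_C1 ion2.c_C1 ion1.c_continuous ion2.c_continuous t D)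
      (use boundary_between[OF t] in auto)
  show "0 \<le> excess_functional t"
    unfolding excess_functional_def using D1 D2 by (auto intro!: add_nonneg_nonneg divide_nonneg_pos ci_nonneg)
qed

lemma relative_entropy_integral:
  assumes t: "t > 0"
  defines "S \<equiv> cell_integral L (\<lambda>p. relative_entropy ca cb (c1 t p) (cs1 (p $ 1))) +
     cell_integral L (\<lambda>p. relative_entropy ca cb (c2 t p) (cs2 (p $ 1)))"
  shows "deviation t / (2 * cb) \<le> S" "S \<le> deviation t / (2 * ca)"
proof -
  note ac = cutoffs(1,3)
  have bc: "bcont L (\<lambda>p. relative_entropy ca cb (c p) (cs (p $ 1)))" if "bcont L c" "bcont L (\<lambda>p. cs (p $ 1))" for c cs
    unfolding relative_entropy_def[OF ac]
    by (intro bcont_intros bcont_compose_UNIV[OF _ cutoff_entropy_continuous[OF ac]] bcont_compose_UNIV[OF _ cutoff_ln_continuous[OF ac]] that)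
  note b = bcont_intros bconts[OF t] bc C1_bcont[OF steady.cs1_C1] C1_bcont[OF steady.cs2_C1]
  have "deviation t / (2 * cb) = cell_integral L (\<lambda>p. 1 / (2 * cb) * (d1 t p)\<^sup>2) + cell_integral L (\<lambda>p. 1 / (2 * cb) * (d2 t p)\<^sup>2)"
    by (simp only: ci_cmult) (simp add: deviation_def add_divide_distrib)
  also have "\<dots> \<le> S"
    unfolding S_def
  proof (intro add_mono ci_mono)
    show "1 / (2 * cb) * (d1 t p)\<^sup>2 \<le> relative_entropy ca cb (c1 t p) (cs1 (p $ 1))" for p
      using relative_entropy_bounds(1)[OF ac, of "c1 t p" "cs1 (p $ 1)"] by (simp add: d1_def)
    show "1 / (2 * cb) * (d2 t p)\<^sup>2 \<le> relative_entropy ca cb (c2 t p) (cs2 (p $ 1))" for p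
      using relative_entropy_bounds(1)[OF ac, of "c2 t p" "cs2 (p $ 1)"] by (simp add: d2_def)
  qed (intro b)+
  finally show "deviation t / (2 * cb) \<le> S" .
  have "S \<le> cell_integral L (\<lambda>p. 1 / (2 * ca) * (d1 t p)\<^sup>2) + cell_integral L (\<lambda>p. 1 / (2 * ca) * (d2 t p)\<^sup>2)"
    unfolding S_def
  proof (intro add_mono ci_mono)
    show "relative_entropy ca cb (c1 t p) (cs1 (p $ 1)) \<le> 1 / (2 * ca) * (d1 t p)\<^sup>2" for p
      using relative_entropy_bounds(2)[OF ac, of "c1 t p" "cs1 (p $ 1)"] by (simp add: d1_def)
    show "relative_entropy ca cb (c2 t p) (cs2 (p $ 1)) \<le> 1 / (2 * ca) * (d2 t p)\<^sup>2" for p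
      using relative_entropy_bounds(2)[OF ac, of "c2 t p" "cs2 (p $ 1)"] by (simp add: d2_def)
  qed (intro b)+
  also have "\<dots> = deviation t / (2 * ca)"
    by (simp only: ci_cmult) (simp add: deviation_def add_divide_distrib)
  finally show "S \<le> deviation t / (2 * ca)" .
qed

lemma energies_nonneg: "0 \<le> deviation t" "0 \<le> field_energy t" "0 \<le> kinetic t" "0 \<le> viscous t" "0 \<le> ionic t" "0 \<le> excess_energy t"
  unfolding deviation_def field_energy_def kinetic_def viscous_def ionic_def excess_energy_def
  by (intro add_nonneg_nonneg sum_nonneg ci_nonneg mult_nonneg_nonneg excess2_nonneg inner_ge_zero zero_le_power2)+

lemma entropy_le:
  assumes t: "t > 0"
  shows "entropy t \<le> (cb\<^sup>2 * L\<^sup>2 / (8 * ca) + cb * L\<^sup>2 / 16) * ionic t + L\<^sup>2 / (8 * K) * viscous t"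
proof -
  have cb: "cb > 0" using cutoffs by simp
  have "deviation t / (2 * cb) \<le> cb * L\<^sup>2 / 8 * ionic t"
    using coercivity[OF t] mult_nonneg_nonneg[OF less_imp_le[OF \<epsilon>] energies_nonneg(2)[of t]] by linarith
  then have "deviation t \<le> cb\<^sup>2 * L\<^sup>2 / 4 * ionic t"
    using cb by (simp add: field_simps power2_eq_square)
  then have "deviation t / (2 * ca) \<le> cb\<^sup>2 * L\<^sup>2 / 4 * ionic t / (2 * ca)"
    using cutoffs by (intro divide_right_mono) auto
  moreover have "\<epsilon> / 2 * field_energy t \<le> cb * L\<^sup>2 / 16 * ionic t"
    using coercivity[OF t] divide_nonneg_pos[OF energies_nonneg(1)[of t], of "2 * cb"] cb by simp
  moreover have "kinetic t / (2 * K) \<le> L\<^sup>2 / 4 * viscous t / (2 * K)"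
    using K kinetic_le[OF t] by (intro divide_right_mono) auto
  ultimately show ?thesis
    unfolding entropy_def using relative_entropy_integral(2)[OF t] by (simp add: distrib_right)
qed

text \<open>The cut-off entropy is quadratic in the deviation from below, and \<open>psi s \<le> (s - 1)\<^sup>2\<close> makes the
original entropy quadratic from above.\<close>

lemma steady_distance_le:
  assumes t: "t > 0"
  shows "steady_distance L cs1 cs2 \<Phi>s (c1 t) (c2 t) (u t) (\<Phi> t) \<le> (2 * cb / lo + 2 / \<epsilon> + 2 * K) * entropy t"
proof -
  note bc = bcont_intros bconts[OF t]
  have psi: "0 \<le> cs * psi (c / cs) \<and> cs * psi (c / cs) \<le> 1 / lo * (c - cs)\<^sup>2" if "0 \<le> c" "lo \<le> cs" for c cs
  proof -
    have cs: "0 < cs" using that lo by linarith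
    have "cs * psi (c / cs) \<le> cs * (c / cs - 1)\<^sup>2"
      using psi_le[of "c / cs"] that cs by (intro mult_left_mono) auto
    also have "\<dots> = (c - cs)\<^sup>2 / cs" using cs by (simp add: field_simps power2_eq_square)
    also have "\<dots> \<le> (c - cs)\<^sup>2 / lo" using that lo by (intro frac_le) auto
    finally show ?thesis using psi_le[of "c / cs"] that cs by simp
  qed
  have csb: "lo \<le> cs1 (p $ 1)" "lo \<le> cs2 (p $ 1)" if "p \<in> cell L" for p
    using cs_bounds[of "p $ 1"] that by (auto simp: cell_def)
  have "cell_integral L (\<lambda>p. cs1 (p $ 1) * psi (c1 t p / cs1 (p $ 1))) \<le> cell_integral L (\<lambda>p. 1 / lo * (d1 t p)\<^sup>2)"
  proof (rule ci_le_nonneg)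
    show "bcont L (\<lambda>p. 1 / lo * (d1 t p)\<^sup>2)" by (intro bc)
  qed (use psi[OF _ csb(1)] nonnegative[OF t] in \<open>auto simp: d1_def\<close>)
  moreover have "cell_integral L (\<lambda>p. cs2 (p $ 1) * psi (c2 t p / cs2 (p $ 1))) \<le> cell_integral L (\<lambda>p. 1 / lo * (d2 t p)\<^sup>2)"
  proof (rule ci_le_nonneg)
    show "bcont L (\<lambda>p. 1 / lo * (d2 t p)\<^sup>2)" by (intro bc)
  qed (use psi[OF _ csb(2)] nonnegative[OF t] in \<open>auto simp: d2_def\<close>)
  moreover have "cell_integral L (\<lambda>p. (norm (grad (\<lambda>q. \<Phi> t q - \<Phi>s (q $ 1)) p))\<^sup>2) = field_energy t"
    unfolding field_energy_def
    by (intro ci_cong) (simp add: grad_eq[OF \<phi>_C1[OF t, unfolded \<phi>_def[abs_def]]] power2_norm_eq_inner)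
  moreover have "cell_integral L (\<lambda>p. (norm (u t p))\<^sup>2) = kinetic t"
  proof -
    have "cell_integral L (\<lambda>p. (norm (u t p))\<^sup>2) = cell_integral L (\<lambda>p. \<Sum>i\<in>UNIV. (u t p $ i)\<^sup>2)"
      by (intro ci_cong) (simp add: norm_vec_def L2_set_def sum_nonneg)
    also have "\<dots> = kinetic t" unfolding kinetic_def by (rule ci_sum) (intro bc)
    finally show ?thesis .
  qed
  ultimately have "steady_distance L cs1 cs2 \<Phi>s (c1 t) (c2 t) (u t) (\<Phi> t) \<le> 1 / lo * deviation t + field_energy t + kinetic t"
    unfolding steady_distance_def cell_integral_def[symmetric] deviation_def distrib_left ci_cmult
    by linarith
  also have "\<dots> \<le> 2 * cb / lo * entropy t + 2 / \<epsilon> * entropy t + 2 * K * entropy t"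
  proof -
    have cb: "cb > 0" using cutoffs by simp
    let ?S = "cell_integral L (\<lambda>p. relative_entropy ca cb (c1 t p) (cs1 (p $ 1))) +
       cell_integral L (\<lambda>p. relative_entropy ca cb (c2 t p) (cs2 (p $ 1)))"
    have S: "deviation t / (2 * cb) \<le> ?S" by (rule relative_entropy_integral(1)[OF t])
    have nn: "0 \<le> deviation t / (2 * cb)" "0 \<le> \<epsilon> / 2 * field_energy t" "0 \<le> kinetic t / (2 * K)"
      using energies_nonneg cb \<epsilon> K by auto
    have e: "deviation t / (2 * cb) \<le> entropy t" "\<epsilon> / 2 * field_energy t \<le> entropy t" "kinetic t / (2 * K) \<le> entropy t"
      using S nn unfolding entropy_def by linarith+
    have "2 * cb / lo * (deviation t / (2 * cb)) \<le> 2 * cb / lo * entropy t"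
      using cb lo e by (intro mult_left_mono) auto
    moreover have "2 / \<epsilon> * (\<epsilon> / 2 * field_energy t) \<le> 2 / \<epsilon> * entropy t"
      using \<epsilon> e by (intro mult_left_mono) auto
    moreover have "2 * K * (kinetic t / (2 * K)) \<le> 2 * K * entropy t"
      using K e by (intro mult_left_mono) auto
    ultimately show ?thesis using cb lo \<epsilon> K by simp
  qed
  finally show ?thesis by (simp add: distrib_right)
qed

lemma steady_distance_nonneg:
  assumes t: "t > 0"
  shows "0 \<le> steady_distance L cs1 cs2 \<Phi>s (c1 t) (c2 t) (u t) (\<Phi> t)"
proof -
  have "0 < cs1 (p $ 1)" "0 < cs2 (p $ 1)" if "p \<in> cell L" for p
    using steady.steady_positive[of "p $ 1"] that by (auto simp: cell_def)
  then show ?thesis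
    unfolding steady_distance_def cell_integral_def[symmetric]
    using psi_le nonnegative[OF t]
    by (intro add_nonneg_nonneg ci_nonneg mult_nonneg_nonneg) (auto simp: less_imp_le)
qed

text \<open>\<open>A\<close> is so large that the excess functional dissipates more than the error term of the
entropy produces. The constants \<open>k1\<close>, \<open>k2\<close>, \<open>k3\<close> bound the functional by its own dissipation.\<close>

theorem steady_distance_decay:
  "\<exists>C>0. \<exists>\<kappa>>0. \<forall>t\<ge>1. steady_distance L cs1 cs2 \<Phi>s (c1 t) (c2 t) (u t) (\<Phi> t) \<le> C * exp (- \<kappa> * t)"
proof -
  obtain C where C: "C \<ge> 0" "\<And>t. t > 0 \<Longrightarrow> residual t \<le> C * excess_energy t"
    by (rule residual_le) blast
  define B where "B = 2 * (D1 + D2) / ca * C"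
  \<comment> \<open>The excess functional dissipates three times \<open>excess_energy\<close>: \<open>B\<close> of \<open>3 A = B + 1\<close> pays for the error term.\<close>
  define A where "A = (B + 1) / 3"
  define F where "F t = entropy t + A * excess_functional t" for t
  have B: "B \<ge> 0" using C D1 D2 cutoffs by (simp add: B_def)
  then have A: "A > 0" by (simp add: A_def)
  define k1 where "k1 = cb\<^sup>2 * L\<^sup>2 / (8 * ca) + cb * L\<^sup>2 / 16"
  define k2 where "k2 = L\<^sup>2 / (8 * K)"
  define k3 where "k3 = A * (L\<^sup>2 / (4 * D))"
  have k: "k1 > 0" "k2 > 0" "k3 > 0"
    using L K A D cutoffs by (auto simp: k1_def k2_def k3_def intro!: add_pos_pos divide_pos_pos mult_pos_pos)
  define m where "m = min (D * lo / 20) (min (\<nu> / (2 * K)) 1)"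
  have m: "m > 0" "m \<le> D * lo / 20" "m \<le> \<nu> / (2 * K)" "m \<le> 1"
    using D lo \<nu> K by (auto simp: m_def)
  define \<kappa> where "\<kappa> = m / (k1 + k2 + k3)"
  have \<kappa>: "\<kappa> > 0" using m k by (simp add: \<kappa>_def)
  have rate: "\<exists>y. (F has_real_derivative y) (at t) \<and> y \<le> - \<kappa> * F t" if "t \<ge> 1" for t
  proof -
    have t: "t > 0" using that by simp
    obtain y1 where y1: "(entropy has_real_derivative y1) (at t)" "y1 \<le> 2 * (D1 + D2) / ca * residual t - dissipation_rate t"
      by (rule entropy_decay[OF t]) blast
    obtain y2 where y2: "(excess_functional has_real_derivative y2) (at t)" "y2 \<le> - 3 * excess_energy t"
      by (rule excess_decay[OF t]) blast
    have der: "(F has_real_derivative y1 + A * y2) (at t)"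
      unfolding F_def[abs_def] by (intro DERIV_add DERIV_cmult y1 y2)
    have "2 * (D1 + D2) / ca * residual t \<le> B * excess_energy t"
      using mult_left_mono[OF C(2)[OF t], of "2 * (D1 + D2) / ca"] D1 D2 cutoffs by (simp add: B_def)
    moreover have "A * y2 \<le> - (B + 1) * excess_energy t"
    proof -
      have "A * y2 \<le> A * (- 3 * excess_energy t)" using y2(2) A by (intro mult_left_mono) auto
      also have "\<dots> = - (B + 1) * excess_energy t" by (simp add: A_def algebra_simps)
      finally show ?thesis .
    qed
    ultimately have "y1 + A * y2 \<le> - (dissipation_rate t + excess_energy t)"
      using y1(2) by (simp add: algebra_simps)
    also have "\<dots> \<le> - (m * (ionic t + viscous t + excess_energy t))"
    proof -
      have "m * ionic t \<le> D * lo / 20 * ionic t" "m * viscous t \<le> \<nu> / (2 * K) * viscous t" "m * excess_energy t \<le> 1 * excess_energy t"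
        using m energies_nonneg by (intro mult_right_mono; simp)+
      then show ?thesis by (simp add: dissipation_rate_def distrib_left)
    qed
    also have "\<dots> \<le> - (\<kappa> * F t)"
    proof -
      have "F t \<le> k1 * ionic t + k2 * viscous t + k3 * excess_energy t"
        using entropy_le[OF t] mult_left_mono[OF excess_functional_le(1)[OF t], of A] A
        by (simp add: F_def k1_def k2_def k3_def mult.assoc)
      also have "\<dots> \<le> (k1 + k2 + k3) * ionic t + (k1 + k2 + k3) * viscous t + (k1 + k2 + k3) * excess_energy t"
        using k energies_nonneg by (intro add_mono mult_right_mono) auto
      finally have "\<kappa> * F t \<le> \<kappa> * ((k1 + k2 + k3) * (ionic t + viscous t + excess_energy t))"
        using \<kappa> by (intro mult_left_mono) (auto simp: distrib_left)
      then show ?thesis using k by (simp add: \<kappa>_def)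
    qed
    finally show ?thesis using der by auto
  qed
  define c where "c = 2 * cb / lo + 2 / \<epsilon> + 2 * K"
  have c: "c > 0" using cutoffs lo \<epsilon> K by (auto simp: c_def intro!: add_pos_pos)
  have bound: "steady_distance L cs1 cs2 \<Phi>s (c1 t) (c2 t) (u t) (\<Phi> t) \<le> (c * (\<bar>F 1\<bar> * exp \<kappa>) + 1) * exp (- \<kappa> * t)" if "t \<ge> 1" for t
  proof -
    have t: "t > 0" using that by simp
    have "steady_distance L cs1 cs2 \<Phi>s (c1 t) (c2 t) (u t) (\<Phi> t) \<le> c * entropy t"
      unfolding c_def by (rule steady_distance_le[OF t])
    also have "\<dots> \<le> c * F t"
      using c A excess_functional_le(2)[OF t] by (simp add: F_def)
    also have "\<dots> \<le> c * (F 1 * exp \<kappa> * exp (- \<kappa> * t))"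
      using c exponential_decay[of F \<kappa> t, OF rate that] by (intro mult_left_mono) auto
    also have "\<dots> \<le> c * (\<bar>F 1\<bar> * exp \<kappa> * exp (- \<kappa> * t))"
      using c by (intro mult_left_mono mult_right_mono) auto
    also have "\<dots> \<le> (c * (\<bar>F 1\<bar> * exp \<kappa>) + 1) * exp (- \<kappa> * t)"
      by (simp add: distrib_right)
    finally show ?thesis .
  qed
  moreover have "c * (\<bar>F 1\<bar> * exp \<kappa>) + 1 > 0" using c by (simp add: add_nonneg_pos)
  ultimately show ?thesis using \<kappa> by blast
qed

end

section \<open>Global stability\<close>

lemma smallness:
  assumes pos: "L > 0" "D > 0" "Di > 0" "\<nu> > 0" "K > 0" "\<gamma>lo > 0" "\<gamma>hi > 0"
    and small: "\<bar>j\<bar> * L * G_const L D Di \<nu> K \<gamma>lo \<gamma>hi < 1 / sqrt 2"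
  shows "j\<^sup>2 * (Di / (2 * \<gamma>lo ^ 3) + K * L\<^sup>2 / (\<nu> * \<gamma>lo\<^sup>2)) \<le> D * \<gamma>lo / (2 * L\<^sup>2 * \<gamma>hi\<^sup>2)"
proof -
  let ?X = "Di * \<gamma>hi\<^sup>2 / (2 * \<gamma>lo ^ 4) + K * L\<^sup>2 * \<gamma>hi\<^sup>2 / (\<nu> * \<gamma>lo ^ 3)"
  let ?Y = "Di / (2 * \<gamma>lo ^ 3) + K * L\<^sup>2 / (\<nu> * \<gamma>lo\<^sup>2)"
  have X: "?X = \<gamma>hi\<^sup>2 / \<gamma>lo * ?Y"
    using pos by (simp add: field_simps power2_eq_square eval_nat_numeral)
  have nn: "0 \<le> 1 / D * ?X" using pos by (intro mult_nonneg_nonneg add_nonneg_nonneg) auto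
  have "(\<bar>j\<bar> * L * G_const L D Di \<nu> K \<gamma>lo \<gamma>hi)\<^sup>2 \<le> (1 / sqrt 2)\<^sup>2"
    using small nn pos unfolding G_const_def by (intro power_mono) auto
  then have "j\<^sup>2 * L\<^sup>2 * (1 / D * ?X) \<le> 1 / 2"
    using nn unfolding G_const_def by (simp add: power_mult_distrib power_divide)
  then have "j\<^sup>2 * L\<^sup>2 * (1 / D * (\<gamma>hi\<^sup>2 / \<gamma>lo * ?Y)) \<le> 1 / 2" unfolding X .
  then have "(j\<^sup>2 * ?Y) * (L\<^sup>2 * \<gamma>hi\<^sup>2 / (D * \<gamma>lo)) \<le> 1 / 2"
    by (simp add: mult_ac)
  then have "j\<^sup>2 * ?Y \<le> 1 / 2 / (L\<^sup>2 * \<gamma>hi\<^sup>2 / (D * \<gamma>lo))"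
    using pos by (subst pos_le_divide_eq) auto
  then show ?thesis by simp
qed

theorem theorem5:
  fixes L D1 D2 \<epsilon> \<nu> K \<alpha>1 \<alpha>2 \<beta>1 \<beta>2 V j1 j2 D \<gamma>lo \<gamma>hi :: real
    and cs1 cs2 \<Phi>s :: "real \<Rightarrow> real"
  assumes "L > 0" "D1 > 0" "D2 > 0" "\<epsilon> > 0" "\<nu> > 0" "K > 0"
    and "\<alpha>1 > 0" "\<alpha>2 > 0" "\<beta>1 > 0" "\<beta>2 > 0" "V > 0"
    and steady: "steady_current L \<epsilon> \<alpha>1 \<alpha>2 \<beta>1 \<beta>2 V cs1 cs2 \<Phi>s"
    and j1: "\<forall>x\<in>{0<..<L}. p_flux cs1 \<Phi>s x = j1"
    and j2: "\<forall>x\<in>{0<..<L}. n_flux cs2 \<Phi>s x = j2"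
    and D: "D = min D1 D2"
    and \<gamma>lo: "\<gamma>lo = Min {\<alpha>1, \<alpha>2, \<beta>1, \<beta>2}"
    and \<gamma>hi: "\<gamma>hi = Max {\<alpha>1, \<alpha>2, \<beta>1, \<beta>2}"
    and small: "max (\<bar>j1\<bar> * L * G_const L D D1 \<nu> K \<gamma>lo \<gamma>hi)
                    (\<bar>j2\<bar> * L * G_const L D D2 \<nu> K \<gamma>lo \<gamma>hi) < 1 / sqrt 2"
  shows "\<forall>c10 c20 u0. smooth_initial_data L c10 c20 u0 \<longrightarrow>
    (\<forall>c1 c2 u \<Phi> pr.
       nps_solution L D1 D2 \<epsilon> \<nu> K \<alpha>1 \<alpha>2 \<beta>1 \<beta>2 V c10 c20 u0 c1 c2 u \<Phi> pr \<longrightarrow>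
       ((\<lambda>t. steady_distance L cs1 cs2 \<Phi>s (c1 t) (c2 t) (u t) (\<Phi> t)) \<longlongrightarrow> 0) at_top) \<and>
    (\<exists>T>0. \<forall>c1 c2 u \<Phi> pr.
       nps_solution L D1 D2 \<epsilon> \<nu> K \<alpha>1 \<alpha>2 \<beta>1 \<beta>2 V c10 c20 u0 c1 c2 u \<Phi> pr \<longrightarrow>
       (\<exists>C>0. \<exists>\<kappa>>0. \<forall>t\<ge>T.
          steady_distance L cs1 cs2 \<Phi>s (c1 t) (c2 t) (u t) (\<Phi> t) \<le> C * exp (- \<kappa> * t)))"
proof -
  have lo: "\<gamma>lo > 0" and hi: "\<gamma>hi > 0" using assms(7-10) by (simp_all add: \<gamma>lo \<gamma>hi less_max_iff_disj)
  have Dpos: "D > 0" using assms(2,3) D by simp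
  interpret st: steady_fields L \<epsilon> \<gamma>lo \<gamma>hi j1 j2 cs1 cs2 \<Phi>s "deriv \<Phi>s"
    unfolding \<gamma>lo \<gamma>hi by (rule steady_current_fields[OF assms(1,4,7-10) steady j1 j2])
  have near: "nps_near_steady L D1 D2 \<epsilon> \<nu> K \<alpha>1 \<alpha>2 \<beta>1 \<beta>2 V c10 c20 u0 c1 c2 u \<Phi> pr \<gamma>lo \<gamma>hi j1 j2 cs1 cs2 \<Phi>s (deriv \<Phi>s) D"
    if "smooth_initial_data L c10 c20 u0" "nps_solution L D1 D2 \<epsilon> \<nu> K \<alpha>1 \<alpha>2 \<beta>1 \<beta>2 V c10 c20 u0 c1 c2 u \<Phi> pr" for c10 c20 u0 c1 c2 u \<Phi> pr
  proof (intro nps_near_steady.intro nps_flow.intro nps_near_steady_axioms.intro st.steady_fields_axioms that)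
    show "j1\<^sup>2 * (D1 / (2 * \<gamma>lo ^ 3) + K * L\<^sup>2 / (\<nu> * \<gamma>lo\<^sup>2)) \<le> D * \<gamma>lo / (2 * L\<^sup>2 * \<gamma>hi\<^sup>2)"
      by (rule smallness[OF assms(1) Dpos assms(2,5,6) lo hi]) (use small in simp)
    show "j2\<^sup>2 * (D2 / (2 * \<gamma>lo ^ 3) + K * L\<^sup>2 / (\<nu> * \<gamma>lo\<^sup>2)) \<le> D * \<gamma>lo / (2 * L\<^sup>2 * \<gamma>hi\<^sup>2)"
      by (rule smallness[OF assms(1) Dpos assms(3,5,6) lo hi]) (use small in simp)
  next
    show "cs1 0 = \<alpha>1" "cs1 L = \<beta>1" "cs2 0 = \<alpha>2" "cs2 L = \<beta>2" "\<Phi>s 0 = - V" "\<Phi>s L = 0"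
      using steady by (simp_all add: steady_current_def)
    show "D \<le> D1" "D \<le> D2" using D by simp_all
  qed (fact assms Dpos)+
  have lim: "((\<lambda>t. steady_distance L cs1 cs2 \<Phi>s (c1 t) (c2 t) (u t) (\<Phi> t)) \<longlongrightarrow> 0) at_top"
    if sol: "smooth_initial_data L c10 c20 u0" "nps_solution L D1 D2 \<epsilon> \<nu> K \<alpha>1 \<alpha>2 \<beta>1 \<beta>2 V c10 c20 u0 c1 c2 u \<Phi> pr" for c10 c20 u0 c1 c2 u \<Phi> pr
  proof -
    interpret nps_near_steady L D1 D2 \<epsilon> \<nu> K \<alpha>1 \<alpha>2 \<beta>1 \<beta>2 V c10 c20 u0 c1 c2 u \<Phi> pr \<gamma>lo \<gamma>hi j1 j2 cs1 cs2 \<Phi>s "deriv \<Phi>s" D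
      by (rule near[OF sol])
    obtain C \<kappa> where C: "\<kappa> > 0" "\<And>t. t \<ge> 1 \<Longrightarrow> steady_distance L cs1 cs2 \<Phi>s (c1 t) (c2 t) (u t) (\<Phi> t) \<le> C * exp (- \<kappa> * t)"
      using steady_distance_decay by blast
    show ?thesis
    proof (rule tendsto_sandwich)
      show "\<forall>\<^sub>F t in at_top. 0 \<le> steady_distance L cs1 cs2 \<Phi>s (c1 t) (c2 t) (u t) (\<Phi> t)"
        using eventually_gt_at_top[of 0] by eventually_elim (rule steady_distance_nonneg)
      show "\<forall>\<^sub>F t in at_top. steady_distance L cs1 cs2 \<Phi>s (c1 t) (c2 t) (u t) (\<Phi> t) \<le> C * exp (- \<kappa> * t)"
        using eventually_ge_at_top[of 1] by eventually_elim (rule C)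
      have "filterlim (\<lambda>t. - \<kappa> * t) at_bot at_top"
        by (rule filterlim_tendsto_neg_mult_at_bot[OF tendsto_const _ filterlim_ident]) (use C(1) in simp)
      from tendsto_mult[OF tendsto_const filterlim_compose[OF exp_at_bot this], of C]
      have "((\<lambda>t. C * exp (- \<kappa> * t)) \<longlongrightarrow> C * 0) at_top" .
      then show "((\<lambda>t. C * exp (- \<kappa> * t)) \<longlongrightarrow> 0) at_top" by simp
    qed simp
  qed
  \<comment> \<open>The decay estimate holds from time 1 on for every solution, so \<open>T\<close> need not depend on the data.\<close>
  have "\<exists>T>0. \<forall>c1 c2 u \<Phi> pr.
       nps_solution L D1 D2 \<epsilon> \<nu> K \<alpha>1 \<alpha>2 \<beta>1 \<beta>2 V c10 c20 u0 c1 c2 u \<Phi> pr \<longrightarrow>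
       (\<exists>C>0. \<exists>\<kappa>>0. \<forall>t\<ge>T. steady_distance L cs1 cs2 \<Phi>s (c1 t) (c2 t) (u t) (\<Phi> t) \<le> C * exp (- \<kappa> * t))"
    if init: "smooth_initial_data L c10 c20 u0" for c10 c20 u0
    using nps_near_steady.steady_distance_decay[OF near[OF init]] zero_less_one by blast
  with lim show ?thesis by blast
qed

end
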